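(* There is a randomized algorithm that, given an undirected graph $G$ with $n$ vertices, a positive integer $\ell$, and a tree decomposition of $G$ of width ${\rm tw}$, decides in time $6^{{\rm tw}}\cdot n^{\mathcal{O}(1)}$ whether there exists a set $X\subseteq V(G)$ with $|X|\ge \ell$ such that $G[X]$ is a forest and $G[X]$ contains a perfect matching (the Acyclic Matching problem). The algorithm never gives false positives (a "yes" answer is always correct) and gives a false negative with probability at most $\frac{1}{3}$.
   Context: $G[X]$ denotes the subgraph of $G$ induced by $X$. A tree decomposition of $G$ is a pair $(\mathbb{T},\{\mathcal{B}_x\}_{x\in V(\mathbb{T})})$ where $\mathbb{T}$ is a tree and the bags $\mathcal{B}_x\subseteq V(G)$ satisfy: every vertex lies in some bag; for every edge $uv$ some bag contains both $u$ and $v$; and for every vertex $v$ the nodes whose bags contain $v$ form a connected subtree. Its width is the maximum bag size minus one. *)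

theory Defs
  imports "HOL-Probability.Probability" "HOL-Library.Log_Nat"
begin

section \<open>Graphs and tree decompositions\<close>

text \<open>
  Undirected graphs are not taken from AFP Graph_Theory: that library models them as
  symmetric digraphs, in which a single undirected edge already forms a directed cycle, so its
  notions of forest and tree are not the undirected ones.
\<close>

record 'a ugraph =
  verts :: "'a set"
  edges :: "'a set set"

definition fin_ugraph :: "'a ugraph \<Rightarrow> bool" where
  "fin_ugraph G \<longleftrightarrow> finite (verts G) \<and> (\<forall>e\<in>edges G. e \<subseteq> verts G \<and> card e = 2)"

definition induced :: "'a ugraph \<Rightarrow> 'a set \<Rightarrow> 'a ugraph" where
  "induced G X = \<lparr>verts = X, edges = {e \<in> edges G. e \<subseteq> X}\<rparr>"

definition ucycle :: "'a ugraph \<Rightarrow> 'a list \<Rightarrow> bool" where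
  "ucycle G p \<longleftrightarrow> length p \<ge> 3 \<and> distinct p \<and> set p \<subseteq> verts G \<and>
     (\<forall>i. Suc i < length p \<longrightarrow> {p ! i, p ! Suc i} \<in> edges G) \<and> {last p, hd p} \<in> edges G"

definition uforest :: "'a ugraph \<Rightarrow> bool" where
  "uforest G \<longleftrightarrow> (\<nexists>p. ucycle G p)"

definition uconnected :: "'a ugraph \<Rightarrow> bool" where
  "uconnected G \<longleftrightarrow> verts G \<noteq> {} \<and>
     (\<forall>u\<in>verts G. \<forall>v\<in>verts G. (u, v) \<in> {(a, b). {a, b} \<in> edges G}\<^sup>*)"

definition utree :: "'a ugraph \<Rightarrow> bool" where
  "utree G \<longleftrightarrow> fin_ugraph G \<and> uconnected G \<and> uforest G"

definition has_perfect_matching :: "'a ugraph \<Rightarrow> bool" where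
  "has_perfect_matching G \<longleftrightarrow> (\<exists>M \<subseteq> edges G. \<forall>v\<in>verts G. \<exists>!e. e \<in> M \<and> v \<in> e)"

definition tree_decomposition :: "'a ugraph \<Rightarrow> 'b ugraph \<Rightarrow> ('b \<Rightarrow> 'a set) \<Rightarrow> bool" where
  "tree_decomposition G T B \<longleftrightarrow> utree T \<and>
     (\<forall>x\<in>verts T. B x \<subseteq> verts G) \<and>
     (\<forall>v\<in>verts G. \<exists>x\<in>verts T. v \<in> B x) \<and>
     (\<forall>e\<in>edges G. \<exists>x\<in>verts T. e \<subseteq> B x) \<and>
     (\<forall>v\<in>verts G. uconnected (induced T {x \<in> verts T. v \<in> B x}))"

text \<open>
  The subtraction truncates only when all bags are empty, i.e. for the graph without
  vertices, whose width is then 0 instead of -1.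
\<close>
definition width :: "'b ugraph \<Rightarrow> ('b \<Rightarrow> 'a set) \<Rightarrow> nat" where
  "width T B = Max ((\<lambda>x. card (B x)) ` verts T) - 1"

definition acyclic_matching :: "'a ugraph \<Rightarrow> nat \<Rightarrow> bool" where
  "acyclic_matching G l \<longleftrightarrow> (\<exists>X \<subseteq> verts G. card X \<ge> l \<and>
     uforest (induced G X) \<and> has_perfect_matching (induced G X))"


section \<open>Randomized random access machines with logarithmic cost\<close>

text \<open>
  Algorithms are programs of a deeply embedded structured language over a random access memory:
  named arrays of natural numbers, with computed indices. Time is measured by the logarithmic
  cost criterion: every operation pays for the binary lengths of the numbers and indices it
  handles. Hence unit-cost arithmetic on huge numbers cannot be exploited, and the exponential
  base of a running time is meaningful.
\<close>

datatype binop = Plus | Minus | Times | Quotient | Remainder | Less | Equal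

datatype expr =
    Const nat
  | Get string expr              \<comment> \<open>array, index\<close>
  | Op binop expr expr

datatype com =
    Skip
  | Put string expr expr         \<comment> \<open>array, index, value\<close>
  | Flip string expr             \<comment> \<open>store the outcome (0 or 1) of a fair coin at array, index\<close>
  | Seq com com
  | Cond expr com com            \<comment> \<open>nonzero means true\<close>
  | Loop expr com

type_synonym memory = "string \<Rightarrow> nat \<Rightarrow> nat"

fun apply_op :: "binop \<Rightarrow> nat \<Rightarrow> nat \<Rightarrow> nat" where
  "apply_op Plus a b = a + b"
| "apply_op Minus a b = a - b"
| "apply_op Times a b = a * b"
| "apply_op Quotient a b = a div b"
| "apply_op Remainder a b = a mod b"
| "apply_op Less a b = (if a < b then 1 else 0)"
| "apply_op Equal a b = (if a = b then 1 else 0)"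

fun val :: "expr \<Rightarrow> memory \<Rightarrow> nat" where
  "val (Const k) m = k"
| "val (Get a i) m = m a (val i m)"
| "val (Op f e e') m = apply_op f (val e m) (val e' m)"

abbreviation bits :: "nat \<Rightarrow> nat" where
  "bits k \<equiv> floorlog 2 k"

fun cost :: "expr \<Rightarrow> memory \<Rightarrow> nat" where
  "cost (Const k) m = 1 + bits k"
| "cost (Get a i) m = cost i m + 1 + bits (val i m) + bits (m a (val i m))"
| "cost (Op f e e') m = cost e m + cost e' m + 1 + bits (val e m) + bits (val e' m)
     + bits (apply_op f (val e m) (val e' m))"

definition update :: "memory \<Rightarrow> string \<Rightarrow> nat \<Rightarrow> nat \<Rightarrow> memory" where
  "update m a i k = m(a := (m a)(i := k))"

text \<open>
  \<open>exec c (m, w) t (m', w')\<close>: started in memory \<open>m\<close>, with \<open>w\<close> the outcomes of the coin tosses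
  still to come, \<open>c\<close> terminates after time \<open>t\<close> in memory \<open>m'\<close>, leaving the coin tosses \<open>w'\<close>.
\<close>
inductive exec :: "com \<Rightarrow> memory \<times> bool stream \<Rightarrow> nat \<Rightarrow> memory \<times> bool stream \<Rightarrow> bool" where
  Skip: "exec Skip (m, w) 1 (m, w)"
| Put: "exec (Put a i e) (m, w)
     (cost i m + cost e m + 1 + bits (val i m) + bits (val e m))
     (update m a (val i m) (val e m), w)"
| Flip: "exec (Flip a i) (m, w) (cost i m + 1 + bits (val i m))
     (update m a (val i m) (if shd w then 1 else 0), stl w)"
| Seq: "exec c s t s' \<Longrightarrow> exec c' s' t' s'' \<Longrightarrow> exec (Seq c c') s (t + t') s''"
| Cond_true: "val e m \<noteq> 0 \<Longrightarrow> exec c (m, w) t s \<Longrightarrow>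
     exec (Cond e c c') (m, w) (cost e m + 1 + t) s"
| Cond_false: "val e m = 0 \<Longrightarrow> exec c' (m, w) t s \<Longrightarrow>
     exec (Cond e c c') (m, w) (cost e m + 1 + t) s"
| Loop_true: "val e m \<noteq> 0 \<Longrightarrow> exec c (m, w) t s \<Longrightarrow> exec (Loop e c) s t' s' \<Longrightarrow>
     exec (Loop e c) (m, w) (cost e m + 1 + t + t') s'"
| Loop_false: "val e m = 0 \<Longrightarrow> exec (Loop e c) (m, w) (cost e m + 1) (m, w)"

inductive_cases SkipE: "exec Skip s t s'"
inductive_cases PutE: "exec (Put a i e) s t s'"
inductive_cases FlipE: "exec (Flip a i) s t s'"
inductive_cases SeqE: "exec (Seq c c') s t s'"
inductive_cases CondE: "exec (Cond e c c') s t s'"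
inductive_cases LoopE: "exec (Loop e c) s t s'"

lemma exec_deterministic:
  assumes "exec c s t1 s1" "exec c s t2 s2"
  shows "t1 = t2 \<and> s1 = s2"
  using assms
proof (induction arbitrary: t2 s2 rule: exec.induct)
  case Skip
  then show ?case by (rule SkipE) simp
next
  case Put
  then show ?case by (rule PutE) simp
next
  case Flip
  then show ?case by (rule FlipE) simp
next
  case (Seq c s t s' c' t' s'')
  from Seq.prems obtain u r u' where
    t2: "t2 = u + u'" and run: "exec c s u r" and run': "exec c' r u' s2"
    by (rule SeqE)
  from Seq.IH(1)[OF run] have "t = u" and r: "s' = r" by simp_all
  moreover from Seq.IH(2)[of u' s2] run' r have "t' = u' \<and> s'' = s2" by simp
  ultimately show ?case using t2 by simp
next
  case (Cond_true e m c w t s c')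
  from Cond_true.prems obtain u where
    t2: "t2 = cost e m + 1 + u" and run: "exec c (m, w) u s2"
    by (rule CondE) (use Cond_true.hyps in simp_all)
  from Cond_true.IH[OF run] t2 show ?case by simp
next
  case (Cond_false e m c' w t s c)
  from Cond_false.prems obtain u where
    t2: "t2 = cost e m + 1 + u" and run: "exec c' (m, w) u s2"
    by (rule CondE) (use Cond_false.hyps in simp_all)
  from Cond_false.IH[OF run] t2 show ?case by simp
next
  case (Loop_true e m c w t s t' s')
  from Loop_true.prems obtain u r u' where
    t2: "t2 = cost e m + 1 + u + u'"
    and run: "exec c (m, w) u r" and run': "exec (Loop e c) r u' s2"
    by (rule LoopE) (use Loop_true.hyps(1) in simp_all)
  from Loop_true.IH(1)[OF run] have "t = u" and r: "s = r" by simp_all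
  moreover from Loop_true.IH(2)[of u' s2] run' r have "t' = u' \<and> s' = s2" by simp
  ultimately show ?case using t2 by simp
next
  case Loop_false
  from Loop_false.prems show ?case by (rule LoopE) (use Loop_false.hyps in simp_all)
qed

definition halts_within :: "com \<Rightarrow> memory \<Rightarrow> bool stream \<Rightarrow> nat \<Rightarrow> bool" where
  "halts_within P m w b \<longleftrightarrow> (\<exists>t m' w'. exec P (m, w) t (m', w') \<and> t \<le> b)"

definition accepts :: "com \<Rightarrow> memory \<Rightarrow> bool stream \<Rightarrow> bool" where
  "accepts P m w \<longleftrightarrow> (\<exists>t m' w'. exec P (m, w) t (m', w') \<and> m' ''out'' 0 \<noteq> 0)"

definition coin_flips :: "bool stream measure" where
  "coin_flips = stream_space (measure_pmf (pmf_of_set (UNIV :: bool set)))"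


section \<open>Encoding of instances\<close>

text \<open>
  Instances have vertex sets \<open>{..<n}\<close> and \<open>{..<N}\<close> for the graph and the decomposition tree.
  Edges and bags are given as 0/1 matrices, stored row by row. The number \<open>l\<close> is given by its
  binary digits, least significant first, each incremented by one, so that the first 0 marks
  the end; a program can therefore detect \<open>l > n\<close> without reading an arbitrarily long number.
\<close>
definition instance_memory ::
    "nat ugraph \<Rightarrow> nat \<Rightarrow> nat ugraph \<Rightarrow> (nat \<Rightarrow> nat set) \<Rightarrow> memory" where
  "instance_memory G l T B =
    (let n = card (verts G); N = card (verts T) in
     (\<lambda>a i. 0)
       (''n'' := (\<lambda>i. if i = 0 then n else 0),
        ''graph'' := (\<lambda>i. if {i div n, i mod n} \<in> edges G then 1 else 0),
        ''l'' := (\<lambda>i. if i < bits l then 1 + (l div 2 ^ i) mod 2 else 0),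
        ''nodes'' := (\<lambda>i. if i = 0 then N else 0),
        ''tree'' := (\<lambda>i. if {i div N, i mod N} \<in> edges T then 1 else 0),
        ''bags'' := (\<lambda>i. if i div n \<in> verts T \<and> i mod n \<in> B (i div n) then 1 else 0)))"

text \<open>
  The decomposition is part of the input, so running times are polynomial in the number \<open>n\<close>
  of vertices and the number \<open>N\<close> of nodes of the decomposition. For decompositions with
  polynomially many nodes such bounds are polynomial in \<open>n\<close> alone:
\<close>
lemma bound_in_vertices_only:
  fixes C tw n N a k c :: nat
  assumes "N \<le> a * n ^ k" and "n \<ge> 1"
  shows "C * 6 ^ tw * (n + N) ^ c \<le> (C * (1 + a) ^ c) * 6 ^ tw * n ^ (Suc k * c)"
proof -
  have "n ^ 1 \<le> n ^ Suc k" "n ^ k \<le> n ^ Suc k"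
    using assms(2) by (intro power_increasing; simp)+
  then have "n \<le> n ^ Suc k" "a * n ^ k \<le> a * n ^ Suc k"
    by (simp_all only: power_one_right mult_le_mono2)
  with assms(1) have "n + N \<le> (1 + a) * n ^ Suc k"
    unfolding distrib_right mult_1 by linarith
  then have "(n + N) ^ c \<le> ((1 + a) * n ^ Suc k) ^ c"
    by (rule power_mono) simp
  also have "\<dots> = (1 + a) ^ c * n ^ (Suc k * c)"
    by (simp only: power_mult_distrib power_mult)
  finally have "C * 6 ^ tw * (n + N) ^ c \<le> C * 6 ^ tw * ((1 + a) ^ c * n ^ (Suc k * c))"
    by (rule mult_le_mono2)
  then show ?thesis
    by (simp only: mult.assoc mult.left_commute)
qed

end

theory Submission
  imports Defs
begin

text \<open>
  A Cut and Count argument over the integers. For a set \<open>X\<close> of vertices and a set \<open>M\<close> of edges of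
  \<open>G[X]\<close> count the cuts: the subsets \<open>C\<close> of \<^emph>\<open>all\<close> vertices that separate no edge of \<open>G[X]\<close>.
  If \<open>b\<close> is the number of edges of \<open>G[X]\<close>, this number is \<open>2 ^ (n - b)\<close> for a forest and divisible
  by \<open>2 ^ (n - b + 1)\<close> otherwise. Weighting each vertex of \<open>X\<close> that is not covered by \<open>M\<close> with
  \<open>2 ^ (n + 1)\<close>, the terms with \<open>M\<close> not covering \<open>X\<close> vanish modulo \<open>2 ^ (n - b + 1)\<close> as well, and a
  cover with \<open>|X| = 2 |M|\<close> is a perfect matching. So, for random edge weights, if \<open>M\<close> of least weight
  is unique, the coefficient of the monomial recording \<open>|X|\<close>, \<open>b\<close>, \<open>|M|\<close> and the weight of \<open>M\<close> is
  nonzero modulo \<open>2 ^ (n - b + 1)\<close>; and a nonzero coefficient is always caused by a solution.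

  The factor \<open>2 ^ (n + 1)\<close> is split as \<open>(2 ^ (n + 1) - 1) + 1\<close>, according to whether an uncovered vertex
  belongs to an additional set \<open>Y \<subseteq> X\<close> with \<open>M \<subseteq> E(G[Y])\<close>. Then the generating function is a sum over
  assignments of 6 states to the vertices of products of factors of single vertices and edges, hence
  joining two tables of the dynamic program is a pointwise product. Polynomials are represented by
  their values at a power of two (Kronecker substitution).
\<close>

section \<open>Cuts and forests\<close>

text \<open>The number of cuts is two to the number of connected components of the graph on all
  \<open>n\<close> vertices with the edges of G[X]. There are at least \<open>n - b\<close>
  components, with equality exactly for forests; a modulus that depends on \<open>b\<close>
  therefore forces \<open>b\<close> into the monomial. Isolation acts on M alone, because in a
  solution X is the set of ends of M; hence only the pair numbers below \<open>n * n\<close> need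
  random weights. To spend only 6 states per vertex of a bag, no join may convolve tables: every
  vertex and edge factor is given to exactly one bag, and a node sends to its parent a table over
  their common vertices only. In this way an arbitrary tree decomposition is used directly, without
  normalising it first. Since the machine pays for the length of numbers, the integer that stands
  for a polynomial must have polynomially many bits: the weights are polynomially bounded, four
  exponents are packed into one by a polynomial radix \<open>D\<close>, and the tables are kept
  modulo \<open>2 ^ (slot n * D ^ 4)\<close>, which exceeds the final value.\<close>

definition edge_rel :: "'a set set \<Rightarrow> ('a \<times> 'a) set" where
  "edge_rel F = {(a, b). {a, b} \<in> F}"

text \<open>For edges inside \<open>V\<close> these are the unions of connected components.
  Components themselves are never defined: the two lemmas on inserting an edge, which keep or halve
  the number of cuts, take over their counting.\<close>

definition cuts :: "'a set \<Rightarrow> 'a set set \<Rightarrow> 'a set set" where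
  "cuts V F = {C. C \<subseteq> V \<and> (\<forall>e\<in>F. e \<subseteq> C \<or> e \<inter> C = {})}"

lemma cutsD_rtrancl:
  assumes "(u, v) \<in> (edge_rel F)\<^sup>*" "C \<in> cuts V F"
  shows "u \<in> C \<longleftrightarrow> v \<in> C"
  using assms(1)
proof induction
  case (step y z)
  then have "{y, z} \<in> F" by (simp add: edge_rel_def)
  moreover from assms(2) have "\<forall>e\<in>F. e \<subseteq> C \<or> e \<inter> C = {}" by (simp add: cuts_def)
  ultimately have "{y, z} \<subseteq> C \<or> {y, z} \<inter> C = {}" by (rule bspec[rotated])
  with step.IH show ?case by auto
qed simp

text \<open>A set that separates no edge of \<open>F\<close> cannot separate the ends of a walk
  along \<open>F\<close>, so an edge that closes a cycle imposes no new condition.\<close>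

lemma cuts_insert_connected:
  assumes "(u, v) \<in> (edge_rel F)\<^sup>*"
  shows "cuts V (insert {u, v} F) = cuts V F"
proof
  show "cuts V F \<subseteq> cuts V (insert {u, v} F)"
  proof
    fix C assume C: "C \<in> cuts V F"
    from cutsD_rtrancl[OF assms this] have "{u, v} \<subseteq> C \<or> {u, v} \<inter> C = {}" by auto
    with C show "C \<in> cuts V (insert {u, v} F)" by (simp add: cuts_def)
  qed
qed (auto simp: cuts_def)

text \<open>Symmetric difference with the component \<open>K\<close> of \<open>u\<close> is an
  involution on the cuts of \<open>F\<close>. As \<open>K\<close> contains \<open>u\<close> but not
  \<open>v\<close>, it exchanges the cuts that keep \<open>u\<close> and \<open>v\<close> together
  with those that separate them, so exactly half survive the new edge.\<close>

lemma card_cuts_insert_disconnected: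
  assumes fin: "finite V" and F: "\<And>e. e \<in> F \<Longrightarrow> e \<subseteq> V \<and> card e = 2" and uv: "u \<in> V"
    and dis: "(u, v) \<notin> (edge_rel F)\<^sup>*"
  shows "card (cuts V F) = 2 * card (cuts V (insert {u, v} F))"
proof -
  define K where "K = {w. (u, w) \<in> (edge_rel F)\<^sup>*}"
  define flip where "flip C = (C - K) \<union> (K - C)" for C
  have sym: "sym (edge_rel F)" by (auto simp: sym_def edge_rel_def insert_commute)
  have KV: "K \<subseteq> V"
  proof
    fix w assume "w \<in> K"
    then have "(u, w) \<in> (edge_rel F)\<^sup>*" by (simp add: K_def)
    then show "w \<in> V" by cases (use uv F in \<open>auto simp: edge_rel_def\<close>)
  qed
  have K_edge: "e \<subseteq> K \<or> e \<inter> K = {}" if e: "e \<in> F" for e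
  proof -
    obtain a b where ab: "e = {a, b}" using F[OF e] by (auto simp: card_2_iff)
    then have "(a, b) \<in> edge_rel F" "(b, a) \<in> edge_rel F" using e sym
      by (auto simp: edge_rel_def insert_commute)
    then have "a \<in> K \<longleftrightarrow> b \<in> K" unfolding K_def
      by (auto intro: rtrancl_into_rtrancl)
    with ab show ?thesis by auto
  qed
  have uK: "u \<in> K" and vK: "v \<notin> K" using dis by (auto simp: K_def)
  have flip_cuts: "flip C \<in> cuts V F" if "C \<in> cuts V F" for C
  proof -
    have "e \<subseteq> flip C \<or> e \<inter> flip C = {}" if "e \<in> F" for e
    proof -
      have "e \<subseteq> C \<or> e \<inter> C = {}" using \<open>C \<in> cuts V F\<close> \<open>e \<in> F\<close> by (auto simp: cuts_def)
      with K_edge[OF \<open>e \<in> F\<close>] show ?thesis unfolding flip_def by blast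
    qed
    moreover have "flip C \<subseteq> V" using that KV by (auto simp: flip_def cuts_def)
    ultimately show ?thesis by (simp add: cuts_def)
  qed
  have flip_flip: "flip (flip C) = C" for C unfolding flip_def by blast
  let ?A = "cuts V (insert {u, v} F)"
  have "bij_betw flip ?A (cuts V F - ?A)"
  proof (rule bij_betw_byWitness[where f' = flip])
    show "flip ` ?A \<subseteq> cuts V F - ?A"
    proof
      fix D assume "D \<in> flip ` ?A"
      then obtain C where C: "C \<in> ?A" "D = flip C" by blast
      then have "C \<in> cuts V F" and "u \<in> C \<longleftrightarrow> v \<in> C" by (auto simp: cuts_def)
      with uK vK C(2) have "u \<in> D \<longleftrightarrow> v \<notin> D" by (auto simp: flip_def)
      with flip_cuts[OF \<open>C \<in> cuts V F\<close>] C(2) show "D \<in> cuts V F - ?A" by (auto simp: cuts_def)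
    qed
    show "flip ` (cuts V F - ?A) \<subseteq> ?A"
    proof
      fix D assume "D \<in> flip ` (cuts V F - ?A)"
      then obtain C where C: "C \<in> cuts V F" "C \<notin> ?A" "D = flip C" by blast
      then have "u \<in> C \<longleftrightarrow> v \<notin> C" by (auto simp: cuts_def)
      with uK vK C(3) have "u \<in> D \<longleftrightarrow> v \<in> D" by (auto simp: flip_def)
      with flip_cuts[OF C(1)] C(3) show "D \<in> ?A" by (auto simp: cuts_def)
    qed
  qed (simp_all add: flip_flip)
  then have eq: "card (cuts V F - ?A) = card ?A" by (simp add: bij_betw_same_card)
  have fin': "finite (cuts V F)" using fin
    by (intro finite_subset[of "cuts V F" "Pow V"]) (auto simp: cuts_def)
  have sub: "?A \<subseteq> cuts V F" by (auto simp: cuts_def)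
  have "card (cuts V F) = card ?A + card (cuts V F - ?A)"
    using card_Diff_subset[OF finite_subset[OF sub fin'] sub] card_mono[OF fin' sub] by simp
  with eq show ?thesis by simp
qed

lemma rtrancl_distinct_path:
  assumes "(u, v) \<in> R\<^sup>*"
  shows "\<exists>p. p \<noteq> [] \<and> hd p = u \<and> last p = v \<and> distinct p \<and>
    (\<forall>i. Suc i < length p \<longrightarrow> (p ! i, p ! Suc i) \<in> R)"
  using assms
proof (induction rule: converse_rtrancl_induct)
  case base
  show ?case by (rule exI[of _ "[v]"]) simp
next
  case (step y z)
  then obtain p where p: "p \<noteq> []" "hd p = z" "last p = v" "distinct p"
    "\<forall>i. Suc i < length p \<longrightarrow> (p ! i, p ! Suc i) \<in> R" by blast
  show ?case
  proof (cases "y \<in> set p")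
    \<comment> \<open>If \<open>y\<close> already occurs on the path, the part from that occurrence
      on is used instead; otherwise \<open>y\<close> is put in front.\<close>
    case True
    then obtain p1 p2 where sp: "p = p1 @ y # p2" by (meson split_list)
    have "(\<forall>i. Suc i < length (y # p2) \<longrightarrow> ((y # p2) ! i, (y # p2) ! Suc i) \<in> R)"
    proof (intro allI impI)
      fix i assume "Suc i < length (y # p2)"
      then have "Suc (length p1 + i) < length p" using sp by simp
      with p(5) have "(p ! (length p1 + i), p ! Suc (length p1 + i)) \<in> R" by blast
      then show "((y # p2) ! i, (y # p2) ! Suc i) \<in> R"
        unfolding sp by (simp only: nth_append_length_plus add_Suc_right[symmetric])
    qed
    with p sp show ?thesis by (intro exI[of _ "y # p2"]) (auto simp: last_append split: if_splits)
  next
    case False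
    have "\<forall>i. Suc i < length (y # p) \<longrightarrow> ((y # p) ! i, (y # p) ! Suc i) \<in> R"
    proof (intro allI impI)
      fix i assume "Suc i < length (y # p)"
      then show "((y # p) ! i, (y # p) ! Suc i) \<in> R"
        using p step.hyps(1) by (cases i) (auto simp: hd_conv_nth)
    qed
    with p False show ?thesis by (intro exI[of _ "y # p"]) auto
  qed
qed

text \<open>A simple path between the ends of an edge that avoids this edge would close up to a
  cycle; it has at least three vertices because a path on two vertices would be the edge itself.
  This serves twice: for the number of cuts of a forest and for the running intersection property of
  the decomposition tree.\<close>

lemma uforest_edge_disconnected:
  assumes forest: "uforest \<lparr>verts = V, edges = F\<rparr>" and F: "\<And>e. e \<in> F \<Longrightarrow> e \<subseteq> V \<and> card e = 2"
    and uv: "{u, v} \<in> F"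
  shows "(u, v) \<notin> (edge_rel (F - {{u, v}}))\<^sup>*"
proof
  assume "(u, v) \<in> (edge_rel (F - {{u, v}}))\<^sup>*"
  from rtrancl_distinct_path[OF this] obtain p where
    p: "p \<noteq> []" "hd p = u" "last p = v" "distinct p"
    and steps: "\<And>i. Suc i < length p \<Longrightarrow> {p ! i, p ! Suc i} \<in> F - {{u, v}}"
    unfolding edge_rel_def by blast
  have "u \<noteq> v" using F[OF uv] by auto
  then have "length p \<noteq> 1" using p by (auto simp: length_Suc_conv)
  moreover have "length p \<noteq> 2"
  proof
    assume l: "length p = 2"
    then have "p = [u, v]" using p by (auto simp: length_Suc_conv numeral_2_eq_2)
    with steps[of 0] show False by simp
  qed
  moreover have "length p \<noteq> 0" using p by simp
  ultimately have len: "length p \<ge> 3" by linarith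
  have "set p \<subseteq> V"
  proof
    fix x assume "x \<in> set p"
    then obtain i where i: "i < length p" "x = p ! i" by (auto simp: in_set_conv_nth)
    show "x \<in> V"
    proof (cases i)
      case 0
      with steps[of 0] F i len show ?thesis by force
    next
      case (Suc j)
      with steps[of j] F i show ?thesis by force
    qed
  qed
  with p len steps uv have "ucycle \<lparr>verts = V, edges = F\<rparr> p"
    by (auto simp: ucycle_def insert_commute)
  with forest show False by (auto simp: uforest_def)
qed

text \<open>The edge between the last and the first vertex of a cycle is bypassed by the rest of the
  cycle.\<close>

lemma not_uforest_edge_connected:
  assumes "\<not> uforest \<lparr>verts = V, edges = F\<rparr>"
  obtains u v where "{u, v} \<in> F" "(u, v) \<in> (edge_rel (F - {{u, v}}))\<^sup>*"
proof -
  obtain p where "ucycle \<lparr>verts = V, edges = F\<rparr> p" using assms by (auto simp: uforest_def)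
  then have len: "length p \<ge> 3" and dist: "distinct p"
    and steps: "\<And>i. Suc i < length p \<Longrightarrow> {p ! i, p ! Suc i} \<in> F" and close: "{last p, hd p} \<in> F"
    by (auto simp: ucycle_def)
  have ne: "p \<noteq> []" using len by auto
  let ?e = "{hd p, last p}"
  have "(hd p, p ! i) \<in> (edge_rel (F - {?e}))\<^sup>*" if "i < length p" for i
    using that
  proof (induction i)
    case 0
    then show ?case using ne by (simp add: hd_conv_nth)
  next
    case (Suc i)
    \<comment> \<open>By distinctness a step of the list can coincide with the closing edge only if
      it leads from the first vertex straight to the last, which a length of at least 3
      excludes.\<close>
    have "{p ! i, p ! Suc i} \<noteq> {p ! 0, p ! (length p - 1)}"
    proof
      assume "{p ! i, p ! Suc i} = {p ! 0, p ! (length p - 1)}"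
      then have "p ! Suc i = p ! 0 \<or> p ! Suc i = p ! (length p - 1) \<and> p ! i = p ! 0"
        by (auto simp: doubleton_eq_iff)
      moreover have "0 < length p" "i < length p" "length p - 1 < length p" using len Suc.prems by auto
      ultimately have "Suc i = 0 \<or> Suc i = length p - 1 \<and> i = 0"
        using nth_eq_iff_index_eq[OF dist] Suc.prems by blast
      with len show False by linarith
    qed
    then have "(p ! i, p ! Suc i) \<in> edge_rel (F - {?e})"
      using steps[OF Suc.prems] ne by (simp add: edge_rel_def hd_conv_nth last_conv_nth)
    with Suc show ?case by (auto intro: rtrancl_into_rtrancl)
  qed
  from this[of "length p - 1"] have "(hd p, last p) \<in> (edge_rel (F - {?e}))\<^sup>*"
    using ne by (simp add: last_conv_nth)
  moreover have "?e \<in> F" using close by (simp add: insert_commute)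
  ultimately show ?thesis using that by blast
qed

lemma uforest_mono:
  "uforest \<lparr>verts = V, edges = F\<rparr> \<Longrightarrow> F' \<subseteq> F \<Longrightarrow> uforest \<lparr>verts = V, edges = F'\<rparr>"
  by (auto simp: uforest_def ucycle_def subset_iff)

lemma finite_edges:
  assumes "finite V" "\<And>e. e \<in> F \<Longrightarrow> e \<subseteq> V \<and> card e = 2"
  shows "finite F"
  by (rule finite_subset[of _ "Pow V"]) (use assms in auto)

text \<open>The empty edge set has \<open>2 ^ card V\<close> cuts and every further edge at most
  halves the number. Truncated subtraction makes the claim trivial once \<open>F\<close> has more
  edges than \<open>V\<close> has vertices.\<close>

lemma power_dvd_card_cuts:
  assumes fin: "finite V" and F: "\<And>e. e \<in> F \<Longrightarrow> e \<subseteq> V \<and> card e = 2"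
  shows "2 ^ (card V - card F) dvd card (cuts V F)"
proof -
  have "finite F" using assms by (rule finite_edges)
  then show ?thesis using F
  proof (induction F)
    case empty
    have "cuts V {} = Pow V" by (auto simp: cuts_def)
    then show ?case using fin by (simp add: card_Pow)
  next
    case (insert e F)
    obtain u v where uv: "e = {u, v}" "u \<in> V" using insert.prems[of e] by (auto simp: card_2_iff)
    have IH: "2 ^ (card V - card F) dvd card (cuts V F)" using insert by simp
    show ?case
    proof (cases "(u, v) \<in> (edge_rel F)\<^sup>*")
      case True
      have "(2::nat) ^ (card V - card (insert e F)) dvd 2 ^ (card V - card F)"
        using insert by (intro le_imp_power_dvd) simp
      then show ?thesis using IH unfolding uv(1) cuts_insert_connected[OF True] by (rule dvd_trans)
    next
      case False
      have eq: "card (cuts V F) = 2 * card (cuts V (insert e F))"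
        unfolding uv(1) using insert.prems uv by (intro card_cuts_insert_disconnected fin False) auto
      show ?thesis
      proof (cases "card V - card F")
        case 0
        then show ?thesis using insert by simp
      next
        case (Suc k)
        then have "card V - card (insert e F) = k" using insert by simp
        with IH Suc show ?thesis unfolding eq by simp
      qed
    qed
  qed
qed

text \<open>In a forest every edge joins two components of the others, so each insertion halves
  exactly. The induction runs on the product form
  \<open>card (cuts V F) * 2 ^ card F = 2 ^ card V\<close>, which avoids truncated subtraction and
  yields the bound on \<open>card F\<close> as a by-product.\<close>

lemma card_cuts_forest:
  assumes fin: "finite V" and F: "\<And>e. e \<in> F \<Longrightarrow> e \<subseteq> V \<and> card e = 2"
    and forest: "uforest \<lparr>verts = V, edges = F\<rparr>"
  shows "card F \<le> card V" "card (cuts V F) = 2 ^ (card V - card F)"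
proof -
  have "finite F" using fin F by (rule finite_edges)
  then have eq: "card (cuts V F) * 2 ^ card F = 2 ^ card V" using F forest
  proof (induction F)
    case empty
    have "cuts V {} = Pow V" by (auto simp: cuts_def)
    then show ?case using fin by (simp add: card_Pow)
  next
    case (insert e F)
    obtain u v where uv: "e = {u, v}" "u \<in> V" using insert.prems(1)[of e] by (auto simp: card_2_iff)
    have IH: "card (cuts V F) * 2 ^ card F = 2 ^ card V"
      using insert.prems uforest_mono[OF insert.prems(2), of F] by (intro insert.IH) auto
    have "(u, v) \<notin> (edge_rel (insert e F - {{u, v}}))\<^sup>*"
      using insert.prems uv by (intro uforest_edge_disconnected[where V = V]) auto
    then have dis: "(u, v) \<notin> (edge_rel F)\<^sup>*" using insert.hyps uv by (simp add: insert_Diff_if)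
    have "card (cuts V F) = 2 * card (cuts V (insert e F))"
      unfolding uv(1) using insert.prems uv by (intro card_cuts_insert_disconnected fin dis) auto
    with IH insert.hyps show ?case by simp
  qed
  show le: "card F \<le> card V"
  proof (rule power_dvd_imp_le)
    show "(2::nat) ^ card F dvd 2 ^ card V" using eq by (metis dvd_triv_right)
  qed simp
  have "(2::nat) ^ card V = 2 ^ (card V - card F) * 2 ^ card F" using le by (simp flip: power_add)
  with eq show "card (cuts V F) = 2 ^ (card V - card F)" by simp
qed

text \<open>Deleting an edge of a cycle leaves the cuts unchanged but lowers the number of edges,
  which gains one factor of two in the general divisibility bound.\<close>

lemma power_dvd_card_cuts_not_forest:
  assumes fin: "finite V" and F: "\<And>e. e \<in> F \<Longrightarrow> e \<subseteq> V \<and> card e = 2"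
    and cyc: "\<not> uforest \<lparr>verts = V, edges = F\<rparr>" and le: "card F \<le> card V"
  shows "2 ^ (card V - card F + 1) dvd card (cuts V F)"
proof -
  have finF: "finite F" using fin F by (rule finite_edges)
  obtain u v where uv: "{u, v} \<in> F" "(u, v) \<in> (edge_rel (F - {{u, v}}))\<^sup>*"
    using cyc by (rule not_uforest_edge_connected)
  have "card F > 0" using finF uv by (auto simp: card_gt_0_iff)
  then have "card V - card F + 1 = card V - card (F - {{u, v}})"
    using uv finF le by simp
  moreover have "2 ^ (card V - card (F - {{u, v}})) dvd card (cuts V (F - {{u, v}}))"
    using F by (intro power_dvd_card_cuts fin) auto
  moreover have "cuts V (F - {{u, v}}) = cuts V F"
    using cuts_insert_connected[OF uv(2)] uv(1) by (simp add: insert_absorb)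
  ultimately show ?thesis by simp
qed

text \<open>Exactly-once covering is replaced by a cardinality condition, since the generating
  function sees only sizes and coverage: a cover of \<open>X\<close> by half as many edges as
  vertices leaves no room for overlap.\<close>

lemma has_perfect_matching_induced_iff:
  assumes "finite X" "\<And>e. e \<in> edges G \<Longrightarrow> card e = 2"
  shows "has_perfect_matching (induced G X) \<longleftrightarrow>
    (\<exists>M. M \<subseteq> edges (induced G X) \<and> \<Union>M = X \<and> card X = 2 * card M)"
proof
  assume "has_perfect_matching (induced G X)"
  then obtain M where M: "M \<subseteq> edges (induced G X)" and ex1: "\<And>v. v \<in> X \<Longrightarrow> \<exists>!e. e \<in> M \<and> v \<in> e"
    by (auto simp: has_perfect_matching_def induced_def)
  have un: "\<Union>M = X" using M ex1 by (fastforce simp: induced_def)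
  moreover have "2 * card M = card (\<Union>M)"
  proof (rule card_partition)
    show "finite M" using un assms(1) by (metis finite_UnionD)
    show "finite (\<Union>M)" using un assms(1) by simp
    show "card e = 2" if "e \<in> M" for e using that M assms(2) by (auto simp: induced_def)
    show "e1 \<inter> e2 = {}" if "e1 \<in> M" "e2 \<in> M" "e1 \<noteq> e2" for e1 e2
      using that ex1 un by (metis UnionI disjoint_iff)
  qed
  ultimately show "\<exists>M. M \<subseteq> edges (induced G X) \<and> \<Union>M = X \<and> card X = 2 * card M"
    using M by metis
next
  assume "\<exists>M. M \<subseteq> edges (induced G X) \<and> \<Union>M = X \<and> card X = 2 * card M"
  then obtain M where M: "M \<subseteq> edges (induced G X)" "\<Union>M = X" "card X = 2 * card M" by blast
  have finM: "finite M" using M assms(1) by (metis finite_UnionD)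
  have card2: "card e = 2" if "e \<in> M" for e using that M assms(2) by (auto simp: induced_def)
  have "e1 = e2" if "e1 \<in> M" "e2 \<in> M" "v \<in> e1" "v \<in> e2" for e1 e2 v
  proof (rule ccontr)
    assume ne: "e1 \<noteq> e2"
    have fine1: "finite e1" using card2[OF that(1)] by (metis card.infinite zero_neq_numeral)
    \<comment> \<open>If two edges of \<open>M\<close> share \<open>v\<close>, then dropping
      \<open>v\<close> from one of them still leaves a cover, which reaches at most
      \<open>2 * (card M - 1) + 1\<close> vertices.\<close>
    have "X \<subseteq> \<Union>(M - {e1}) \<union> (e1 - {v})" using M that ne by blast
    then have "card X \<le> card (\<Union>(M - {e1}) \<union> (e1 - {v}))"
      using M assms(1) fine1 by (intro card_mono) (auto intro: finite_subset)
    also have "\<dots> \<le> card (\<Union>(M - {e1})) + card (e1 - {v})" by (rule card_Un_le)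
    also have "card (\<Union>(M - {e1})) \<le> (\<Sum>e\<in>M - {e1}. card e)" by (rule card_Union_le_sum_card)
    also have "(\<Sum>e\<in>M - {e1}. card e) = 2 * (card M - 1)" using card2 that finM by simp
    also have "card (e1 - {v}) = 1" using card2 that fine1 by simp
    finally have "card X \<le> 2 * (card M - 1) + 1" by simp
    moreover have "card M > 0" using that finM by (auto simp: card_gt_0_iff)
    ultimately show False using M(3) by linarith
  qed
  then show "has_perfect_matching (induced G X)"
    using M unfolding has_perfect_matching_def
    by (intro exI[of _ M]) (auto simp: induced_def; blast)
qed

section \<open>The isolation lemma\<close>

text \<open>Most significant bit first, so that appending a toss is doubling and adding, the step by
  which the program draws a weight.\<close>

definition binary :: "bool list \<Rightarrow> nat" where
  "binary = foldl (\<lambda>a b. 2 * a + of_bool b) 0"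

lemma binary_Nil [simp]: "binary [] = 0" by (simp add: binary_def)

lemma binary_snoc [simp]: "binary (xs @ [b]) = 2 * binary xs + of_bool b"
  by (simp add: binary_def)

lemma binary_less: "binary xs < 2 ^ length xs"
  by (induction xs rule: rev_induct) (auto simp: of_bool_def)

lemma binary_inj: "length xs = length ys \<Longrightarrow> binary xs = binary ys \<Longrightarrow> xs = ys"
proof (induction xs arbitrary: ys rule: rev_induct)
  case (snoc x xs)
  then obtain ys' y where ys: "ys = ys' @ [y]" by (metis length_0_conv rev_exhaust snoc_eq_iff_butlast)
  from snoc.prems ys have eq: "2 * binary xs + of_bool x = 2 * binary ys' + of_bool y" by simp
  then have "x = y" by (cases x; cases y; simp; presburger)
  with eq snoc ys show ?case by auto
qed simp

text \<open>The weight of element \<open>p\<close> is the \<open>p\<close>-th group of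
  \<open>k\<close> tosses. Random weights thus become uniformly distributed bit strings of a fixed
  length, and the isolation lemma becomes a count of such strings.\<close>

definition block :: "nat \<Rightarrow> bool list \<Rightarrow> nat \<Rightarrow> nat" where
  "block k xs p = binary (take k (drop (p * k) xs))"

definition isolated :: "(nat \<Rightarrow> nat) \<Rightarrow> nat set set \<Rightarrow> bool" where
  "isolated wt \<F> \<longleftrightarrow> (\<exists>S\<in>\<F>. \<forall>S'\<in>\<F>. S' \<noteq> S \<longrightarrow> sum wt S < sum wt S')"

text \<open>Without a unique minimum there are two distinct minimal sets, and some element lies in
  exactly one of them. The union bound of the isolation lemma ranges over such ambiguous
  elements.\<close>

lemma not_isolated:
  assumes "\<not> isolated wt \<F>" "\<F> \<noteq> {}"
  shows "\<exists>S1\<in>\<F>. \<exists>S2\<in>\<F>. \<exists>p. p \<in> S1 \<and> p \<notin> S2 \<and>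
     (\<forall>S\<in>\<F>. sum wt S1 \<le> sum wt S) \<and> (\<forall>S\<in>\<F>. sum wt S2 \<le> sum wt S)"
proof -
  obtain S where S: "S \<in> \<F>" "\<forall>S'\<in>\<F>. sum wt S \<le> sum wt S'"
  proof -
    obtain S0 where "S0 \<in> \<F>" using assms(2) by blast
    from arg_min_nat_lemma[of "\<lambda>S. S \<in> \<F>" S0 "sum wt", OF this] show ?thesis
      by (intro that[of "arg_min (sum wt) (\<lambda>S. S \<in> \<F>)"]) simp_all
  qed
  from assms(1) S(1) obtain S' where S': "S' \<in> \<F>" "S' \<noteq> S" "\<not> sum wt S < sum wt S'"
    unfolding isolated_def by blast
  have min': "\<forall>T\<in>\<F>. sum wt S' \<le> sum wt T"
  proof
    fix T assume "T \<in> \<F>"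
    with S(2) have "sum wt S \<le> sum wt T" by blast
    with S'(3) show "sum wt S' \<le> sum wt T" by linarith
  qed
  show ?thesis
  proof (cases "S' \<subseteq> S")
    case True
    then obtain p where "p \<in> S" "p \<notin> S'" using S'(2) by blast
    then show ?thesis using S S'(1) min' by blast
  next
    case False
    then obtain p where "p \<in> S'" "p \<notin> S" by blast
    then show ?thesis using S S'(1) min' by blast
  qed
qed

text \<open>The argument of Mulmuley, Vazirani and Vazirani: once the weights of all elements except
  \<open>p\<close> are fixed, at most one weight of \<open>p\<close> makes \<open>p\<close>
  ambiguous. Here this is the injectivity on \<open>bad p\<close> of the map \<open>cut\<close>,
  which deletes the block of \<open>p\<close>; summing over the \<open>u\<close> elements gives the
  bound.\<close>

lemma isolation:
  assumes \<F>: "\<And>S. S \<in> \<F> \<Longrightarrow> S \<subseteq> {..<u}" and ne: "\<F> \<noteq> {}"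
  shows "card {xs. length xs = u * k \<and> \<not> isolated (block k xs) \<F>} * 2 ^ k \<le> u * 2 ^ (u * k)"
proof -
  define bad where "bad p = {xs. length xs = u * k \<and> (\<exists>S1\<in>\<F>. \<exists>S2\<in>\<F>. p \<in> S1 \<and> p \<notin> S2 \<and>
      (\<forall>S\<in>\<F>. sum (block k xs) S1 \<le> sum (block k xs) S) \<and>
      (\<forall>S\<in>\<F>. sum (block k xs) S2 \<le> sum (block k xs) S))}" for p
  have finlen: "finite {xs :: bool list. length xs = m}" for m
    using finite_lists_length_eq[of "UNIV :: bool set" m] by simp
  have cardlen: "card {xs :: bool list. length xs = m} = 2 ^ m" for m
    using card_lists_length_eq[of "UNIV :: bool set" m] by simp
  have finbad: "finite (bad p)" for p
    by (rule finite_subset[OF _ finlen[of "u * k"]]) (auto simp: bad_def)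
  have card_bad: "card (bad p) * 2 ^ k \<le> 2 ^ (u * k)" if p: "p < u" for p
  proof -
    have pk: "p * k + k \<le> u * k" using p by (metis Suc_leI add.commute mult_Suc mult_le_mono1)
    define cut where "cut xs = take (p * k) xs @ drop (p * k + k) xs" for xs :: "bool list"
    have decomp: "xs = take (p * k) xs @ take k (drop (p * k) xs) @ drop (p * k + k) xs" for xs :: "bool list"
      by (metis add.commute append_take_drop_id drop_drop)
    have "inj_on cut (bad p)"
    proof (rule inj_onI)
      fix xs ys assume xs: "xs \<in> bad p" and ys: "ys \<in> bad p" and eq: "cut xs = cut ys"
      have len: "length xs = u * k" "length ys = u * k" using xs ys by (auto simp: bad_def)
      have pre: "take (p * k) xs = take (p * k) ys" and post: "drop (p * k + k) xs = drop (p * k + k) ys"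
        using eq len unfolding cut_def by (auto simp: append_eq_append_conv)
      have other: "block k xs q = block k ys q" if "q \<noteq> p" for q
      proof (cases "q < p")
        case True
        then have "q * k + k \<le> p * k" by (metis Suc_leI add.commute mult_Suc mult_le_mono1)
        then have *: "take k (drop (q * k) zs) = drop (q * k) (take (q * k + k) (take (p * k) zs))" for zs :: "bool list"
          by (simp add: take_drop add.commute min_def)
        show ?thesis unfolding block_def * pre ..
      next
        case False
        then have "p * k + k \<le> q * k" using that
          by (metis Suc_leI add.commute linorder_neqE_nat mult_Suc mult_le_mono1)
        then have *: "drop (q * k) zs = drop (q * k - (p * k + k)) (drop (p * k + k) zs)" for zs :: "bool list"
          by (simp add: drop_drop)
        show ?thesis unfolding block_def * post ..
      qed
      define R where "R S = sum (block k xs) (S - {p})" for S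
      have finS: "finite S" if "S \<in> \<F>" for S using \<F>[OF that] finite_subset by blast
      have Wx: "sum (block k xs) S = R S + (if p \<in> S then block k xs p else 0)" if "S \<in> \<F>" for S
        using finS[OF that] by (simp add: R_def sum.remove)
      have Ry: "R S = sum (block k ys) (S - {p})" for S
        unfolding R_def by (rule sum.cong) (auto simp: other)
      have Wy: "sum (block k ys) S = R S + (if p \<in> S then block k ys p else 0)" if "S \<in> \<F>" for S
        using finS[OF that] by (simp add: Ry sum.remove)
      from xs obtain S1 S2 where S: "S1 \<in> \<F>" "S2 \<in> \<F>" "p \<in> S1" "p \<notin> S2"
        and minS: "\<And>S. S \<in> \<F> \<Longrightarrow> sum (block k xs) S1 \<le> sum (block k xs) S"
          "\<And>S. S \<in> \<F> \<Longrightarrow> sum (block k xs) S2 \<le> sum (block k xs) S"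
        unfolding bad_def by blast
      from ys obtain T1 T2 where T: "T1 \<in> \<F>" "T2 \<in> \<F>" "p \<in> T1" "p \<notin> T2"
        and minT: "\<And>S. S \<in> \<F> \<Longrightarrow> sum (block k ys) T1 \<le> sum (block k ys) S"
          "\<And>S. S \<in> \<F> \<Longrightarrow> sum (block k ys) T2 \<le> sum (block k ys) S"
        unfolding bad_def by blast
      \<comment> \<open>\<open>R\<close> measures sets without the contribution of \<open>p\<close>
        and agrees for both strings. Minimality of one set containing \<open>p\<close> and of one
        avoiding it forces the weight of \<open>p\<close> to be the least \<open>R\<close> of a set
        avoiding \<open>p\<close> minus the least \<open>R\<close> of a set containing it.\<close>
      have "block k xs p = block k ys p"
      proof -
        have xs_eqs: "sum (block k xs) S1 = R S1 + block k xs p" "sum (block k xs) T1 = R T1 + block k xs p"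
          "sum (block k xs) S2 = R S2" "sum (block k xs) T2 = R T2"
          using Wx S T by auto
        have ys_eqs: "sum (block k ys) S1 = R S1 + block k ys p" "sum (block k ys) T1 = R T1 + block k ys p"
          "sum (block k ys) S2 = R S2" "sum (block k ys) T2 = R T2"
          using Wy S T by auto
        note minS(1)[OF S(2)] minS(1)[OF T(1)] minS(2)[OF S(1)] minS(2)[OF T(2)]
          minT(1)[OF T(2)] minT(1)[OF S(1)] minT(2)[OF T(1)] minT(2)[OF S(2)]
        then show ?thesis unfolding xs_eqs ys_eqs by linarith
      qed
      then have "take k (drop (p * k) xs) = take k (drop (p * k) ys)"
        unfolding block_def using len pk by (intro binary_inj) auto
      then show "xs = ys" using decomp[of xs] decomp[of ys] pre post by metis
    qed
    moreover have "cut ` bad p \<subseteq> {xs. length xs = u * k - k}"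
      using pk by (auto simp: cut_def bad_def)
    ultimately have "card (bad p) \<le> 2 ^ (u * k - k)"
      using card_inj_on_le[of cut "bad p" "{xs. length xs = u * k - k}"] finlen cardlen by simp
    then have "card (bad p) * 2 ^ k \<le> 2 ^ (u * k - k) * 2 ^ k" by simp
    also have "\<dots> = 2 ^ (u * k)" using pk by (simp flip: power_add)
    finally show ?thesis .
  qed
  have "{xs. length xs = u * k \<and> \<not> isolated (block k xs) \<F>} \<subseteq> (\<Union>p<u. bad p)"
  proof
    fix xs assume "xs \<in> {xs. length xs = u * k \<and> \<not> isolated (block k xs) \<F>}"
    then have len: "length xs = u * k" and iso: "\<not> isolated (block k xs) \<F>" by auto
    from not_isolated[OF iso ne] obtain S1 S2 p where *: "S1 \<in> \<F>" "S2 \<in> \<F>" "p \<in> S1" "p \<notin> S2"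
      "\<forall>S\<in>\<F>. sum (block k xs) S1 \<le> sum (block k xs) S"
      "\<forall>S\<in>\<F>. sum (block k xs) S2 \<le> sum (block k xs) S"
      by blast
    moreover have "p < u" using * \<F> by blast
    ultimately show "xs \<in> (\<Union>p<u. bad p)" using len unfolding bad_def by blast
  qed
  then have "card {xs. length xs = u * k \<and> \<not> isolated (block k xs) \<F>} \<le> card (\<Union>p<u. bad p)"
    using finbad by (intro card_mono) auto
  also have "\<dots> \<le> (\<Sum>p<u. card (bad p))" by (rule card_UN_le) simp
  finally have "card {xs. length xs = u * k \<and> \<not> isolated (block k xs) \<F>} * 2 ^ k \<le> (\<Sum>p<u. card (bad p)) * 2 ^ k"
    by simp
  also have "\<dots> = (\<Sum>p<u. card (bad p) * 2 ^ k)" by (simp add: sum_distrib_right)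
  also have "\<dots> \<le> (\<Sum>p<u. 2 ^ (u * k))" using card_bad by (intro sum_mono) auto
  finally show ?thesis by simp
qed

section \<open>Events decided by finitely many coin tosses\<close>

lemma space_coin_flips [simp]: "space coin_flips = UNIV"
  by (simp add: coin_flips_def space_stream_space)

lemma measurable_stake_coin_flips [measurable]:
  "{w. stake m w \<in> S} \<in> sets coin_flips"
proof -
  have "sets coin_flips = sets (stream_space (count_space UNIV))"
    unfolding coin_flips_def by (rule sets_stream_space_cong) simp
  then have "stake m \<in> measurable coin_flips (count_space UNIV)"
    using measurable_cong_sets measurable_stake by blast
  from measurable_sets[OF this, of S] show ?thesis by (simp add: vimage_def)
qed

text \<open>Induction by splitting off the first toss: the strings of \<open>S\<close> that begin
  with \<open>t\<close> correspond to \<open>S' t\<close>, and both values of \<open>t\<close> have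
  probability one half.\<close>

lemma measure_coin_flips_stake:
  assumes "\<And>xs. xs \<in> S \<Longrightarrow> length xs = m"
  shows "measure coin_flips {w. stake m w \<in> S} = card S / 2 ^ m"
  using assms
proof (induction m arbitrary: S)
  case 0
  interpret prob_space coin_flips
    unfolding coin_flips_def by (intro prob_space.prob_space_stream_space measure_pmf.prob_space_axioms)
  have "S = {} \<or> S = {[]}" using 0 by auto
  then show ?case using prob_space by (auto simp: Collect_const_case_prod)
next
  case (Suc m)
  let ?M = "measure_pmf (pmf_of_set (UNIV :: bool set))"
  define S' where "S' t = {xs. t # xs \<in> S}" for t
  have IH: "measure coin_flips {w. stake m w \<in> S' t} = card (S' t) / 2 ^ m" for t
    by (rule Suc.IH) (use Suc.prems in \<open>force simp: S'_def\<close>)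
  have "ennreal (measure coin_flips {w. stake (Suc m) w \<in> S}) =
      (\<integral>\<^sup>+t. measure coin_flips {w. stake m w \<in> S' t} \<partial>?M)"
    using prob_space.prob_stream_space[OF measure_pmf.prob_space_axioms, of "pmf_of_set (UNIV :: bool set)" "\<lambda>w. stake (Suc m) w \<in> S"]
      measurable_stake_coin_flips[of "Suc m" S]
    by (simp add: coin_flips_def[symmetric] S'_def)
  also have "\<dots> = (ennreal (card (S' True) / 2 ^ m) + ennreal (card (S' False) / 2 ^ m)) / 2"
    by (simp add: nn_integral_pmf_of_set IH UNIV_bool add.commute)
  also have "\<dots> = ennreal (card (S' True) / 2 ^ m + card (S' False) / 2 ^ m) / 2"
    by (subst ennreal_plus) simp_all
  also have "\<dots> = ennreal ((card (S' True) / 2 ^ m + card (S' False) / 2 ^ m) / 2)"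
    by (subst ennreal_divide_numeral) simp_all
  also have "(card (S' True) / 2 ^ m + card (S' False) / 2 ^ m) / 2 =
      (card (S' True) + card (S' False)) / 2 ^ Suc m"
    by (simp add: add_divide_distrib)
  finally have *: "measure coin_flips {w. stake (Suc m) w \<in> S} = (card (S' True) + card (S' False)) / 2 ^ Suc m"
    by (subst (asm) ennreal_inj) auto
  have finS: "finite S"
    by (rule finite_subset[OF _ finite_lists_length_eq[of "UNIV :: bool set" "Suc m"]]) (use Suc.prems in auto)
  have "S = Cons True ` S' True \<union> Cons False ` S' False"
  proof
    show "S \<subseteq> Cons True ` S' True \<union> Cons False ` S' False"
    proof
      fix xs assume xs: "xs \<in> S"
      then obtain t ys where "xs = t # ys" using Suc.prems by (metis length_Suc_conv)
      with xs show "xs \<in> Cons True ` S' True \<union> Cons False ` S' False"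
        by (cases t) (auto simp: S'_def)
    qed
  qed (auto simp: S'_def)
  moreover have "finite (S' t)" for t
    using finite_vimageI[OF finS, of "Cons t"] by (simp add: S'_def vimage_def)
  moreover have "Cons True ` S' True \<inter> Cons False ` S' False = {}" by auto
  ultimately have "card S = card (Cons True ` S' True) + card (Cons False ` S' False)"
    by (simp add: card_Un_disjoint)
  then have "card S = card (S' True) + card (S' False)" by (simp add: card_image)
  with * show ?case by simp
qed

text \<open>The failure probability is at most \<open>u / 2 ^ k\<close>; the premise on
  \<open>k\<close> is where the error 1/3 of the theorem comes from.\<close>

lemma prob_isolated:
  assumes \<F>: "\<And>S. S \<in> \<F> \<Longrightarrow> S \<subseteq> {..<u}" and ne: "\<F> \<noteq> {}" and k: "3 * u \<le> 2 ^ k"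
  shows "measure coin_flips {w. isolated (block k (stake (u * k) w)) \<F>} \<ge> 2 / 3"
proof -
  interpret prob_space coin_flips
    unfolding coin_flips_def by (intro prob_space.prob_space_stream_space measure_pmf.prob_space_axioms)
  define S where "S = {xs. length xs = u * k \<and> \<not> isolated (block k xs) \<F>}"
  have "card S * 2 ^ k \<le> u * 2 ^ (u * k)" unfolding S_def by (rule isolation[OF \<F> ne])
  then have "real (card S) * 2 ^ k \<le> real u * 2 ^ (u * k)"
    by (metis (mono_tags, lifting) of_nat_le_iff of_nat_mult of_nat_numeral of_nat_power)
  moreover have "3 * real u \<le> 2 ^ k" using k
    by (metis (mono_tags, lifting) of_nat_le_iff of_nat_mult of_nat_numeral of_nat_power)
  then have "3 * real u * 2 ^ (u * k) \<le> 2 ^ k * 2 ^ (u * k)" by (intro mult_right_mono) auto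
  moreover have "(3 * real (card S)) * 2 ^ k = 3 * (real (card S) * 2 ^ k)"
    "3 * real u * 2 ^ (u * k) = 3 * (real u * 2 ^ (u * k))"
    "(2::real) ^ k * 2 ^ (u * k) = 2 ^ (u * k) * 2 ^ k" by simp_all
  ultimately have "(3 * real (card S)) * 2 ^ k \<le> 2 ^ (u * k) * 2 ^ k" by linarith
  then have "3 * real (card S) \<le> 2 ^ (u * k)" by (rule mult_right_le_imp_le) simp
  then have le: "real (card S) / 2 ^ (u * k) \<le> 1 / 3" by (simp add: field_simps)
  have "measure coin_flips {w. stake (u * k) w \<in> S} = card S / 2 ^ (u * k)"
    by (rule measure_coin_flips_stake) (simp add: S_def)
  moreover have "{w. isolated (block k (stake (u * k) w)) \<F>} = space coin_flips - {w. stake (u * k) w \<in> S}"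
    by (auto simp: S_def)
  ultimately show ?thesis using le prob_compl[OF measurable_stake_coin_flips[of "u * k" S]] by simp
qed

section \<open>The partition function\<close>

text \<open>
  A state \<open>s < 6\<close> encodes whether a vertex is outside of \<open>X\<close> (\<open>s div 2 = 0\<close>), in \<open>X - Y\<close> (1) or
  in \<open>Y\<close> (2), and by \<open>s mod 2\<close> on which side of the cut it lies.
\<close>
definition vfac :: "nat \<Rightarrow> nat \<Rightarrow> nat \<Rightarrow> nat" where
  "vfac sg zb s = (if s < 2 then 1 else if s < 4 then sg * zb else zb)"

text \<open>\<open>zB\<close> marks the edges of G[X]; in \<open>1 + z\<close> the summand 1 leaves
  an edge of G[Y] out of M and \<open>z\<close> puts it in. The value 0 removes the assignments
  whose cut separates an edge of G[X].\<close>

definition efac :: "nat \<Rightarrow> nat \<Rightarrow> nat \<Rightarrow> nat \<Rightarrow> nat" where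
  "efac zB z s t = (if s < 2 \<or> t < 2 then 1 else if s mod 2 \<noteq> t mod 2 then 0
     else if 3 < s \<and> 3 < t then zB * (1 + z) else zB)"

text \<open>The edge \<open>uv\<close> with \<open>u < v < n\<close> is represented by the number \<open>u * n + v\<close>.\<close>
definition ends :: "nat \<Rightarrow> nat \<Rightarrow> nat set" where
  "ends n p = {p div n, p mod n}"

definition pairs :: "nat \<Rightarrow> nat set set \<Rightarrow> nat set" where
  "pairs n E = {p. p < n * n \<and> p div n < p mod n \<and> ends n p \<in> E}"

lemma pairs_subset: "pairs n E \<subseteq> {..<n * n}"
  by (auto simp: pairs_def)

lemma finite_pairs [simp]: "finite (pairs n E)"
  by (rule finite_subset[OF pairs_subset]) simp

lemma pair_less: "u < n \<Longrightarrow> v < n \<Longrightarrow> u * n + v < n * n" for u v n :: nat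
  by (metis Suc_leI add.commute less_le_trans mult_Suc mult_le_mono1 nat_add_left_cancel_less)

lemma inj_on_ends: "inj_on (ends n) (pairs n E)"
proof (rule inj_onI)
  fix p q assume p: "p \<in> pairs n E" and q: "q \<in> pairs n E" and eq: "ends n p = ends n q"
  then have "p div n = q div n" "p mod n = q mod n"
    by (auto simp: pairs_def ends_def doubleton_eq_iff)
  then show "p = q" by (metis div_mult_mod_eq)
qed

lemma ends_image_pairs:
  assumes E: "\<forall>e\<in>E. e \<subseteq> {..<n} \<and> card e = 2"
  shows "ends n ` pairs n E = E"
proof
  show "E \<subseteq> ends n ` pairs n E"
  proof
    fix e assume e: "e \<in> E"
    then have "card e = 2" using E by blast
    then obtain a b where "e = {a, b}" "a \<noteq> b" by (auto simp: card_2_iff)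
    then obtain u v where uv: "e = {u, v}" "u < v" by (metis insert_commute linorder_neqE_nat)
    then have "u < n" "v < n" using bspec[OF E e] by auto
    moreover then have "(u * n + v) div n = u" "(u * n + v) mod n = v" by auto
    ultimately have "u * n + v \<in> pairs n E" "ends n (u * n + v) = e"
      using uv e pair_less by (auto simp: pairs_def ends_def)
    then show "e \<in> ends n ` pairs n E" by blast
  qed
qed (auto simp: pairs_def)

definition induced_pairs :: "nat \<Rightarrow> nat set set \<Rightarrow> nat set \<Rightarrow> nat set" where
  "induced_pairs n E X = {p \<in> pairs n E. ends n p \<subseteq> X}"

lemma finite_induced_pairs [simp]: "finite (induced_pairs n E X)"
  by (simp add: induced_pairs_def)

lemma ends_image_induced_pairs:
  assumes "\<forall>e\<in>E. e \<subseteq> {..<n} \<and> card e = 2"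
  shows "ends n ` induced_pairs n E X = {e \<in> E. e \<subseteq> X}"
proof
  have eq: "ends n ` pairs n E = E" by (rule ends_image_pairs[OF assms])
  show "{e \<in> E. e \<subseteq> X} \<subseteq> ends n ` induced_pairs n E X"
  proof
    fix e assume e: "e \<in> {e \<in> E. e \<subseteq> X}"
    then obtain p where "p \<in> pairs n E" "e = ends n p" using eq by blast
    with e show "e \<in> ends n ` induced_pairs n E X" by (auto simp: induced_pairs_def)
  qed
qed (auto simp: induced_pairs_def pairs_def)

lemma card_induced_pairs:
  assumes "\<forall>e\<in>E. e \<subseteq> {..<n} \<and> card e = 2"
  shows "card (induced_pairs n E X) = card {e \<in> E. e \<subseteq> X}"
proof -
  have "inj_on (ends n) (induced_pairs n E X)"
    by (rule inj_on_subset[OF inj_on_ends[of n E]]) (auto simp: induced_pairs_def)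
  from card_image[OF this] show ?thesis unfolding ends_image_induced_pairs[OF assms] ..
qed

lemma card_induced_pairs_le: "card (induced_pairs n E X) \<le> n * n"
proof -
  have "card (induced_pairs n E X) \<le> card {..<n * n}"
    using pairs_subset by (intro card_mono) (auto simp: induced_pairs_def)
  then show ?thesis by simp
qed

definition covered :: "nat \<Rightarrow> nat set \<Rightarrow> nat set" where
  "covered n M = \<Union>(ends n ` M)"

text \<open>Vertices sit on the diagonal and edges above it, so a single index \<open>p\<close>
  enumerates all factors; every other pair gets the neutral factor 1. The exponents \<open>D\<close>
  and \<open>D ^ 2 + D ^ 3 * wt p\<close> are the contributions of an edge of G[X] and of a chosen
  edge to \<open>key\<close>.\<close>

definition pfac :: "nat \<Rightarrow> nat set set \<Rightarrow> nat \<Rightarrow> nat \<Rightarrow> nat \<Rightarrow> (nat \<Rightarrow> nat) \<Rightarrow> nat \<Rightarrow> (nat \<Rightarrow> nat) \<Rightarrow> nat" where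
  "pfac n E sg zb D wt p \<sigma> =
    (if p div n = p mod n then vfac sg zb (\<sigma> (p mod n))
     else if p div n < p mod n \<and> ends n p \<in> E
     then efac (zb ^ D) (zb ^ (D ^ 2 + D ^ 3 * wt p)) (\<sigma> (p div n)) (\<sigma> (p mod n))
     else 1)"

definition states :: "nat set \<Rightarrow> (nat \<Rightarrow> nat) set" where
  "states U = PiE U (\<lambda>_. {..<6})"

lemma finite_states [simp]: "finite U \<Longrightarrow> finite (states U)"
  by (simp add: states_def finite_PiE)

definition Zsum :: "nat \<Rightarrow> nat set set \<Rightarrow> nat \<Rightarrow> nat \<Rightarrow> nat \<Rightarrow> (nat \<Rightarrow> nat) \<Rightarrow> nat" where
  "Zsum n E sg zb D wt = (\<Sum>\<sigma>\<in>states {..<n}. \<Prod>p<n * n. pfac n E sg zb D wt p \<sigma>)"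

text \<open>Four statistics are packed into one exponent in base \<open>D\<close>, so one variable
  \<open>zb\<close> does the work of four. As long as each of them is less than \<open>D\<close>,
  they can be read back as digits.\<close>

definition key :: "nat \<Rightarrow> nat set set \<Rightarrow> nat \<Rightarrow> (nat \<Rightarrow> nat) \<Rightarrow> nat set \<Rightarrow> nat set \<Rightarrow> nat" where
  "key n E D wt X M = card X + D * card (induced_pairs n E X) + D ^ 2 * card M + D ^ 3 * sum wt M"

lemma prod_pfac:
  "(\<Prod>p<n * n. pfac n E sg zb D wt p \<sigma>) = (\<Prod>v<n. vfac sg zb (\<sigma> v)) *
    (\<Prod>p\<in>pairs n E. efac (zb ^ D) (zb ^ (D ^ 2 + D ^ 3 * wt p)) (\<sigma> (p div n)) (\<sigma> (p mod n)))"
proof -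
  let ?f = "\<lambda>p. pfac n E sg zb D wt p \<sigma>"
  let ?diag = "{p. p < n * n \<and> p div n = p mod n}"
  have "(\<Prod>p<n * n. ?f p) = (\<Prod>p\<in>?diag \<union> pairs n E. ?f p)"
    by (rule prod.mono_neutral_right) (auto simp: pairs_def pfac_def)
  also have "\<dots> = (\<Prod>p\<in>?diag. ?f p) * (\<Prod>p\<in>pairs n E. ?f p)"
    by (rule prod.union_disjoint) (auto simp: pairs_def)
  also have "(\<Prod>p\<in>?diag. ?f p) = (\<Prod>v<n. vfac sg zb (\<sigma> v))"
  proof (rule prod.reindex_bij_witness[of _ "\<lambda>v. v * n + v" "\<lambda>p. p mod n"])
    fix p assume p: "p \<in> ?diag"
    then show "p mod n * n + p mod n = p" by (metis (mono_tags) div_mult_mod_eq mem_Collect_eq)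
    show "p mod n \<in> {..<n}" using p by (cases "n = 0") auto
    show "vfac sg zb (\<sigma> (p mod n)) = ?f p" using p by (simp add: pfac_def)
  next
    fix v assume "v \<in> {..<n}"
    then show "(v * n + v) mod n = v" "v * n + v \<in> ?diag" using pair_less by auto
  qed
  also have "(\<Prod>p\<in>pairs n E. ?f p) =
    (\<Prod>p\<in>pairs n E. efac (zb ^ D) (zb ^ (D ^ 2 + D ^ 3 * wt p)) (\<sigma> (p div n)) (\<sigma> (p mod n)))"
    by (rule prod.cong) (auto simp: pairs_def pfac_def)
  finally show ?thesis .
qed

lemma prod_vfac:
  fixes n :: nat
  assumes "Y \<subseteq> X" "X \<subseteq> {..<n}"
    and "\<And>v. v < n \<Longrightarrow> (2 \<le> \<sigma> v \<longleftrightarrow> v \<in> X) \<and> (4 \<le> \<sigma> v \<longleftrightarrow> v \<in> Y)"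
  shows "(\<Prod>v<n. vfac sg zb (\<sigma> v)) = sg ^ card (X - Y) * zb ^ card X"
proof -
  have fin: "finite X" using assms(2) by (rule finite_subset) simp
  have "(\<Prod>v<n. vfac sg zb (\<sigma> v)) = (\<Prod>v\<in>X. vfac sg zb (\<sigma> v))"
  proof (rule prod.mono_neutral_right)
    show "\<forall>v\<in>{..<n} - X. vfac sg zb (\<sigma> v) = 1"
    proof
      fix v assume "v \<in> {..<n} - X"
      with assms(3)[of v] have "\<sigma> v < 2" by simp
      then show "vfac sg zb (\<sigma> v) = 1" by (simp add: vfac_def)
    qed
  qed (use assms in auto)
  also have "\<dots> = (\<Prod>v\<in>X. (if v \<in> X - Y then sg else 1) * zb)"
  proof (rule prod.cong[OF refl])
    fix v assume v: "v \<in> X"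
    then have "v < n" using assms(2) by auto
    then have "2 \<le> \<sigma> v" "4 \<le> \<sigma> v \<longleftrightarrow> v \<in> Y" using assms(3)[of v] v by auto
    then show "vfac sg zb (\<sigma> v) = (if v \<in> X - Y then sg else 1) * zb"
      using v by (cases "v \<in> Y") (simp_all add: vfac_def)
  qed
  also have "\<dots> = (\<Prod>v\<in>X - Y. sg) * zb ^ card X"
    using fin prod.mono_neutral_cong_right[of X "X - Y" "\<lambda>v. if v \<in> X - Y then sg else 1" "\<lambda>_. sg"]
    by (simp add: prod.distrib)
  finally show ?thesis by simp
qed

lemma prod_one_plus:
  fixes f :: "'a \<Rightarrow> nat"
  assumes "finite A"
  shows "(\<Prod>x\<in>A. 1 + f x) = (\<Sum>M\<in>Pow A. prod f M)"
proof -
  have "(\<Prod>x\<in>A. 1 + f x) = (\<Prod>x\<in>A. f x + 1)" by (simp add: add.commute)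
  also have "\<dots> = (\<Sum>M\<in>Pow A. prod f M)"
    by (simp only: prod_add[OF assms] prod.neutral_const mult_1_right)
  finally show ?thesis .
qed

text \<open>Multiplying out the factors \<open>1 + z p\<close> over the edges of G[Y] produces the
  sum over M; a separated edge of G[X] annihilates the whole product, which restricts
  \<open>C\<close> to cuts.\<close>

lemma prod_efac:
  assumes E: "\<forall>e\<in>E. e \<subseteq> {..<n} \<and> card e = 2"
    and sub: "Y \<subseteq> X" "X \<subseteq> {..<n}" "C \<subseteq> {..<n}"
    and \<sigma>: "\<And>v. v < n \<Longrightarrow> (2 \<le> \<sigma> v \<longleftrightarrow> v \<in> X) \<and> (4 \<le> \<sigma> v \<longleftrightarrow> v \<in> Y) \<and> (odd (\<sigma> v) \<longleftrightarrow> v \<in> C)"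
  shows "(\<Prod>p\<in>pairs n E. efac zB (z p) (\<sigma> (p div n)) (\<sigma> (p mod n))) =
    (if C \<in> cuts {..<n} {e \<in> E. e \<subseteq> X} then zB ^ card (induced_pairs n E X) *
       (\<Sum>M\<in>Pow (induced_pairs n E Y). prod z M) else 0)"
proof -
  let ?f = "\<lambda>p. efac zB (z p) (\<sigma> (p div n)) (\<sigma> (p mod n))"
  have f: "?f p = (if \<not> ends n p \<subseteq> X then 1 else if \<not> (ends n p \<subseteq> C \<or> ends n p \<inter> C = {}) then 0
      else if ends n p \<subseteq> Y then zB * (1 + z p) else zB)" if p: "p \<in> pairs n E" for p
  proof -
    have *: "p div n < n" "p mod n < n" using p bspec[OF E, of "ends n p"] by (auto simp: pairs_def ends_def)
    have **: "(\<sigma> u < 2 \<longleftrightarrow> u \<notin> X) \<and> (3 < \<sigma> u \<longleftrightarrow> u \<in> Y) \<and> (\<sigma> u mod 2 = of_bool (u \<in> C))"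
      if "u < n" for u
      using \<sigma>[OF that] by (auto simp: odd_iff_mod_2_eq_one)
    show ?thesis using sub
      unfolding efac_def ends_def **[OF *(1), THEN conjunct1] **[OF *(2), THEN conjunct1]
        **[OF *(1), THEN conjunct2, THEN conjunct1] **[OF *(2), THEN conjunct2, THEN conjunct1]
        **[OF *(1), THEN conjunct2, THEN conjunct2] **[OF *(2), THEN conjunct2, THEN conjunct2]
      by auto
  qed
  show ?thesis
  proof (cases "C \<in> cuts {..<n} {e \<in> E. e \<subseteq> X}")
    case False
    then obtain e where e: "e \<in> E" "e \<subseteq> X" "\<not> (e \<subseteq> C \<or> e \<inter> C = {})"
      using sub by (auto simp: cuts_def)
    then obtain p where "p \<in> pairs n E" "e = ends n p" using ends_image_pairs[OF E] by blast
    with e f[of p] have "?f p = 0" "p \<in> pairs n E" by auto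
    then have "prod ?f (pairs n E) = 0" by (metis finite_pairs prod_zero)
    with False show ?thesis by simp
  next
    case True
    then have C: "ends n p \<subseteq> C \<or> ends n p \<inter> C = {}" if "p \<in> induced_pairs n E X" for p
      using that unfolding cuts_def induced_pairs_def pairs_def by blast
    have "prod ?f (pairs n E) = prod ?f (induced_pairs n E X)"
      by (rule prod.mono_neutral_right) (auto simp: induced_pairs_def f)
    also have "\<dots> = (\<Prod>p\<in>induced_pairs n E X. zB * (if p \<in> induced_pairs n E Y then 1 + z p else 1))"
      using C by (intro prod.cong refl) (auto simp: induced_pairs_def f)
    also have "\<dots> = zB ^ card (induced_pairs n E X) * (\<Prod>p\<in>induced_pairs n E X. if p \<in> induced_pairs n E Y then 1 + z p else 1)"
      by (simp add: prod.distrib)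
    also have "(\<Prod>p\<in>induced_pairs n E X. if p \<in> induced_pairs n E Y then 1 + z p else 1) =
        (\<Prod>p\<in>induced_pairs n E Y. 1 + z p)"
      using sub by (intro prod.mono_neutral_cong_right) (auto simp: induced_pairs_def)
    finally show ?thesis using True by (simp add: prod_one_plus del: One_nat_def)
  qed
qed

lemma sum_states:
  fixes g :: "nat set \<Rightarrow> nat set \<Rightarrow> nat set \<Rightarrow> nat" and n :: nat
  defines "X\<^sub>0 \<equiv> \<lambda>\<sigma>. {v. v < n \<and> 2 \<le> \<sigma> v}" and "Y\<^sub>0 \<equiv> \<lambda>\<sigma>. {v. v < n \<and> 4 \<le> \<sigma> v}"
    and "C\<^sub>0 \<equiv> \<lambda>\<sigma>. {v. v < n \<and> odd (\<sigma> v)}"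
  shows "(\<Sum>\<sigma>\<in>states {..<n}. g (X\<^sub>0 \<sigma>) (Y\<^sub>0 \<sigma>) (C\<^sub>0 \<sigma>)) =
    (\<Sum>X\<in>Pow {..<n}. \<Sum>Y\<in>Pow X. \<Sum>C\<in>Pow {..<n}. g X Y C)"
proof -
  let ?S = "SIGMA X:Pow {..<n}. SIGMA Y:Pow X. Pow {..<n}"
  have "(\<Sum>\<sigma>\<in>states {..<n}. g (X\<^sub>0 \<sigma>) (Y\<^sub>0 \<sigma>) (C\<^sub>0 \<sigma>)) = (\<Sum>(X, Y, C)\<in>?S. g X Y C)"
  proof (rule sum.reindex_bij_witness[of _
      "\<lambda>(X, Y, C). restrict (\<lambda>v. (if v \<in> Y then 4 else if v \<in> X then 2 else 0) + of_bool (v \<in> C)) {..<n}"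
      "\<lambda>\<sigma>. (X\<^sub>0 \<sigma>, Y\<^sub>0 \<sigma>, C\<^sub>0 \<sigma>)"])
    fix \<sigma> assume \<sigma>: "\<sigma> \<in> states {..<n}"
    have dig: "(if 4 \<le> \<sigma> v then 4 else if 2 \<le> \<sigma> v then 2 else 0) + of_bool (odd (\<sigma> v)) = \<sigma> v" if "v < n" for v
    proof -
      have "\<sigma> v < 6" using \<sigma> that by (auto simp: states_def)
      then have "\<sigma> v \<in> {0, 1, 2, 3, 4, 5}" by auto
      then show ?thesis by auto
    qed
    have und: "\<sigma> v = undefined" if "\<not> v < n" for v
      using \<sigma> that by (simp add: states_def PiE_def extensional_def)
    have "restrict (\<lambda>v. (if v \<in> Y\<^sub>0 \<sigma> then 4 else if v \<in> X\<^sub>0 \<sigma> then 2 else 0) + of_bool (v \<in> C\<^sub>0 \<sigma>)) {..<n} v = \<sigma> v" for v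
    proof (cases "v < n")
      case True
      show ?thesis
        unfolding X\<^sub>0_def Y\<^sub>0_def C\<^sub>0_def restrict_def mem_Collect_eq lessThan_iff
        by (simp only: True simp_thms if_True dig)
    qed (simp add: und)
    then show "(case (X\<^sub>0 \<sigma>, Y\<^sub>0 \<sigma>, C\<^sub>0 \<sigma>) of (X, Y, C) \<Rightarrow>
        restrict (\<lambda>v. (if v \<in> Y then 4 else if v \<in> X then 2 else 0) + of_bool (v \<in> C)) {..<n}) = \<sigma>"
      unfolding prod.case by (rule ext)
    show "(X\<^sub>0 \<sigma>, Y\<^sub>0 \<sigma>, C\<^sub>0 \<sigma>) \<in> ?S" by (auto simp: X\<^sub>0_def Y\<^sub>0_def C\<^sub>0_def)
  next
    fix T assume "T \<in> ?S"
    then obtain X Y C where T: "T = (X, Y, C)" and sub: "X \<subseteq> {..<n}" "Y \<subseteq> X" "C \<subseteq> {..<n}" by auto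
    let ?\<sigma> = "restrict (\<lambda>v. (if v \<in> Y then 4 else if v \<in> X then 2 else 0) + of_bool (v \<in> C)) {..<n} :: nat \<Rightarrow> nat"
    have "X\<^sub>0 ?\<sigma> = X" "Y\<^sub>0 ?\<sigma> = Y" "C\<^sub>0 ?\<sigma> = C"
      using sub by (auto simp: X\<^sub>0_def Y\<^sub>0_def C\<^sub>0_def of_bool_def split: if_splits)
    then show "(X\<^sub>0 (case T of (X, Y, C) \<Rightarrow> restrict (\<lambda>v. (if v \<in> Y then 4 else if v \<in> X then 2 else 0) + of_bool (v \<in> C)) {..<n}),
       Y\<^sub>0 (case T of (X, Y, C) \<Rightarrow> restrict (\<lambda>v. (if v \<in> Y then 4 else if v \<in> X then 2 else 0) + of_bool (v \<in> C)) {..<n}),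
       C\<^sub>0 (case T of (X, Y, C) \<Rightarrow> restrict (\<lambda>v. (if v \<in> Y then 4 else if v \<in> X then 2 else 0) + of_bool (v \<in> C)) {..<n})) = T"
      by (simp only: T prod.case)
    show "(case T of (X, Y, C) \<Rightarrow> restrict (\<lambda>v. (if v \<in> Y then 4 else if v \<in> X then 2 else 0) + of_bool (v \<in> C)) {..<n}) \<in> states {..<n}"
      by (auto simp: T states_def of_bool_def)
  qed simp
  also have "\<dots> = (\<Sum>X\<in>Pow {..<n}. \<Sum>(Y, C)\<in>(SIGMA Y:Pow X. Pow {..<n}). g X Y C)"
    by (subst sum.Sigma) (auto intro: finite_subset intro!: finite_SigmaI)
  also have "\<dots> = (\<Sum>X\<in>Pow {..<n}. \<Sum>Y\<in>Pow X. \<Sum>C\<in>Pow {..<n}. g X Y C)"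
    by (intro sum.cong refl, subst sum.Sigma) (auto intro: finite_subset)
  finally show ?thesis .
qed

text \<open>Every element of \<open>X - U\<close> independently either joins \<open>Y\<close>, with
  factor 1, or stays outside, with factor \<open>s\<close>. For \<open>s = 2 ^ (n + 1) - 1\<close>
  this recombines the split weight of an uncovered vertex.\<close>

lemma sum_power_card_between:
  assumes "finite X" "U \<subseteq> X"
  shows "(\<Sum>Y | U \<subseteq> Y \<and> Y \<subseteq> X. s ^ card (X - Y)) = (1 + s :: nat) ^ card (X - U)"
proof -
  have "(\<Sum>Y | U \<subseteq> Y \<and> Y \<subseteq> X. s ^ card (X - Y)) = (\<Sum>T\<in>Pow (X - U). s ^ card T)"
    by (rule sum.reindex_bij_witness[of _ "\<lambda>T. X - T" "\<lambda>Y. X - Y"]) (use assms in auto)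
  also have "\<dots> = (\<Prod>x\<in>X - U. 1 + s)"
    using assms by (subst prod_one_plus) auto
  finally show ?thesis by simp
qed

text \<open>The sum over \<open>C\<close> counts cuts. Since M consists of edges of G[Y] exactly if
  all its ends lie in Y, exchanging the sums over Y and M leaves for each M the sum over all Y
  between \<open>covered n M\<close> and \<open>X\<close>, which contributes one factor
  \<open>1 + sg\<close> per uncovered vertex.\<close>

lemma Zsum_expand:
  assumes E: "\<forall>e\<in>E. e \<subseteq> {..<n} \<and> card e = 2"
  shows "Zsum n E sg zb D wt = (\<Sum>X\<in>Pow {..<n}. \<Sum>M\<in>Pow (induced_pairs n E X).
     card (cuts {..<n} {e \<in> E. e \<subseteq> X}) * (1 + sg) ^ card (X - covered n M) * zb ^ key n E D wt X M)"
proof -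
  let ?z = "\<lambda>p. zb ^ (D ^ 2 + D ^ 3 * wt p)"
  define a where "a X = zb ^ card X * (zb ^ D) ^ card (induced_pairs n E X)" for X
  define g where "g X Y C = (sg ^ card (X - Y) * zb ^ card X) *
    (if C \<in> cuts {..<n} {e \<in> E. e \<subseteq> X} then (zb ^ D) ^ card (induced_pairs n E X) *
       (\<Sum>M\<in>Pow (induced_pairs n E Y). prod ?z M) else 0)" for X Y C
  have "Zsum n E sg zb D wt = (\<Sum>\<sigma>\<in>states {..<n}. g {v. v < n \<and> 2 \<le> \<sigma> v} {v. v < n \<and> 4 \<le> \<sigma> v} {v. v < n \<and> odd (\<sigma> v)})"
    unfolding Zsum_def
  proof (rule sum.cong[OF refl])
    fix \<sigma> :: "nat \<Rightarrow> nat"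
    show "(\<Prod>p<n * n. pfac n E sg zb D wt p \<sigma>) = g {v. v < n \<and> 2 \<le> \<sigma> v} {v. v < n \<and> 4 \<le> \<sigma> v} {v. v < n \<and> odd (\<sigma> v)}"
    proof -
      let ?X = "{v. v < n \<and> 2 \<le> \<sigma> v}" and ?Y = "{v. v < n \<and> 4 \<le> \<sigma> v}" and ?C = "{v. v < n \<and> odd (\<sigma> v)}"
      have 1: "(\<Prod>v<n. vfac sg zb (\<sigma> v)) = sg ^ card (?X - ?Y) * zb ^ card ?X"
        by (rule prod_vfac) auto
      have 2: "(\<Prod>p\<in>pairs n E. efac (zb ^ D) (?z p) (\<sigma> (p div n)) (\<sigma> (p mod n))) =
        (if ?C \<in> cuts {..<n} {e \<in> E. e \<subseteq> ?X} then (zb ^ D) ^ card (induced_pairs n E ?X) *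
          (\<Sum>M\<in>Pow (induced_pairs n E ?Y). prod ?z M) else 0)"
        by (rule prod_efac[OF E]) auto
      show ?thesis unfolding g_def prod_pfac 1 2 ..
    qed
  qed
  also have "\<dots> = (\<Sum>X\<in>Pow {..<n}. \<Sum>Y\<in>Pow X. \<Sum>C\<in>Pow {..<n}. g X Y C)" by (rule sum_states)
  also have "\<dots> = (\<Sum>X\<in>Pow {..<n}. \<Sum>M\<in>Pow (induced_pairs n E X).
     card (cuts {..<n} {e \<in> E. e \<subseteq> X}) * (1 + sg) ^ card (X - covered n M) * zb ^ key n E D wt X M)"
  proof (rule sum.cong[OF refl])
    fix X assume "X \<in> Pow {..<n}"
    then have finX: "finite X" by (auto intro: finite_subset)
    let ?c = "card (cuts {..<n} {e \<in> E. e \<subseteq> X})"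
    have inner: "(\<Sum>C\<in>Pow {..<n}. g X Y C) = ?c * a X * (sg ^ card (X - Y) * (\<Sum>M\<in>Pow (induced_pairs n E Y). prod ?z M))" for Y
    proof -
      have "Pow {..<n} \<inter> cuts {..<n} {e \<in> E. e \<subseteq> X} = cuts {..<n} {e \<in> E. e \<subseteq> X}"
        by (auto simp: cuts_def)
      then show ?thesis
        unfolding g_def a_def by (simp add: sum_distrib_left[symmetric] sum.inter_restrict[symmetric] mult_ac)
    qed
    have swap: "(\<Sum>Y\<in>Pow X. sg ^ card (X - Y) * (\<Sum>M\<in>Pow (induced_pairs n E Y). prod ?z M)) =
       (\<Sum>M\<in>Pow (induced_pairs n E X). (1 + sg) ^ card (X - covered n M) * prod ?z M)"
    proof -
      have "(\<Sum>Y\<in>Pow X. sg ^ card (X - Y) * (\<Sum>M\<in>Pow (induced_pairs n E Y). prod ?z M)) =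
        (\<Sum>Y\<in>Pow X. \<Sum>M | M \<in> Pow (induced_pairs n E X) \<and> covered n M \<subseteq> Y. sg ^ card (X - Y) * prod ?z M)"
      proof (rule sum.cong[OF refl])
        fix Y assume "Y \<in> Pow X"
        then have "Pow (induced_pairs n E Y) = {M. M \<in> Pow (induced_pairs n E X) \<and> covered n M \<subseteq> Y}"
          unfolding induced_pairs_def covered_def by blast
        then show "sg ^ card (X - Y) * (\<Sum>M\<in>Pow (induced_pairs n E Y). prod ?z M) =
          (\<Sum>M | M \<in> Pow (induced_pairs n E X) \<and> covered n M \<subseteq> Y. sg ^ card (X - Y) * prod ?z M)"
          by (simp add: sum_distrib_left)
      qed
      also have "\<dots> = (\<Sum>M\<in>Pow (induced_pairs n E X). \<Sum>Y | Y \<in> Pow X \<and> covered n M \<subseteq> Y. sg ^ card (X - Y) * prod ?z M)"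
        using finX by (intro sum.swap_restrict) auto
      also have "\<dots> = (\<Sum>M\<in>Pow (induced_pairs n E X). (1 + sg) ^ card (X - covered n M) * prod ?z M)"
      proof (rule sum.cong[OF refl])
        fix M assume "M \<in> Pow (induced_pairs n E X)"
        then have "covered n M \<subseteq> X" by (auto simp: covered_def induced_pairs_def)
        from sum_power_card_between[OF finX this, of sg]
        show "(\<Sum>Y | Y \<in> Pow X \<and> covered n M \<subseteq> Y. sg ^ card (X - Y) * prod ?z M) =
           (1 + sg) ^ card (X - covered n M) * prod ?z M"
          by (simp add: sum_distrib_right[symmetric] conj_commute)
      qed
      finally show ?thesis .
    qed
    have "(\<Sum>Y\<in>Pow X. \<Sum>C\<in>Pow {..<n}. g X Y C) =
      ?c * a X * (\<Sum>M\<in>Pow (induced_pairs n E X). (1 + sg) ^ card (X - covered n M) * prod ?z M)"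
      unfolding inner swap[symmetric] by (simp add: sum_distrib_left)
    also have "\<dots> = (\<Sum>M\<in>Pow (induced_pairs n E X). ?c * (1 + sg) ^ card (X - covered n M) * zb ^ key n E D wt X M)"
      unfolding sum_distrib_left
    proof (rule sum.cong[OF refl])
      fix M assume "M \<in> Pow (induced_pairs n E X)"
      have "prod ?z M = zb ^ (\<Sum>p\<in>M. D ^ 2 + D ^ 3 * wt p)" by (rule power_sum[symmetric])
      also have "(\<Sum>p\<in>M. D ^ 2 + D ^ 3 * wt p) = D ^ 2 * card M + D ^ 3 * sum wt M"
        by (simp add: sum.distrib sum_distrib_left)
      finally have "prod ?z M = zb ^ (D ^ 2 * card M + D ^ 3 * sum wt M)" .
      then have *: "a X * prod ?z M = zb ^ key n E D wt X M"
        unfolding a_def key_def by (simp add: power_add power_mult)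
      have "u * v * (w * x) = u * w * (v * x)" for u v w x :: nat by simp
      then show "?c * a X * ((1 + sg) ^ card (X - covered n M) * prod ?z M) =
        ?c * (1 + sg) ^ card (X - covered n M) * zb ^ key n E D wt X M"
        unfolding *[symmetric] .
    qed
    finally show "(\<Sum>Y\<in>Pow X. \<Sum>C\<in>Pow {..<n}. g X Y C) = (\<Sum>M\<in>Pow (induced_pairs n E X).
     ?c * (1 + sg) ^ card (X - covered n M) * zb ^ key n E D wt X M)" .
  qed
  finally show ?thesis .
qed

section \<open>Coefficients of the generating function\<close>

definition configs :: "nat \<Rightarrow> nat set set \<Rightarrow> (nat set \<times> nat set) set" where
  "configs n E = (SIGMA X:Pow {..<n}. Pow (induced_pairs n E X))"

definition config_weight :: "nat \<Rightarrow> nat set set \<Rightarrow> nat set \<Rightarrow> nat set \<Rightarrow> nat" where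
  "config_weight n E X M = card (cuts {..<n} {e \<in> E. e \<subseteq> X}) * 2 ^ ((n + 1) * card (X - covered n M))"

definition coef :: "nat \<Rightarrow> nat set set \<Rightarrow> nat \<Rightarrow> (nat \<Rightarrow> nat) \<Rightarrow> nat \<Rightarrow> nat" where
  "coef n E D wt q = (\<Sum>(X, M) | (X, M) \<in> configs n E \<and> key n E D wt X M = q. config_weight n E X M)"

text \<open>Number of bits that suffice for every coefficient.\<close>
definition slot :: "nat \<Rightarrow> nat" where "slot n = 2 * n * n + 3 * n + 1"

lemma finite_configs [simp]: "finite (configs n E)"
  by (simp add: configs_def)

lemma Zsum_coef:
  assumes E: "\<forall>e\<in>E. e \<subseteq> {..<n} \<and> card e = 2"
    and Q: "\<And>X M. (X, M) \<in> configs n E \<Longrightarrow> key n E D wt X M < Q"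
  shows "Zsum n E (2 ^ (n + 1) - 1) zb D wt = (\<Sum>q<Q. coef n E D wt q * zb ^ q)"
proof -
  have sg: "1 + ((2::nat) ^ (n + 1) - 1) = 2 ^ (n + 1)" by simp
  have "Zsum n E (2 ^ (n + 1) - 1) zb D wt =
     (\<Sum>(X, M)\<in>configs n E. config_weight n E X M * zb ^ key n E D wt X M)"
    unfolding Zsum_expand[OF E] sg configs_def config_weight_def power_mult[symmetric]
    by (subst sum.Sigma) (auto simp: mult.assoc)
  also have "\<dots> = (\<Sum>q<Q. \<Sum>(X, M) | (X, M) \<in> configs n E \<and> key n E D wt X M = q.
      config_weight n E X M * zb ^ key n E D wt X M)"
    using Q sum.group[of "configs n E" "{..<Q}" "\<lambda>(X, M). key n E D wt X M"
      "\<lambda>(X, M). config_weight n E X M * zb ^ key n E D wt X M"]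
    by (auto simp: case_prod_unfold image_subset_iff)
  also have "\<dots> = (\<Sum>q<Q. coef n E D wt q * zb ^ q)"
    unfolding coef_def sum_distrib_right by (intro sum.cong refl) auto
  finally show ?thesis .
qed

text \<open>There are at most \<open>2 ^ n\<close> sets X, at most \<open>2 ^ (n * n)\<close> sets M
  for each, at most \<open>2 ^ n\<close> cuts, and at most \<open>n\<close> uncovered vertices of
  weight \<open>2 ^ (n + 1)\<close>. The exponents add up to \<open>2 * n * n + 3 * n\<close>, one
  less than \<open>slot n\<close>.\<close>

lemma coef_less: "coef n E D wt q < 2 ^ slot n"
proof -
  have weight: "config_weight n E X M \<le> 2 ^ n * 2 ^ ((n + 1) * n)" if "(X, M) \<in> configs n E" for X M
  proof -
    have "card (cuts {..<n} {e \<in> E. e \<subseteq> X}) \<le> card (Pow {..<n})"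
      by (intro card_mono) (auto simp: cuts_def)
    moreover have "card (X - covered n M) \<le> card {..<n}"
      using that by (intro card_mono) (auto simp: configs_def)
    then have "(2::nat) ^ ((n + 1) * card (X - covered n M)) \<le> 2 ^ ((n + 1) * n)"
      by (intro power_increasing mult_le_mono2) simp_all
    ultimately show ?thesis unfolding config_weight_def by (intro mult_le_mono) (simp_all add: card_Pow)
  qed
  have "card (configs n E) = (\<Sum>X\<in>Pow {..<n}. card (Pow (induced_pairs n E X)))"
    unfolding configs_def by (rule card_SigmaI) auto
  also have "\<dots> \<le> (\<Sum>X\<in>Pow {..<n}. 2 ^ (n * n))"
    by (intro sum_mono) (simp add: card_Pow card_induced_pairs_le)
  finally have card: "card (configs n E) \<le> 2 ^ n * 2 ^ (n * n)" by (simp add: card_Pow)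
  have "coef n E D wt q \<le> (\<Sum>(X, M)\<in>configs n E. config_weight n E X M)"
    unfolding coef_def by (intro sum_mono2) auto
  also have "\<dots> \<le> (\<Sum>(X, M)\<in>configs n E. 2 ^ n * 2 ^ ((n + 1) * n))"
    using weight by (intro sum_mono) auto
  also have "\<dots> = card (configs n E) * (2 ^ n * 2 ^ ((n + 1) * n))" by (simp add: case_prod_unfold)
  also have "\<dots> \<le> (2 ^ n * 2 ^ (n * n)) * (2 ^ n * 2 ^ ((n + 1) * n))"
    using card by (rule mult_le_mono1)
  also have "\<dots> = 2 ^ (2 * n * n + 3 * n)"
    unfolding power_add[symmetric] by (rule arg_cong[where f = "\<lambda>k. 2 ^ k"]) (simp add: algebra_simps)
  also have "\<dots> < 2 ^ slot n" by (simp add: slot_def)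
  finally show ?thesis .
qed

lemma digit_extraction:
  fixes c :: "nat \<Rightarrow> nat"
  assumes c: "\<And>q. c q < b" and j: "j < Q"
  shows "(\<Sum>q<Q. c q * b ^ q) div b ^ j mod b = c j"
proof -
  have b: "0 < b" using c[of 0] by simp
  have low: "(\<Sum>q<j. c q * b ^ q) < b ^ j" for j
  proof (induction j)
    case (Suc j)
    have "(c j + 1) * b ^ j \<le> b * b ^ j" using c[of j] by (intro mult_le_mono1) simp
    with Suc show ?case by simp
  qed simp
  have "(\<Sum>q<Q. c q * b ^ q) = (\<Sum>q<j. c q * b ^ q) + (\<Sum>q=j..<Q. c q * b ^ q)"
    using j by (simp add: lessThan_atLeast0 sum.atLeastLessThan_concat)
  also have "(\<Sum>q=j..<Q. c q * b ^ q) = c j * b ^ j + (\<Sum>q=Suc j..<Q. c q * b ^ q)"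
    using j by (rule sum.atLeast_Suc_lessThan)
  also have "(\<Sum>q=Suc j..<Q. c q * b ^ q) = b ^ j * (b * (\<Sum>q=Suc j..<Q. c q * b ^ (q - Suc j)))"
    unfolding sum_distrib_left
  proof (rule sum.cong[OF refl])
    fix q assume "q \<in> {Suc j..<Q}"
    then have "q = j + Suc (q - Suc j)" by simp
    then have "b ^ q = b ^ j * (b * b ^ (q - Suc j))" by (metis power_add power_Suc)
    then show "c q * b ^ q = b ^ j * (b * (c q * b ^ (q - Suc j)))" by simp
  qed
  finally have "(\<Sum>q<Q. c q * b ^ q) =
      (\<Sum>q<j. c q * b ^ q) + b ^ j * (c j + b * (\<Sum>q=Suc j..<Q. c q * b ^ (q - Suc j)))"
    by (simp add: algebra_simps)
  then have "(\<Sum>q<Q. c q * b ^ q) div b ^ j = c j + b * (\<Sum>q=Suc j..<Q. c q * b ^ (q - Suc j))"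
    using low[of j] b by simp
  then show ?thesis using c[of j] by simp
qed

text \<open>The digits of \<open>q\<close> stand for |X|, b, |M| and the weight of M. A modulus that
  depends on b makes sense because all configurations with exponent \<open>q\<close> share the same
  b; the bound on b, which holds for forests, keeps \<open>n - b\<close> from being truncated. The
  weight digit is unconstrained, so the least weight need not be known.\<close>

definition found :: "nat \<Rightarrow> nat set set \<Rightarrow> nat \<Rightarrow> nat \<Rightarrow> (nat \<Rightarrow> nat) \<Rightarrow> nat \<Rightarrow> bool" where
  "found n E l D wt q \<longleftrightarrow> q mod D = 2 * (q div D ^ 2 mod D) \<and> l \<le> q mod D \<and> q div D mod D \<le> n \<and>
     coef n E D wt q mod 2 ^ (n - q div D mod D + 1) \<noteq> 0"

text \<open>Solutions are represented by their matchings alone, X being \<open>covered n M\<close>;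
  the cardinality condition makes the edges disjoint. Isolation within this family is enough,
  because configurations of the same exponent outside of it vanish modulo the tested power of
  two.\<close>

definition matching_family :: "nat \<Rightarrow> nat ugraph \<Rightarrow> nat \<Rightarrow> nat set set" where
  "matching_family n G l = {M. M \<subseteq> pairs n (edges G) \<and> card (covered n M) = 2 * card M \<and>
     l \<le> card (covered n M) \<and> uforest (induced G (covered n M))}"

text \<open>Every vertex of a cycle is an end of one of its edges, so padding with isolated vertices
  changes nothing. This is needed because cuts live on all vertices rather than on
  \<open>X\<close>.\<close>

lemma uforest_induced_iff:
  assumes "X \<subseteq> V"
  shows "uforest (induced G X) \<longleftrightarrow> uforest \<lparr>verts = V, edges = {e \<in> edges G. e \<subseteq> X}\<rparr>"
proof -
  have "set p \<subseteq> X" if "ucycle \<lparr>verts = V, edges = {e \<in> edges G. e \<subseteq> X}\<rparr> p" for p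
  proof
    fix x assume "x \<in> set p"
    then obtain i where i: "i < length p" "x = p ! i" by (auto simp: in_set_conv_nth)
    have len: "length p \<ge> 3" and "\<And>i. Suc i < length p \<Longrightarrow> {p ! i, p ! Suc i} \<subseteq> X"
      using that by (auto simp: ucycle_def)
    from this(2)[of i] this(2)[of "i - 1"] show "x \<in> X"
      using i len by (cases "Suc i < length p") auto
  qed
  then show ?thesis using assms unfolding uforest_def ucycle_def induced_def
    by (auto; blast)
qed

section \<open>Correctness of the coefficient test\<close>

context
  fixes n :: nat and G :: "nat ugraph" and D :: nat and wt :: "nat \<Rightarrow> nat" and E :: "nat set set"
  assumes G: "fin_ugraph G" "verts G = {..<n}" and D: "n * n < D"
    and wt: "\<And>M. M \<subseteq> pairs n (edges G) \<Longrightarrow> sum wt M < D"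
  defines E_def: "E \<equiv> edges G"
begin

lemma edge_props: "\<forall>e\<in>E. e \<subseteq> {..<n} \<and> card e = 2"
  using G by (auto simp: fin_ugraph_def E_def)

lemma key_digits:
  assumes "(X, M) \<in> configs n E"
  defines "q \<equiv> key n E D wt X M"
  shows "q mod D = card X" "q div D mod D = card (induced_pairs n E X)" "q div D ^ 2 mod D = card M"
    "q < D ^ 4" "q div D ^ 3 = sum wt M"
proof -
  have X: "X \<subseteq> {..<n}" and M: "M \<subseteq> induced_pairs n E X" using assms by (auto simp: configs_def)
  have "card X \<le> n" using card_mono[OF _ X] by simp
  moreover have "n \<le> n * n" by simp
  ultimately have a: "card X < D" using D by linarith
  have b: "card (induced_pairs n E X) < D" using card_induced_pairs_le[of n E X] D by linarith
  have c: "card M < D" using card_mono[OF _ M] b by simp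
  have d: "sum wt M < D" using M by (intro wt) (auto simp: induced_pairs_def E_def)
  have q: "q = card X + D * (card (induced_pairs n E X) + D * (card M + D * sum wt M))"
    by (simp add: q_def key_def algebra_simps power2_eq_square power3_eq_cube)
  have q1: "q div D = card (induced_pairs n E X) + D * (card M + D * sum wt M)" using a by (simp add: q)
  then have "q div D div D = card M + D * sum wt M" using b by simp
  then have q2: "q div D ^ 2 = card M + D * sum wt M" by (simp add: power2_eq_square div_mult2_eq)
  then have "q div D ^ 2 div D = sum wt M" using c by simp
  then show q3: "q div D ^ 3 = sum wt M" by (simp add: power2_eq_square power3_eq_cube div_mult2_eq)
  show "q mod D = card X" using a by (simp add: q)
  show "q div D mod D = card (induced_pairs n E X)" using b by (simp add: q1)
  show "q div D ^ 2 mod D = card M" using c by (simp add: q2)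
  have "q div D ^ 3 < D" using q3 d by simp
  then show "q < D ^ 4" using D by (simp add: div_less_iff_less_mult power_numeral_even power3_eq_cube mult.assoc flip: power_Suc)
qed

lemma config_weight_dvd:
  assumes XM: "(X, M) \<in> configs n E" and b: "card (induced_pairs n E X) \<le> n"
    and bad: "covered n M \<noteq> X \<or> \<not> uforest (induced G X)"
  shows "2 ^ (n - card (induced_pairs n E X) + 1) dvd config_weight n E X M"
proof (cases "covered n M = X")
  case False
  have X: "X \<subseteq> {..<n}" and M: "M \<subseteq> induced_pairs n E X" using XM by (auto simp: configs_def)
  have "covered n M \<subseteq> X" using M by (auto simp: covered_def induced_pairs_def)
  with False have "X - covered n M \<noteq> {}" by blast
  moreover have "finite X" using X by (rule finite_subset) simp
  ultimately have "1 \<le> card (X - covered n M)" by (simp add: Suc_le_eq card_gt_0_iff)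
  then have "(n + 1) * 1 \<le> (n + 1) * card (X - covered n M)" by (rule mult_le_mono2)
  then have "n - card (induced_pairs n E X) + 1 \<le> (n + 1) * card (X - covered n M)"
    unfolding mult_1_right by (rule order_trans[rotated]) simp
  then have "(2::nat) ^ (n - card (induced_pairs n E X) + 1) dvd 2 ^ ((n + 1) * card (X - covered n M))"
    by (rule le_imp_power_dvd)
  then show ?thesis unfolding config_weight_def by (rule dvd_mult)
next
  case True
  have X: "X \<subseteq> {..<n}" using XM by (auto simp: configs_def)
  have "2 ^ (card {..<n} - card {e \<in> E. e \<subseteq> X} + 1) dvd card (cuts {..<n} {e \<in> E. e \<subseteq> X})"
  proof (rule power_dvd_card_cuts_not_forest)
    show "\<not> uforest \<lparr>verts = {..<n}, edges = {e \<in> E. e \<subseteq> X}\<rparr>"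
      using True bad uforest_induced_iff[OF X, of G] by (simp add: E_def)
    show "card {e \<in> E. e \<subseteq> X} \<le> card {..<n}"
      using b card_induced_pairs[OF edge_props] by simp
  qed (use edge_props in auto)
  then show ?thesis unfolding config_weight_def
    by (simp add: card_induced_pairs[OF edge_props])
qed

lemma config_weight_good:
  assumes X: "X \<subseteq> {..<n}" and cov: "covered n M = X" and forest: "uforest (induced G X)"
  shows "card (induced_pairs n E X) \<le> n" "config_weight n E X M = 2 ^ (n - card (induced_pairs n E X))"
proof -
  have F: "uforest \<lparr>verts = {..<n}, edges = {e \<in> E. e \<subseteq> X}\<rparr>"
    using forest uforest_induced_iff[OF X, of G] by (simp add: E_def)
  have c: "card (induced_pairs n E X) = card {e \<in> E. e \<subseteq> X}"
    by (rule card_induced_pairs[OF edge_props])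
  show "card (induced_pairs n E X) \<le> n"
    unfolding c using card_cuts_forest(1)[OF _ _ F] edge_props by simp
  show "config_weight n E X M = 2 ^ (n - card (induced_pairs n E X))"
    unfolding c config_weight_def cov using card_cuts_forest(2)[OF _ _ F] edge_props by simp
qed

lemma perfect_matching_iff:
  assumes "X \<subseteq> {..<n}"
  shows "has_perfect_matching (induced G X) \<longleftrightarrow>
    (\<exists>M. M \<subseteq> edges (induced G X) \<and> \<Union>M = X \<and> card X = 2 * card M)"
  by (rule has_perfect_matching_induced_iff)
    (use finite_subset[OF assms] edge_props in \<open>auto simp: E_def\<close>)

text \<open>A sum that is not divisible by a power of two has a summand that is not. By
  \<open>config_weight_dvd\<close> this summand comes from a forest covered by M, and the digits of
  \<open>q\<close> supply |X| = 2 |M| and the lower bound on |X|. The weights may be arbitrary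
  within their bound, hence there are no false positives.\<close>

lemma found_sound:
  assumes "found n E l D wt q"
  shows "acyclic_matching G l"
proof -
  define b where "b = q div D mod D"
  have "\<not> 2 ^ (n - b + 1) dvd coef n E D wt q" using assms by (simp add: found_def b_def mod_eq_0_iff_dvd)
  then have "\<not> (\<forall>i. i \<in> configs n E \<and> (case i of (X, M) \<Rightarrow> key n E D wt X M = q) \<longrightarrow>
      2 ^ (n - b + 1) dvd (case i of (X, M) \<Rightarrow> config_weight n E X M))"
    unfolding coef_def by (force intro: dvd_sum)
  then obtain X M where XM: "(X, M) \<in> configs n E" "key n E D wt X M = q"
      "\<not> 2 ^ (n - b + 1) dvd config_weight n E X M"
    by auto
  note dig = key_digits[OF XM(1), unfolded XM(2)]
  have b: "b = card (induced_pairs n E X)" using dig by (simp add: b_def)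
  have "b \<le> n" using assms by (simp add: found_def b_def)
  with config_weight_dvd[OF XM(1)] XM(3) have good: "covered n M = X" "uforest (induced G X)"
    unfolding b by blast+
  have X: "X \<subseteq> {..<n}" and M: "M \<subseteq> induced_pairs n E X" using XM(1) by (auto simp: configs_def)
  have "inj_on (ends n) M" by (rule inj_on_subset[OF inj_on_ends[of n E]]) (use M in \<open>auto simp: induced_pairs_def\<close>)
  then have "card (ends n ` M) = card M" by (rule card_image)
  moreover have "card X = 2 * card M" using assms dig by (simp add: found_def)
  moreover have "ends n ` M \<subseteq> edges (induced G X)"
    using M by (auto simp: induced_pairs_def induced_def pairs_def E_def)
  moreover have "\<Union>(ends n ` M) = X" using good by (simp add: covered_def)
  ultimately have "ends n ` M \<subseteq> edges (induced G X) \<and> \<Union>(ends n ` M) = X \<and> card X = 2 * card (ends n ` M)"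
    by simp
  then have "has_perfect_matching (induced G X)"
    unfolding perfect_matching_iff[OF X] by (rule exI)
  moreover have "l \<le> card X" using assms dig by (simp add: found_def)
  ultimately show ?thesis using X good G unfolding acyclic_matching_def by auto
qed

lemma matching_family_nonempty:
  assumes "acyclic_matching G l"
  shows "matching_family n G l \<noteq> {}"
proof -
  obtain X where X: "X \<subseteq> {..<n}" "l \<le> card X" "uforest (induced G X)" "has_perfect_matching (induced G X)"
    using assms G by (auto simp: acyclic_matching_def)
  from X(4) obtain M' where M': "M' \<subseteq> edges (induced G X)" "\<Union>M' = X" "card X = 2 * card M'"
    unfolding perfect_matching_iff[OF X(1)] by blast
  define M where "M = {p \<in> pairs n E. ends n p \<in> M'}"
  have eq: "ends n ` pairs n E = E" by (rule ends_image_pairs[OF edge_props])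
  have "M' \<subseteq> E" using M'(1) by (auto simp: induced_def E_def)
  have im: "ends n ` M = M'"
  proof
    show "M' \<subseteq> ends n ` M"
    proof
      fix e assume e: "e \<in> M'"
      then obtain p where "p \<in> pairs n E" "e = ends n p" using \<open>M' \<subseteq> E\<close> eq by blast
      with e show "e \<in> ends n ` M" by (auto simp: M_def)
    qed
  qed (auto simp: M_def)
  have "inj_on (ends n) M" by (rule inj_on_subset[OF inj_on_ends[of n E]]) (auto simp: M_def)
  then have "card M' = card M" using card_image im by metis
  moreover have "covered n M = X" unfolding covered_def im by (rule M'(2))
  ultimately have "M \<in> matching_family n G l"
    using X M' by (auto simp: matching_family_def M_def E_def)
  then show ?thesis by blast
qed

text \<open>Exactly one summand of the coefficient, that of the isolated M, equals
  \<open>2 ^ (n - b)\<close>; all others are divisible by \<open>2 ^ (n - b + 1)\<close>, so nothing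
  can cancel it.\<close>

lemma found_complete:
  assumes "isolated wt (matching_family n G l)"
  shows "\<exists>q<D ^ 4. found n E l D wt q"
proof -
  obtain M where M: "M \<in> matching_family n G l"
    and min: "\<And>M'. M' \<in> matching_family n G l \<Longrightarrow> M' \<noteq> M \<Longrightarrow> sum wt M < sum wt M'"
    using assms by (auto simp: isolated_def)
  define X where "X = covered n M"
  define q where "q = key n E D wt X M"
  define b where "b = card (induced_pairs n E X)"
  have MP: "M \<subseteq> pairs n E" using M by (simp add: matching_family_def E_def)
  have X: "X \<subseteq> {..<n}"
    using MP edge_props unfolding X_def covered_def pairs_def by blast
  have XM: "(X, M) \<in> configs n E"
    using X MP by (auto simp: configs_def induced_pairs_def X_def covered_def)
  have forest: "uforest (induced G X)" using M by (simp add: matching_family_def X_def)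
  note good = config_weight_good[OF X X_def[symmetric] forest, folded b_def]
  note dig = key_digits[OF XM, folded q_def b_def]
  let ?S = "{i. i \<in> configs n E \<and> (case i of (X, M) \<Rightarrow> key n E D wt X M = q)}"
  have S: "coef n E D wt q = (\<Sum>(X, M)\<in>?S. config_weight n E X M)"
    unfolding coef_def by (intro sum.cong) auto
  have fin: "finite ?S" by simp
  have "2 ^ (n - b + 1) dvd (\<Sum>(X, M)\<in>?S - {(X, M)}. config_weight n E X M)"
  proof (rule dvd_sum)
    fix i assume i: "i \<in> ?S - {(X, M)}"
    obtain X' M' where i': "i = (X', M')" by (cases i)
    have XM': "(X', M') \<in> configs n E" "key n E D wt X' M' = q" "(X', M') \<noteq> (X, M)" using i i' by auto
    note dig' = key_digits[OF XM'(1), unfolded XM'(2)]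
    \<comment> \<open>A second good configuration with this exponent would yield a member of the
      family with the same weight. It differs from \<open>M\<close>, since the matching determines
      the vertex set, and so contradicts strict minimality.\<close>
    have "covered n M' \<noteq> X' \<or> \<not> uforest (induced G X')"
    proof (rule ccontr)
      assume "\<not> ?thesis"
      then have good': "covered n M' = X'" "uforest (induced G X')" by auto
      have "M' \<subseteq> pairs n E" using XM'(1) by (auto simp: configs_def induced_pairs_def)
      moreover have "card X' = card X" "card M' = card M" "sum wt M' = sum wt M" using dig dig' by simp_all
      moreover have "card X = 2 * card M" "l \<le> card X" using M by (simp_all add: matching_family_def X_def)
      ultimately have "M' \<in> matching_family n G l" using good' by (simp add: matching_family_def E_def)
      moreover have "M' \<noteq> M" using XM'(3) good' X_def by auto
      ultimately show False using min[of M'] \<open>sum wt M' = sum wt M\<close> by simp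
    qed
    moreover have "card (induced_pairs n E X') = b" using dig dig' by simp
    ultimately show "2 ^ (n - b + 1) dvd (case i of (X, M) \<Rightarrow> config_weight n E X M)"
      using config_weight_dvd[OF XM'(1)] good(1) unfolding i' by simp
  qed
  then obtain k where k: "(\<Sum>(X, M)\<in>?S - {(X, M)}. config_weight n E X M) = 2 ^ (n - b + 1) * k" ..
  have "coef n E D wt q = 2 ^ (n - b) + 2 ^ (n - b + 1) * k"
    unfolding S k[symmetric] using sum.remove[OF fin, of "(X, M)" "\<lambda>(X, M). config_weight n E X M"] XM good(2)
    by (simp add: q_def)
  then have "coef n E D wt q mod 2 ^ (n - b + 1) \<noteq> 0" by simp
  moreover have "card X = 2 * card M" "l \<le> card X" using M by (simp_all add: matching_family_def X_def)
  ultimately have "found n E l D wt q" using dig good(1) unfolding found_def by simp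
  then show ?thesis using dig(4) by blast
qed

text \<open>Only a residue modulo \<open>2 ^ k\<close> is tested. Because \<open>k\<close> is at
  most \<open>slot n\<close>, it can be taken right after the shift to digit \<open>q\<close>,
  without first isolating the whole digit.\<close>

lemma coef_extract:
  assumes "q < D ^ 4" "k \<le> slot n"
  shows "Zsum n E (2 ^ (n + 1) - 1) (2 ^ slot n) D wt div (2 ^ slot n) ^ q mod 2 ^ k = coef n E D wt q mod 2 ^ k"
proof -
  have "Zsum n E (2 ^ (n + 1) - 1) (2 ^ slot n) D wt = (\<Sum>q<D ^ 4. coef n E D wt q * (2 ^ slot n) ^ q)"
    by (rule Zsum_coef[OF edge_props]) (rule key_digits(4))
  then have "Zsum n E (2 ^ (n + 1) - 1) (2 ^ slot n) D wt div (2 ^ slot n) ^ q mod 2 ^ slot n = coef n E D wt q"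
    using digit_extraction[OF coef_less assms(1)] by simp
  moreover have "x mod 2 ^ slot n mod 2 ^ k = x mod 2 ^ k" for x :: nat
    using assms(2) by (simp add: mod_mod_cancel le_imp_power_dvd)
  ultimately show ?thesis by metis
qed

text \<open>The tables of the dynamic program are reduced modulo this bound; it guarantees that the
  reduced result is the true value.\<close>

lemma Zsum_less: "Zsum n E (2 ^ (n + 1) - 1) (2 ^ slot n) D wt < (2 ^ slot n) ^ (D ^ 4)"
proof -
  have eq: "Zsum n E (2 ^ (n + 1) - 1) (2 ^ slot n) D wt = (\<Sum>q<D ^ 4. coef n E D wt q * (2 ^ slot n) ^ q)"
    by (rule Zsum_coef[OF edge_props]) (rule key_digits(4))
  have "(\<Sum>q<j. coef n E D wt q * (2 ^ slot n) ^ q) < (2 ^ slot n) ^ j" for j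
  proof (induction j)
    case (Suc j)
    have "(coef n E D wt j + 1) * (2 ^ slot n) ^ j \<le> 2 ^ slot n * (2 ^ slot n) ^ j"
      using coef_less[of n E D wt j] by (intro mult_le_mono1) simp
    with Suc show ?case by simp
  qed simp
  then show ?thesis unfolding eq .
qed

end

section \<open>Elimination along a tree decomposition\<close>

text \<open>The root comes first and gets the parent \<open>N\<close>, which is no node; every other
  node is attached to an earlier one. Running through \<open>ord\<close> backwards therefore meets
  children before their parents.\<close>

definition rooted_order :: "nat \<Rightarrow> nat set set \<Rightarrow> (nat \<Rightarrow> nat) \<Rightarrow> (nat \<Rightarrow> nat) \<Rightarrow> bool" where
  "rooted_order N F ord par \<longleftrightarrow> inj_on ord {..<N} \<and> ord ` {..<N} = {..<N} \<and> par (ord 0) = N \<and>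
    (\<forall>j. 0 < j \<and> j < N \<longrightarrow> par (ord j) \<in> ord ` {..<j} \<and> {ord j, par (ord j)} \<in> F)"

lemma sym_edge_rel: "sym (edge_rel F)"
  by (auto simp: sym_def edge_rel_def insert_commute)

text \<open>Let \<open>x\<close> be the later node and \<open>y\<close> its parent. If
  \<open>y\<close> lacked \<open>v\<close>, the connected set of nodes with \<open>v\<close> would
  link \<open>x\<close> to the earlier node without the edge \<open>xy\<close>, and all earlier
  nodes, \<open>y\<close> among them, are linked to the root without that edge too. Then
  \<open>x\<close> and \<open>y\<close> would be connected without their own edge, which a forest
  forbids.\<close>

lemma running_intersection:
  assumes td: "tree_decomposition G T B" and V: "verts T = {..<N}"
    and ro: "rooted_order N (edges T) ord par"
    and j: "j < N" and i: "i < j" and v: "v \<in> B (ord j)" "v \<in> B (ord i)"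
  shows "v \<in> B (par (ord j))"
proof (rule ccontr)
  define x where "x = ord j"
  define y where "y = par (ord j)"
  define R where "R = edge_rel (edges T - {{x, y}})"
  assume "v \<notin> B (par (ord j))"
  then have vy: "v \<notin> B y" by (simp add: y_def)
  have inj: "inj_on ord {..<N}" and im: "ord ` {..<N} = {..<N}"
    and par: "\<And>j. 0 < j \<Longrightarrow> j < N \<Longrightarrow> par (ord j) \<in> ord ` {..<j} \<and> {ord j, par (ord j)} \<in> edges T"
    using ro by (auto simp: rooted_order_def)
  have xy: "{x, y} \<in> edges T" and y: "y \<in> ord ` {..<j}"
    using par[of j] i j by (auto simp: x_def y_def)
  have ord_ne: "ord k \<noteq> x" if "k < j" for k
    using inj_onD[OF inj, of k j] that j by (auto simp: x_def)
  have symR: "(b, a) \<in> R\<^sup>*" if "(a, b) \<in> R\<^sup>*" for a b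
    using that sym_rtrancl[OF sym_edge_rel] unfolding R_def by (meson symD)
  have root: "(ord k, ord 0) \<in> R\<^sup>*" if "k < j" for k
    using that
  proof (induction k rule: less_induct)
    case (less k)
    show ?case
    proof (cases "k = 0")
      case False
      with less.prems j have p: "par (ord k) \<in> ord ` {..<k}" "{ord k, par (ord k)} \<in> edges T"
        using par[of k] by auto
      then obtain k' where k': "k' < k" "par (ord k) = ord k'" by auto
      have "{ord k, par (ord k)} \<noteq> {x, y}"
        using ord_ne[of k] ord_ne[of k'] k' less.prems by (auto simp: doubleton_eq_iff)
      then have "(ord k, ord k') \<in> R" using p k' by (simp add: R_def edge_rel_def)
      moreover have "(ord k', ord 0) \<in> R\<^sup>*" using less.IH[OF k'(1)] k' less.prems by simp
      ultimately show ?thesis by (rule converse_rtrancl_into_rtrancl)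
    qed simp
  qed
  obtain k where k: "k < j" "y = ord k" using y by auto
  have "ord i \<in> {..<N}" "ord j \<in> {..<N}" using im i j by auto
  then have mem: "x \<in> {a \<in> verts T. v \<in> B a}" "ord i \<in> {a \<in> verts T. v \<in> B a}"
    using v V by (auto simp: x_def)
  have "v \<in> verts G" using td mem(1) unfolding tree_decomposition_def by blast
  then have "uconnected (induced T {a \<in> verts T. v \<in> B a})"
    using td unfolding tree_decomposition_def by blast
  then have "(x, ord i) \<in> (edge_rel (edges (induced T {a \<in> verts T. v \<in> B a})))\<^sup>*"
    using mem unfolding uconnected_def edge_rel_def by (simp add: induced_def)
  moreover have "edge_rel (edges (induced T {a \<in> verts T. v \<in> B a})) \<subseteq> R"
    unfolding R_def edge_rel_def using vy by (auto simp: induced_def doubleton_eq_iff)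
  ultimately have "(x, ord i) \<in> R\<^sup>*" using rtrancl_mono by blast
  also have "(ord i, ord 0) \<in> R\<^sup>*" by (rule root[OF i])
  also have "(ord 0, y) \<in> R\<^sup>*" unfolding k(2) by (rule symR[OF root[OF k(1)]])
  finally have "(x, y) \<in> R\<^sup>*" .
  moreover have "(x, y) \<notin> R\<^sup>*"
    unfolding R_def
  proof (rule uforest_edge_disconnected[where V = "verts T"])
    have "\<lparr>verts = verts T, edges = edges T\<rparr> = T" by (cases T) simp
    then show "uforest \<lparr>verts = verts T, edges = edges T\<rparr>"
      using td unfolding tree_decomposition_def utree_def by (elim conjE) (erule ssubst)
    show "e \<subseteq> verts T \<and> card e = 2" if "e \<in> edges T" for e
      using td that by (auto simp: tree_decomposition_def utree_def fin_ugraph_def)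
  qed fact
  ultimately show False by blast
qed

text \<open>Base-6 notation of the states on \<open>S\<close> that skips the vertices outside, with
  the largest vertex as the least significant digit. On a bag it enumerates the
  \<open>6 ^ card S\<close> states; on the vertices shared with a parent it indexes
  messages.\<close>

fun code :: "nat set \<Rightarrow> (nat \<Rightarrow> nat) \<Rightarrow> nat \<Rightarrow> nat" where
  "code S \<sigma> 0 = 0"
| "code S \<sigma> (Suc v) = (if v \<in> S then code S \<sigma> v * 6 + \<sigma> v else code S \<sigma> v)"

lemma code_cong:
  "(\<And>u. u < v \<Longrightarrow> u \<in> S \<Longrightarrow> \<sigma> u = \<tau> u) \<Longrightarrow> code S \<sigma> v = code S \<tau> v"
  by (induction v) auto

lemma code_less:
  assumes "\<And>u. u < v \<Longrightarrow> u \<in> S \<Longrightarrow> \<sigma> u < 6"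
  shows "code S \<sigma> v < 6 ^ card (S \<inter> {..<v})"
  using assms
proof (induction v)
  case (Suc v)
  have IH: "code S \<sigma> v < 6 ^ card (S \<inter> {..<v})" using Suc by simp
  show ?case
  proof (cases "v \<in> S")
    case True
    then have "S \<inter> {..<Suc v} = insert v (S \<inter> {..<v})" by auto
    then have "card (S \<inter> {..<Suc v}) = Suc (card (S \<inter> {..<v}))" by simp
    then show ?thesis using IH Suc.prems[of v] True by simp
  next
    case False
    then have "S \<inter> {..<Suc v} = S \<inter> {..<v}" by (auto simp: less_Suc_eq)
    with IH False show ?thesis by simp
  qed
qed simp

lemma code_inject:
  assumes "\<And>u. u < v \<Longrightarrow> u \<in> S \<Longrightarrow> \<sigma> u < 6" "\<And>u. u < v \<Longrightarrow> u \<in> S \<Longrightarrow> \<tau> u < 6"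
    and "code S \<sigma> v = code S \<tau> v" "u < v" "u \<in> S"
  shows "\<sigma> u = \<tau> u"
  using assms
proof (induction v)
  case (Suc v)
  show ?case
  proof (cases "v \<in> S")
    case True
    have eq: "code S \<sigma> v * 6 + \<sigma> v = code S \<tau> v * 6 + \<tau> v" using Suc.prems(3) True by simp
    have "\<sigma> v < 6" "\<tau> v < 6" using Suc.prems True by simp_all
    with arg_cong[OF eq, of "\<lambda>x. x mod 6"] arg_cong[OF eq, of "\<lambda>x. x div 6"]
    have "\<sigma> v = \<tau> v" "code S \<sigma> v = code S \<tau> v" by simp_all
    with Suc show ?thesis by (cases "u = v") auto
  next
    case False
    with Suc show ?thesis by (cases "u = v") auto
  qed
qed simp

lemma bij_betw_code:
  assumes S: "S \<subseteq> {..<n}"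
  shows "bij_betw (\<lambda>\<sigma>. code S \<sigma> n) (states S) {..<6 ^ card S}"
proof -
  have Sn: "S \<inter> {..<n} = S" using S by auto
  have fin: "finite S" using S by (rule finite_subset) simp
  have inj: "inj_on (\<lambda>\<sigma>. code S \<sigma> n) (states S)"
  proof (rule inj_onI)
    fix \<sigma> \<tau> assume \<sigma>: "\<sigma> \<in> states S" and \<tau>: "\<tau> \<in> states S" and eq: "code S \<sigma> n = code S \<tau> n"
    show "\<sigma> = \<tau>"
    proof (rule PiE_ext)
      show "\<sigma> \<in> PiE S (\<lambda>_. {..<6})" "\<tau> \<in> PiE S (\<lambda>_. {..<6})" using \<sigma> \<tau> by (simp_all add: states_def)
      show "\<sigma> u = \<tau> u" if "u \<in> S" for u
        using code_inject[OF _ _ eq, of u] \<sigma> \<tau> S that by (auto simp: states_def)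
    qed
  qed
  have sub: "(\<lambda>\<sigma>. code S \<sigma> n) ` states S \<subseteq> {..<6 ^ card S}"
  proof
    fix k assume "k \<in> (\<lambda>\<sigma>. code S \<sigma> n) ` states S"
    then obtain \<sigma> where "\<sigma> \<in> states S" "k = code S \<sigma> n" by auto
    then show "k \<in> {..<6 ^ card S}" using code_less[of n S \<sigma>] Sn by (auto simp: states_def)
  qed
  have "card (states S) = 6 ^ card S" using fin by (simp add: states_def card_PiE)
  then have "card ((\<lambda>\<sigma>. code S \<sigma> n) ` states S) = card {..<6 ^ card S :: nat}"
    by (simp add: card_image[OF inj])
  with sub have "(\<lambda>\<sigma>. code S \<sigma> n) ` states S = {..<6 ^ card S}" by (intro card_subset_eq) auto
  with inj show ?thesis by (simp add: bij_betw_def)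
qed

text \<open>A state on a union is a pair of states that agree on the intersection; this separates
  the sum over one bag from the sum over the remaining bags.\<close>

lemma sum_states_union:
  fixes f g :: "(nat \<Rightarrow> nat) \<Rightarrow> nat"
  assumes fin: "finite W" "finite X"
    and g: "\<And>\<sigma> \<tau>. (\<And>v. v \<in> W \<Longrightarrow> \<sigma> v = \<tau> v) \<Longrightarrow> g \<sigma> = g \<tau>"
    and f: "\<And>\<sigma> \<tau>. (\<And>v. v \<in> X \<Longrightarrow> \<sigma> v = \<tau> v) \<Longrightarrow> f \<sigma> = f \<tau>"
  shows "(\<Sum>\<sigma>\<in>states (W \<union> X). g \<sigma> * f \<sigma>) =
    (\<Sum>\<tau>\<in>states W. g \<tau> * (\<Sum>\<rho> | \<rho> \<in> states X \<and> (\<forall>v\<in>W \<inter> X. \<rho> v = \<tau> v). f \<rho>))"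
proof -
  let ?S = "SIGMA \<tau>:states W. {\<rho>. \<rho> \<in> states X \<and> (\<forall>v\<in>W \<inter> X. \<rho> v = \<tau> v)}"
  let ?join = "\<lambda>(\<tau>, \<rho>). restrict (\<lambda>v. if v \<in> W then \<tau> v else \<rho> v) (W \<union> X)"
  have "(\<Sum>\<sigma>\<in>states (W \<union> X). g \<sigma> * f \<sigma>) = (\<Sum>(\<tau>, \<rho>)\<in>?S. g \<tau> * f \<rho>)"
  proof (rule sum.reindex_bij_witness[of _ ?join "\<lambda>\<sigma>. (restrict \<sigma> W, restrict \<sigma> X)"])
    fix \<sigma> assume \<sigma>: "\<sigma> \<in> states (W \<union> X)"
    have "\<sigma> v = undefined" if "v \<notin> W" "v \<notin> X" for v
      using \<sigma> that by (simp add: states_def PiE_def extensional_def)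
    then show "?join (restrict \<sigma> W, restrict \<sigma> X) = \<sigma>" by (auto simp: fun_eq_iff restrict_def)
    show "(restrict \<sigma> W, restrict \<sigma> X) \<in> ?S" using \<sigma> by (auto simp: states_def)
    have "g (restrict \<sigma> W) = g \<sigma>" "f (restrict \<sigma> X) = f \<sigma>" by (auto intro: g f)
    then show "(case (restrict \<sigma> W, restrict \<sigma> X) of (\<tau>, \<rho>) \<Rightarrow> g \<tau> * f \<rho>) = g \<sigma> * f \<sigma>" by simp
  next
    fix i assume i: "i \<in> ?S"
    obtain \<tau> \<rho> where i': "i = (\<tau>, \<rho>)" by (cases i)
    have \<tau>: "\<tau> \<in> states W" and \<rho>: "\<rho> \<in> states X" and agree: "\<And>v. v \<in> W \<Longrightarrow> v \<in> X \<Longrightarrow> \<rho> v = \<tau> v"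
      using i i' by auto
    show "?join i \<in> states (W \<union> X)" using \<tau> \<rho> by (auto simp: i' states_def)
    have "\<tau> v = undefined" if "v \<notin> W" for v
      using \<tau> that by (simp add: states_def PiE_def extensional_def)
    moreover have "\<rho> v = undefined" if "v \<notin> X" for v
      using \<rho> that by (simp add: states_def PiE_def extensional_def)
    ultimately show "(restrict (?join i) W, restrict (?join i) X) = i"
      using agree by (auto simp: i' fun_eq_iff restrict_def)
  qed
  also have "\<dots> = (\<Sum>\<tau>\<in>states W. \<Sum>\<rho> | \<rho> \<in> states X \<and> (\<forall>v\<in>W \<inter> X. \<rho> v = \<tau> v). g \<tau> * f \<rho>)"
    using fin by (subst sum.Sigma) auto
  finally show ?thesis by (simp add: sum_distrib_left)
qed

section \<open>Messages and the elimination of one node\<close>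

definition children :: "nat \<Rightarrow> (nat \<Rightarrow> nat) \<Rightarrow> nat \<Rightarrow> nat set" where
  "children N par x = {y. y < N \<and> par y = x}"

definition node_value :: "nat \<Rightarrow> nat \<Rightarrow> (nat \<Rightarrow> nat) \<Rightarrow> (nat \<Rightarrow> nat set) \<Rightarrow> (nat \<Rightarrow> (nat \<Rightarrow> nat) \<Rightarrow> nat) \<Rightarrow>
    (nat \<Rightarrow> nat \<Rightarrow> nat) \<Rightarrow> nat \<Rightarrow> (nat \<Rightarrow> nat) \<Rightarrow> nat" where
  "node_value n N par B loc msg x \<rho> = loc x \<rho> * (\<Prod>y\<in>children N par x. msg y (code (B y \<inter> B x) \<rho> n))"

text \<open>
  The value of a partially evaluated partition function: \<open>A\<close> is the set of nodes still to be
  processed, and a processed node whose parent is not processed contributes through its message.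
\<close>
definition partial_sum :: "nat \<Rightarrow> nat \<Rightarrow> (nat \<Rightarrow> nat) \<Rightarrow> (nat \<Rightarrow> nat set) \<Rightarrow> (nat \<Rightarrow> (nat \<Rightarrow> nat) \<Rightarrow> nat) \<Rightarrow>
    (nat \<Rightarrow> nat \<Rightarrow> nat) \<Rightarrow> nat set \<Rightarrow> nat" where
  "partial_sum n N par B loc msg A = (\<Sum>\<sigma>\<in>states (\<Union>(B ` A)). (\<Prod>x\<in>A. loc x \<sigma>) *
     (\<Prod>y | y < N \<and> y \<notin> A \<and> (par y \<in> A \<or> N \<le> par y). msg y (code (B y \<inter> B (par y)) \<sigma> n)))"

lemma sum_mod_cong:
  fixes f g :: "'a \<Rightarrow> nat"
  assumes "\<And>x. x \<in> A \<Longrightarrow> f x mod q = g x mod q"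
  shows "sum f A mod q = sum g A mod q"
proof -
  have "sum f A mod q = (\<Sum>x\<in>A. f x mod q) mod q" by (rule mod_sum_eq[symmetric])
  also have "\<dots> = (\<Sum>x\<in>A. g x mod q) mod q" using assms by (simp cong: sum.cong)
  also have "\<dots> = sum g A mod q" by (rule mod_sum_eq)
  finally show ?thesis .
qed

text \<open>By the running intersection property the bag of \<open>x\<close> meets the other
  remaining bags only inside the bag of its parent. Hence the sum over the states of
  \<open>B x\<close> compatible with a fixed state of the rest depends only on the code on
  \<open>B x \<inter> B (par x)\<close>, and this inner sum is the new message. The alternative
  \<open>A = {}\<close> covers the root, which goes last.\<close>

lemma partial_sum_step:
  assumes A: "finite A" "x \<notin> A" "x < N" "A \<subseteq> {..<N}"
    and B: "\<And>y. B y \<subseteq> {..<n}" and BN: "\<And>y. N \<le> y \<Longrightarrow> B y = {}"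
    and par_x: "par x \<in> A \<or> N \<le> par x \<and> A = {}"
    and par_A: "\<And>y. y \<in> A \<Longrightarrow> par y \<noteq> x"
    and rip: "B x \<inter> \<Union>(B ` A) \<subseteq> B (par x)"
    and loc: "\<And>y \<sigma> \<tau>. y < N \<Longrightarrow> (\<And>v. v \<in> B y \<Longrightarrow> \<sigma> v = \<tau> v) \<Longrightarrow> loc y \<sigma> = loc y \<tau>"
    and msg_x: "\<And>k. msg' x k mod q = (\<Sum>\<rho> | \<rho> \<in> states (B x) \<and> code (B x \<inter> B (par x)) \<rho> n = k.
        node_value n N par B loc msg x \<rho>) mod q"
    and msg: "\<And>y. y < N \<Longrightarrow> y \<noteq> x \<Longrightarrow> msg' y = msg y"
  shows "partial_sum n N par B loc msg' A mod q = partial_sum n N par B loc msg (insert x A) mod q"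
proof -
  let ?W = "\<Union>(B ` A)"
  let ?S = "B x \<inter> B (par x)"
  define rest where "rest = {y. y < N \<and> y \<notin> insert x A \<and> (par y \<in> A \<or> N \<le> par y)}"
  define g where "g \<sigma> = (\<Prod>y\<in>A. loc y \<sigma>) * (\<Prod>y\<in>rest. msg y (code (B y \<inter> B (par y)) \<sigma> n))" for \<sigma>
  define f where "f = node_value n N par B loc msg x"
  have finB: "finite (B y)" for y by (rule finite_subset[OF B]) simp
  have finW: "finite ?W" using A finB by simp
  have S: "?W \<inter> B x = ?S"
  proof
    show "?S \<subseteq> ?W \<inter> B x" using par_x BN by (auto simp: A)
  qed (use rip in auto)
  have fr: "finite rest" by (simp add: rest_def)
  have split: "{y. y < N \<and> y \<notin> insert x A \<and> (par y \<in> insert x A \<or> N \<le> par y)} = rest \<union> children N par x"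
    and disj: "rest \<inter> children N par x = {}"
    using A par_A par_x unfolding rest_def children_def by auto
  have g_cong: "g \<sigma> = g \<tau>" if "\<And>v. v \<in> ?W \<Longrightarrow> \<sigma> v = \<tau> v" for \<sigma> \<tau>
  proof -
    have "loc y \<sigma> = loc y \<tau>" if "y \<in> A" for y using A that \<open>\<And>v. v \<in> ?W \<Longrightarrow> \<sigma> v = \<tau> v\<close> by (intro loc) auto
    moreover have "code (B y \<inter> B (par y)) \<sigma> n = code (B y \<inter> B (par y)) \<tau> n" if "y \<in> rest" for y
      using that \<open>\<And>v. v \<in> ?W \<Longrightarrow> \<sigma> v = \<tau> v\<close> BN by (intro code_cong) (auto simp: rest_def)
    ultimately show ?thesis unfolding g_def by (simp cong: prod.cong)
  qed
  have f_cong: "f \<sigma> = f \<tau>" if "\<And>v. v \<in> B x \<Longrightarrow> \<sigma> v = \<tau> v" for \<sigma> \<tau>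
  proof -
    have "loc x \<sigma> = loc x \<tau>" using A that by (intro loc) auto
    moreover have "code (B y \<inter> B x) \<sigma> n = code (B y \<inter> B x) \<tau> n" for y using that by (intro code_cong) auto
    ultimately show ?thesis unfolding f_def node_value_def by simp
  qed
  have "partial_sum n N par B loc msg (insert x A) = (\<Sum>\<sigma>\<in>states (?W \<union> B x). g \<sigma> * f \<sigma>)"
    unfolding partial_sum_def split
  proof (rule sum.cong)
    fix \<sigma> :: "nat \<Rightarrow> nat"
    have "(\<Prod>y\<in>children N par x. msg y (code (B y \<inter> B (par y)) \<sigma> n)) =
      (\<Prod>y\<in>children N par x. msg y (code (B y \<inter> B x) \<sigma> n))"
      by (rule prod.cong) (auto simp: children_def)
    then show "(\<Prod>y\<in>insert x A. loc y \<sigma>) * (\<Prod>y\<in>rest \<union> children N par x. msg y (code (B y \<inter> B (par y)) \<sigma> n)) = g \<sigma> * f \<sigma>"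
      using A disj fr unfolding g_def f_def node_value_def
      by (subst prod.union_disjoint) (auto simp: children_def mult_ac)
  qed (simp add: Un_commute)
  also have "\<dots> = (\<Sum>\<tau>\<in>states ?W. g \<tau> * (\<Sum>\<rho> | \<rho> \<in> states (B x) \<and> (\<forall>v\<in>?W \<inter> B x. \<rho> v = \<tau> v). f \<rho>))"
    by (rule sum_states_union[OF finW finB g_cong f_cong])
  also have "\<dots> = (\<Sum>\<tau>\<in>states ?W. g \<tau> * (\<Sum>\<rho> | \<rho> \<in> states (B x) \<and> code ?S \<rho> n = code ?S \<tau> n. f \<rho>))"
  proof (intro sum.cong refl arg_cong2[where f = "(*)"])
    fix \<tau> assume \<tau>: "\<tau> \<in> states ?W"
    have "(\<forall>v\<in>?W \<inter> B x. \<rho> v = \<tau> v) \<longleftrightarrow> code ?S \<rho> n = code ?S \<tau> n" if \<rho>: "\<rho> \<in> states (B x)" for \<rho>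
    proof
      assume "\<forall>v\<in>?W \<inter> B x. \<rho> v = \<tau> v"
      then show "code ?S \<rho> n = code ?S \<tau> n" unfolding S by (intro code_cong) auto
    next
      assume eq: "code ?S \<rho> n = code ?S \<tau> n"
      have 1: "\<rho> u < 6" "\<tau> u < 6" if "u \<in> ?S" for u
      proof -
        show "\<rho> u < 6" using \<rho> that by (auto simp: states_def)
        have "u \<in> ?W" using that S by blast
        with \<tau> show "\<tau> u < 6" by (auto simp: states_def)
      qed
      show "\<forall>v\<in>?W \<inter> B x. \<rho> v = \<tau> v"
        unfolding S
      proof
        fix v assume v: "v \<in> ?S"
        then have "v < n" using B by auto
        then show "\<rho> v = \<tau> v" using code_inject[OF _ _ eq, of v] 1 v by blast
      qed
    qed
    then show "{\<rho>. \<rho> \<in> states (B x) \<and> (\<forall>v\<in>?W \<inter> B x. \<rho> v = \<tau> v)} =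
       {\<rho>. \<rho> \<in> states (B x) \<and> code ?S \<rho> n = code ?S \<tau> n}" by blast
  qed
  finally have old: "partial_sum n N par B loc msg (insert x A) =
     (\<Sum>\<tau>\<in>states ?W. g \<tau> * (\<Sum>\<rho> | \<rho> \<in> states (B x) \<and> code ?S \<rho> n = code ?S \<tau> n. f \<rho>))" .
  have split': "{y. y < N \<and> y \<notin> A \<and> (par y \<in> A \<or> N \<le> par y)} = insert x rest" "x \<notin> rest"
    using A par_x unfolding rest_def by auto
  have new: "partial_sum n N par B loc msg' A = (\<Sum>\<tau>\<in>states ?W. g \<tau> * msg' x (code ?S \<tau> n))"
    unfolding partial_sum_def split'(1)
  proof (rule sum.cong[OF refl])
    fix \<tau> :: "nat \<Rightarrow> nat"
    have "(\<Prod>y\<in>rest. msg' y (code (B y \<inter> B (par y)) \<tau> n)) = (\<Prod>y\<in>rest. msg y (code (B y \<inter> B (par y)) \<tau> n))"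
      by (intro prod.cong refl) (use msg in \<open>auto simp: rest_def\<close>)
    then show "(\<Prod>x\<in>A. loc x \<tau>) * (\<Prod>y\<in>insert x rest. msg' y (code (B y \<inter> B (par y)) \<tau> n)) = g \<tau> * msg' x (code ?S \<tau> n)"
      using split'(2) fr by (simp add: g_def mult_ac)
  qed
  show ?thesis unfolding old new
  proof (rule sum_mod_cong)
    fix \<tau> :: "nat \<Rightarrow> nat"
    show "g \<tau> * msg' x (code ?S \<tau> n) mod q =
      g \<tau> * (\<Sum>\<rho> | \<rho> \<in> states (B x) \<and> code ?S \<rho> n = code ?S \<tau> n. f \<rho>) mod q"
      by (rule mod_mult_cong) (simp_all add: msg_x f_def)
  qed
qed

lemma partial_sum_empty:
  assumes "{y. y < N \<and> N \<le> par y} = {r}" "B (par r) = {}"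
  shows "partial_sum n N par B loc msg {} = msg r 0"
proof -
  have "code {} \<sigma> n = 0" for \<sigma> by (induction n) auto
  moreover have "states {} = {\<lambda>_. undefined}" by (simp add: states_def)
  ultimately show ?thesis using assms by (simp add: partial_sum_def)
qed

lemma partial_sum_full:
  assumes "\<Union>(B ` {..<N}) = {..<n}" and
    "\<And>\<sigma>. (\<Prod>x<N. loc x \<sigma>) = (\<Prod>p<n * n. pf p \<sigma>)"
  shows "partial_sum n N par B loc msg {..<N} = (\<Sum>\<sigma>\<in>states {..<n}. \<Prod>p<n * n. pf p \<sigma>)"
proof -
  have "{y. y < N \<and> y \<notin> {..<N} \<and> (par y \<in> {..<N} \<or> N \<le> par y)} = {}" by auto
  then show ?thesis unfolding partial_sum_def assms by (simp only: prod.empty mult_1_right)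
qed

section \<open>Program verification\<close>

text \<open>If all cells have at most \<open>L\<close> bits, the value of \<open>e\<close> has at
  most \<open>L * vsize e\<close> bits: lengths add under multiplication, and no other operation
  does worse. Measuring relative to \<open>L\<close> keeps the constants independent of the
  instance.\<close>

fun vsize :: "expr \<Rightarrow> nat" where
  "vsize (Const k) = 1 + bits k"
| "vsize (Get a i) = 1"
| "vsize (Op f e e') = vsize e + vsize e'"

fun csize :: "expr \<Rightarrow> nat" where
  "csize (Const k) = 1 + bits k"
| "csize (Get a i) = csize i + 2 + vsize i"
| "csize (Op f e e') = csize e + csize e' + 1 + 2 * (vsize e + vsize e')"

text \<open>A loop is charged like one pass through its body; the number of passes enters through
  the separate factor \<open>J\<close>. So \<open>tc\<close> is a constant of the program text and
  finally becomes part of the constant of the running time.\<close>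

fun tc :: "com \<Rightarrow> nat" where
  "tc Skip = 1"
| "tc (Put a i e) = csize i + csize e + 1 + vsize i + vsize e"
| "tc (Flip a i) = csize i + 1 + vsize i"
| "tc (Seq c c') = tc c + tc c'"
| "tc (Cond e c c') = csize e + 1 + tc c + tc c'"
| "tc (Loop e c) = csize e + 1 + tc c"

fun reads :: "expr \<Rightarrow> string set" where
  "reads (Const k) = {}"
| "reads (Get a i) = insert a (reads i)"
| "reads (Op f e e') = reads e \<union> reads e'"

fun mods :: "com \<Rightarrow> string set" where
  "mods Skip = {}"
| "mods (Put a i e) = {a}"
| "mods (Flip a i) = {a}"
| "mods (Seq c c') = mods c \<union> mods c'"
| "mods (Cond e c c') = mods c \<union> mods c'"
| "mods (Loop e c) = mods c"

fun flip_free :: "com \<Rightarrow> bool" where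
  "flip_free Skip = True"
| "flip_free (Put a i e) = True"
| "flip_free (Flip a i) = False"
| "flip_free (Seq c c') = (flip_free c \<and> flip_free c')"
| "flip_free (Cond e c c') = (flip_free c \<and> flip_free c')"
| "flip_free (Loop e c) = flip_free c"

definition bounded_memory :: "nat \<Rightarrow> memory \<Rightarrow> bool" where
  "bounded_memory L m \<longleftrightarrow> 0 < L \<and> (\<forall>a i. m a i < 2 ^ L)"

lemma update_apply [simp]: "update m a i k b = (if b = a then (m a)(i := k) else m b)"
  by (simp add: update_def)

lemma less_two_power_bits: "k < 2 ^ bits k"
  by (cases "k = 0") (auto simp: floorlog_bounds)

lemma bits_le: "v < 2 ^ k \<Longrightarrow> bits v \<le> k"
  by (rule floorlog_leI) auto

lemma le_mult_pos: "0 < k \<Longrightarrow> a \<le> a * k" "0 < k \<Longrightarrow> a \<le> k * a" for a k :: nat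
  by (cases k; simp)+

lemma vsize_pos: "0 < vsize e"
  by (induction e) auto

text \<open>The sum of two numbers that are at least 2 is at most their product, so addition fits
  the bound made for multiplication.\<close>

lemma add_less_power_mult:
  fixes a b x y :: nat
  assumes "x < 2 ^ a" "y < 2 ^ b" "0 < a" "0 < b"
  shows "x + y < 2 ^ (a + b)"
proof -
  have "x + y \<le> (2 ^ a - 1) + (2 ^ b - 1)" using assms by linarith
  moreover have "(2::nat) \<le> 2 ^ a" "(2::nat) \<le> 2 ^ b"
    using assms power_increasing[of 1 _ "2::nat"] by simp_all
  moreover have "u + v \<le> u * v" if "2 \<le> u" "2 \<le> v" for u v :: nat
  proof -
    obtain i j where "u = 2 + i" "v = 2 + j" using \<open>2 \<le> u\<close> \<open>2 \<le> v\<close> le_Suc_ex by metis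
    then show ?thesis by (simp add: algebra_simps)
  qed
  ultimately have "x + y \<le> 2 ^ a * 2 ^ b - 2" by fastforce
  moreover have "(0::nat) < 2 ^ a * 2 ^ b" by simp
  ultimately show ?thesis unfolding power_add by linarith
qed

lemma val_less:
  assumes "bounded_memory L m"
  shows "val e m < 2 ^ (L * vsize e)"
proof (induction e)
  case (Const k)
  have "k < 2 ^ bits k" by (rule less_two_power_bits)
  also have "\<dots> \<le> 2 ^ (L * vsize (Const k))"
    using assms le_mult_pos(2)[of L "1 + bits k"]
    by (intro power_increasing) (simp_all add: bounded_memory_def)
  finally show ?case by simp
next
  case (Get a i)
  then show ?case using assms by (simp add: bounded_memory_def)
next
  case (Op f e e')
  let ?a = "L * vsize e" and ?b = "L * vsize e'"
  have pos: "0 < ?a" "0 < ?b" using assms by (auto simp: bounded_memory_def vsize_pos)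
  have le: "(2::nat) ^ ?a \<le> 2 ^ (?a + ?b)" by (rule power_increasing) auto
  have two: "(1::nat) < 2 ^ (?a + ?b)" using pos by (intro one_less_power) auto
  have eq: "L * vsize (Op f e e') = ?a + ?b" by (simp add: distrib_left)
  have "apply_op f (val e m) (val e' m) < 2 ^ (?a + ?b)"
  proof (cases f)
    case Times
    have "val e m * val e' m < 2 ^ ?a * 2 ^ ?b"
      using Op.IH by (intro mult_strict_mono) auto
    then show ?thesis using Times by (simp add: power_add)
  next
    case Plus
    then show ?thesis using add_less_power_mult[OF Op.IH pos] by simp
  next
    case Minus
    moreover have "val e m < 2 ^ (?a + ?b)" using Op.IH(1) le by (rule less_le_trans)
    ultimately show ?thesis by (simp add: less_imp_diff_less)
  next
    case Quotient
    moreover have "val e m < 2 ^ (?a + ?b)" using Op.IH(1) le by (rule less_le_trans)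
    ultimately show ?thesis by (simp add: le_less_trans[OF div_le_dividend])
  next
    case Remainder
    moreover have "val e m < 2 ^ (?a + ?b)" using Op.IH(1) le by (rule less_le_trans)
    ultimately show ?thesis by (simp add: le_less_trans[OF mod_less_eq_dividend])
  qed (use two in auto)
  then show ?case unfolding eq by simp
qed

lemma bits_val_le: "bounded_memory L m \<Longrightarrow> bits (val e m) \<le> L * vsize e"
  by (rule bits_le) (rule val_less)

lemma cost_le:
  assumes "bounded_memory L m"
  shows "cost e m \<le> L * csize e"
proof (induction e)
  case (Const k)
  show ?case using assms le_mult_pos(2)[of L "1 + bits k"] by (simp add: bounded_memory_def)
next
  case (Get a i)
  have "bits (m a (val i m)) \<le> L"
    using assms by (intro bits_le) (simp add: bounded_memory_def)
  moreover have "1 \<le> L" using assms by (simp add: bounded_memory_def)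
  moreover note Get bits_val_le[OF assms, of i]
  ultimately show ?case by (simp add: distrib_left)
next
  case (Op f e e')
  have "1 \<le> L" using assms by (simp add: bounded_memory_def)
  moreover note Op bits_val_le[OF assms, of e] bits_val_le[OF assms, of e']
    bits_val_le[OF assms, of "Op f e e'"]
  ultimately show ?case by (simp add: distrib_left)
qed

lemma val_cong_reads:
  assumes "\<And>a. a \<in> reads e \<Longrightarrow> m a = m' a"
  shows "val e m = val e m'"
  using assms by (induction e) auto

lemma exec_frame:
  assumes "exec c s t s'"
  shows "(\<forall>a. a \<notin> mods c \<longrightarrow> fst s' a = fst s a) \<and> (flip_free c \<longrightarrow> snd s' = snd s)"
  using assms by (induction rule: exec.induct) auto

text \<open>
  The running time is bounded by the word length \<open>L\<close>, a constant \<open>tc c\<close> of the program text, and a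
  bound \<open>J\<close> on the number of iterations in nested loops.
\<close>
definition wp :: "nat \<Rightarrow> nat \<Rightarrow> com \<Rightarrow> (memory \<Rightarrow> bool stream \<Rightarrow> bool) \<Rightarrow> memory \<Rightarrow> bool stream \<Rightarrow> bool" where
  "wp L J c Q m w \<longleftrightarrow> (\<exists>t m' w'. exec c (m, w) t (m', w') \<and> t \<le> L * (tc c * J) \<and> bounded_memory L m' \<and> Q m' w')"

lemma wpI:
  assumes "exec c (m, w) t (m', w')" "t \<le> L * (tc c * J)" "bounded_memory L m'" "Q m' w'"
  shows "wp L J c Q m w"
  using assms unfolding wp_def by blast

text \<open>Consequence and frame rule in one: the new postcondition may use that the memory stays
  bounded, that arrays not assigned by \<open>c\<close> are unchanged and that a program without
  \<open>Flip\<close> leaves the tosses alone. The iteration bound can be relaxed to the common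
  bound of a sequence.\<close>

lemma wp_conseq:
  assumes "wp L J c Q m w" "J \<le> J'"
    and "\<And>m' w'. \<lbrakk>Q m' w'; bounded_memory L m'; \<And>a. a \<notin> mods c \<Longrightarrow> m' a = m a;
      flip_free c \<Longrightarrow> w' = w\<rbrakk> \<Longrightarrow> R m' w'"
  shows "wp L J' c R m w"
proof -
  obtain t m' w' where run: "exec c (m, w) t (m', w')" and t: "t \<le> L * (tc c * J)"
    and b: "bounded_memory L m'" and Q: "Q m' w'"
    using assms(1) unfolding wp_def by blast
  have "L * (tc c * J) \<le> L * (tc c * J')" using assms(2) by simp
  with t have "t \<le> L * (tc c * J')" by (rule le_trans)
  moreover have "R m' w'" using exec_frame[OF run] by (intro assms(3)[OF Q b]) auto
  ultimately show ?thesis using wpI[OF run _ b] by blast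
qed

lemma wp_Skip:
  assumes "bounded_memory L m" "0 < J" "Q m w"
  shows "wp L J Skip Q m w"
  by (rule wpI[OF exec.Skip]) (use assms in \<open>auto simp: bounded_memory_def Suc_le_eq\<close>)

lemma bounded_update:
  "bounded_memory L m \<Longrightarrow> k < 2 ^ L \<Longrightarrow> bounded_memory L (update m a i k)"
  by (simp add: bounded_memory_def)

text \<open>Only the stored value has to fit into \<open>L\<close> bits. Indices and intermediate
  values of expressions may be longer; their cost is covered by \<open>csize\<close> and
  \<open>vsize\<close>.\<close>

lemma wp_Put:
  assumes "bounded_memory L m" "0 < J" "val e m < 2 ^ L"
    and "bounded_memory L (update m a (val i m) (val e m)) \<Longrightarrow> Q (update m a (val i m) (val e m)) w"
  shows "wp L J (Put a i e) Q m w"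
proof (rule wpI[OF exec.Put])
  have "1 \<le> L" using assms(1) by (simp add: bounded_memory_def)
  then have "cost i m + cost e m + 1 + bits (val i m) + bits (val e m) \<le> L * tc (Put a i e)"
    using cost_le[OF assms(1), of i] cost_le[OF assms(1), of e]
      bits_val_le[OF assms(1), of i] bits_val_le[OF assms(1), of e]
    by (simp add: distrib_left)
  also have "\<dots> \<le> L * (tc (Put a i e) * J)" using assms(2) by (intro mult_le_mono2 le_mult_pos)
  finally show "cost i m + cost e m + 1 + bits (val i m) + bits (val e m)
      \<le> L * (tc (Put a i e) * J)" .
qed (use assms bounded_update in blast)+

lemma wp_Flip:
  assumes "bounded_memory L m" "0 < J"
    and "bounded_memory L (update m a (val i m) (of_bool (shd w))) \<Longrightarrow>
       Q (update m a (val i m) (of_bool (shd w))) (stl w)"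
  shows "wp L J (Flip a i) Q m w"
proof (rule wpI[OF exec.Flip])
  have L: "1 \<le> L" using assms(1) by (simp add: bounded_memory_def)
  then have "cost i m + 1 + bits (val i m) \<le> L * tc (Flip a i)"
    using cost_le[OF assms(1), of i] bits_val_le[OF assms(1), of i]
    by (simp add: distrib_left)
  also have "\<dots> \<le> L * (tc (Flip a i) * J)" using assms(2) by (intro mult_le_mono2 le_mult_pos)
  finally show "cost i m + 1 + bits (val i m) \<le> L * (tc (Flip a i) * J)" .
  have "(1::nat) < 2 ^ L" using L by (intro one_less_power) auto
  then show b: "bounded_memory L (update m a (val i m) (if shd w then 1 else 0))"
    by (intro bounded_update assms) auto
  then show "Q (update m a (val i m) (if shd w then 1 else 0)) (stl w)"
    using assms(3) by (simp add: of_bool_def)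
qed

lemma wp_Seq:
  assumes "wp L J c (\<lambda>m' w'. wp L J c' Q m' w') m w"
  shows "wp L J (Seq c c') Q m w"
proof -
  obtain t m1 w1 where run: "exec c (m, w) t (m1, w1)" and t: "t \<le> L * (tc c * J)"
    and Q: "wp L J c' Q m1 w1"
    using assms unfolding wp_def by blast
  obtain t' m2 w2 where run': "exec c' (m1, w1) t' (m2, w2)" and t': "t' \<le> L * (tc c' * J)"
    and b: "bounded_memory L m2" and Q: "Q m2 w2"
    using Q unfolding wp_def by blast
  show ?thesis
  proof (rule wpI[where J = J and Q = Q, OF exec.Seq[OF run run']])
    show "t + t' \<le> L * (tc (Seq c c') * J)"
      using t t' by (simp add: distrib_left distrib_right)
  qed fact+
qed

lemma wp_Cond:
  assumes "bounded_memory L m" "0 < J"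
    and "val e m \<noteq> 0 \<Longrightarrow> wp L J c Q m w" "val e m = 0 \<Longrightarrow> wp L J c' Q m w"
  shows "wp L J (Cond e c c') Q m w"
proof -
  have *: "cost e m + 1 + t \<le> L * (tc (Cond e c c') * J)" if "t \<le> L * (d * J)" "d \<le> tc c + tc c'" for t d
  proof -
    have "1 \<le> L" using assms(1) by (simp add: bounded_memory_def)
    with cost_le[OF assms(1), of e] have "cost e m + 1 \<le> L * (csize e + 1)"
      by (simp add: distrib_left)
    also have "\<dots> \<le> L * ((csize e + 1) * J)" using assms(2) by (intro mult_le_mono2 le_mult_pos)
    finally have "cost e m + 1 + t \<le> L * ((csize e + 1) * J) + L * (d * J)" using that(1) by simp
    also have "\<dots> = L * ((csize e + 1 + d) * J)" by (simp add: algebra_simps)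
    also have "\<dots> \<le> L * (tc (Cond e c c') * J)"
      using that(2) by (intro mult_le_mono2 mult_le_mono1) simp
    finally show ?thesis .
  qed
  show ?thesis
  proof (cases "val e m = 0")
    case True
    then obtain t m' w' where "exec c' (m, w) t (m', w')" "t \<le> L * (tc c' * J)"
      "bounded_memory L m'" "Q m' w'"
      using assms(4) unfolding wp_def by blast
    with True show ?thesis by (intro wpI[OF exec.Cond_false] *[of _ "tc c'"]) auto
  next
    case False
    then obtain t m' w' where "exec c (m, w) t (m', w')" "t \<le> L * (tc c * J)"
      "bounded_memory L m'" "Q m' w'"
      using assms(3) unfolding wp_def by blast
    with False show ?thesis by (intro wpI[OF exec.Cond_true] *[of _ "tc c"]) auto
  qed
qed

abbreviation V :: "string \<Rightarrow> expr" where "V x \<equiv> Get x (Const 0)"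

text \<open>The only form of loop in the program. Its bound is evaluated anew before every pass,
  which is why the loop rule forbids the body to assign arrays that the bound reads.\<close>

definition For :: "string \<Rightarrow> expr \<Rightarrow> com \<Rightarrow> com" where
  "For i e c = Seq (Put i (Const 0) (Const 0))
     (Loop (Op Less (V i) e) (Seq c (Put i (Const 0) (Op Plus (V i) (Const 1)))))"

lemma mods_For [simp]: "mods (For i e c) = insert i (mods c)"
  by (auto simp: For_def)

lemma flip_free_For [simp]: "flip_free (For i e c) = flip_free c"
  by (auto simp: For_def)

text \<open>The factor \<open>Suc K\<close> instead of \<open>K\<close> pays for the initialisation
  and the final test. The invariant is stated for the memory in which the counter has already
  advanced. Step and exit may use the frame conditions, so invariants need only mention what
  changes.\<close>

lemma wp_For:
  assumes L: "bounded_memory L m" and J: "0 < J" and K: "val e m = K" "K < 2 ^ L"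
    and dis: "i \<notin> mods c" "i \<notin> reads e" "mods c \<inter> reads e = {}"
    and init: "I 0 (update m i 0 0) w"
    and step: "\<And>k m' w'. \<lbrakk>k < K; I k m' w'; bounded_memory L m'; m' i 0 = k; val e m' = K;
        \<And>a. a \<notin> insert i (mods c) \<Longrightarrow> m' a = m a\<rbrakk> \<Longrightarrow>
        wp L J c (\<lambda>m'' w''. I (Suc k) (update m'' i 0 (Suc k)) w'') m' w'"
    and exit: "\<And>m' w'. \<lbrakk>I K m' w'; bounded_memory L m'; \<And>a. a \<notin> insert i (mods c) \<Longrightarrow> m' a = m a;
        flip_free c \<Longrightarrow> w' = w\<rbrakk> \<Longrightarrow> Q m' w'"
  shows "wp L (Suc K * J) (For i e c) Q m w"
proof -
  define inc where "inc = Put i (Const 0) (Op Plus (V i) (Const 1))"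
  define g where "g = Op Less (V i) e"
  define loop where "loop = Loop g (Seq c inc)"
  have frame_e: "val e m' = K" if "\<And>a. a \<notin> insert i (mods c) \<Longrightarrow> m' a = m a" for m'
    using val_cong_reads[of e m' m] that dis K by fastforce
  have L1: "1 \<le> L" using L by (simp add: bounded_memory_def)
  have main: "\<exists>t m'' w''. exec loop (m', w') t (m'', w'') \<and> t \<le> L * (tc loop * Suc (d * J)) \<and>
      bounded_memory L m'' \<and> I K m'' w''  "
    if "k + d = K" "I k m' w'" "bounded_memory L m'" "m' i 0 = k"
       "\<And>a. a \<notin> insert i (mods c) \<Longrightarrow> m' a = m a" for d k m' w'
    using that
  proof (induction d arbitrary: k m' w')
    case 0
    have "val g m' = 0" using 0 frame_e[OF 0(5)] by (simp add: g_def)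
    then have run: "exec loop (m', w') (cost g m' + 1) (m', w')"
      unfolding loop_def by (rule exec.Loop_false)
    have "cost g m' + 1 \<le> L * (csize g + 1)"
      using cost_le[OF 0(3), of g] L1 by (simp add: distrib_left)
    also have "\<dots> \<le> L * (tc loop * Suc (0 * J))" by (simp add: loop_def distrib_left)
    finally show ?case using run 0 by auto
  next
    case (Suc d)
    have k: "k < K" using Suc.prems(1) by simp
    have g: "val g m' \<noteq> 0" using Suc.prems frame_e[OF Suc.prems(5)] k by (simp add: g_def)
    from step[OF k Suc.prems(2,3,4) frame_e[OF Suc.prems(5)] Suc.prems(5)]
    obtain t1 m1 w1 where run1: "exec c (m', w') t1 (m1, w1)" and t1: "t1 \<le> L * (tc c * J)"
      and b1: "bounded_memory L m1" and I1: "I (Suc k) (update m1 i 0 (Suc k)) w1"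
      unfolding wp_def by blast
    have m1: "\<And>a. a \<notin> mods c \<Longrightarrow> m1 a = m' a" using exec_frame[OF run1] by simp
    then have m1i: "m1 i 0 = k" using dis(1) Suc.prems(4) by simp
    define m2 where "m2 = update m1 i 0 (Suc k)"
    have "wp L 1 inc (\<lambda>m'' w''. m'' = m2 \<and> w'' = w1) m1 w1"
      unfolding inc_def by (rule wp_Put) (use b1 k K m1i in \<open>auto simp: m2_def\<close>)
    then obtain t2 where run2: "exec inc (m1, w1) t2 (m2, w1)" and t2: "t2 \<le> L * tc inc"
      and b2: "bounded_memory L m2" unfolding wp_def by auto
    have "\<exists>t m'' w''. exec loop (m2, w1) t (m'', w'') \<and> t \<le> L * (tc loop * Suc (d * J)) \<and>
      bounded_memory L m'' \<and> I K m'' w''"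
    proof (rule Suc.IH[of "Suc k" m2 w1])
      show "Suc k + d = K" using Suc.prems by simp
      show "m2 a = m a" if "a \<notin> insert i (mods c)" for a
        using that m1 Suc.prems(5) by (simp add: m2_def)
      show "I (Suc k) m2 w1" using I1 unfolding m2_def .
      show "m2 i 0 = Suc k" by (simp add: m2_def)
    qed fact
    then obtain t3 m3 w3 where run3: "exec loop (m2, w1) t3 (m3, w3)"
      and t3: "t3 \<le> L * (tc loop * Suc (d * J))" and fin: "bounded_memory L m3" "I K m3 w3"
      by blast
    have run: "exec loop (m', w') (cost g m' + 1 + (t1 + t2) + t3) (m3, w3)"
      unfolding loop_def
      by (rule exec.Loop_true[OF g exec.Seq[OF run1 run2]]) (use run3 in \<open>simp add: loop_def\<close>)
    have "cost g m' + 1 + t2 \<le> L * (csize g + 1 + tc inc)"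
      using cost_le[OF Suc.prems(3), of g] L1 t2 by (simp add: distrib_left)
    also have "\<dots> \<le> L * ((csize g + 1 + tc inc) * J)"
      using J by (intro mult_le_mono2 le_mult_pos)
    finally have "cost g m' + 1 + (t1 + t2) + t3 \<le>
       L * ((csize g + 1 + tc inc) * J) + L * (tc c * J) + L * (tc loop * Suc (d * J))"
      using t1 t3 by linarith
    also have "\<dots> = L * (tc loop * Suc (Suc d * J))"
      by (simp add: loop_def algebra_simps)
    finally show ?case using run fin by blast
  qed
  have "wp L 1 (Put i (Const 0) (Const 0)) (\<lambda>m'' w''. m'' = update m i 0 0 \<and> w'' = w) m w"
    by (rule wp_Put) (use L in auto)
  then obtain t0 where run0: "exec (Put i (Const 0) (Const 0)) (m, w) t0 (update m i 0 0, w)"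
    and t0: "t0 \<le> L * tc (Put i (Const 0) (Const 0))" and b0: "bounded_memory L (update m i 0 0)"
    unfolding wp_def by auto
  from main[of 0 K "update m i 0 0" w] init b0
  obtain t m' w' where run: "exec loop (update m i 0 0, w) t (m', w')"
    and t: "t \<le> L * (tc loop * Suc (K * J))" and fin: "bounded_memory L m'" "I K m' w'"
    by auto
  have run': "exec (For i e c) (m, w) (t0 + t) (m', w')"
    unfolding For_def using exec.Seq[OF run0 run] by (simp add: loop_def g_def inc_def)
  show ?thesis
  proof (rule wpI[OF run'])
    have "t0 + t \<le> L * (tc (Put i (Const 0) (Const 0)) * Suc (K * J)) + L * (tc loop * Suc (K * J))"
    proof -
      have "L * tc (Put i (Const 0) (Const 0)) \<le> L * (tc (Put i (Const 0) (Const 0)) * Suc (K * J))" by simp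
      then show ?thesis using t0 t by linarith
    qed
    also have "\<dots> = L * (tc (For i e c) * Suc (K * J))"
      by (simp add: For_def loop_def g_def inc_def algebra_simps)
    also have "\<dots> \<le> L * (tc (For i e c) * (Suc K * J))"
      using J by (intro mult_le_mono2) simp
    finally show "t0 + t \<le> L * (tc (For i e c) * (Suc K * J))" .
    show "Q m' w'" using exec_frame[OF run'] fin by (intro exit) auto
  qed fact
qed

section \<open>The program\<close>

abbreviation plus_expr :: "expr \<Rightarrow> expr \<Rightarrow> expr" (infixl "\<^bold>+" 65) where "e \<^bold>+ f \<equiv> Op Plus e f"
abbreviation minus_expr :: "expr \<Rightarrow> expr \<Rightarrow> expr" (infixl "\<^bold>-" 65) where "e \<^bold>- f \<equiv> Op Minus e f"
abbreviation times_expr :: "expr \<Rightarrow> expr \<Rightarrow> expr" (infixl "\<^bold>*" 70) where "e \<^bold>* f \<equiv> Op Times e f"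
abbreviation quotient_expr :: "expr \<Rightarrow> expr \<Rightarrow> expr" (infixl "\<^bold>div" 70) where "e \<^bold>div f \<equiv> Op Quotient e f"
abbreviation remainder_expr :: "expr \<Rightarrow> expr \<Rightarrow> expr" (infixl "\<^bold>mod" 70) where "e \<^bold>mod f \<equiv> Op Remainder e f"
abbreviation less_expr :: "expr \<Rightarrow> expr \<Rightarrow> expr" (infix "\<^bold><" 50) where "e \<^bold>< f \<equiv> Op Less e f"
abbreviation equal_expr :: "expr \<Rightarrow> expr \<Rightarrow> expr" (infix "\<^bold>=" 50) where "e \<^bold>= f \<equiv> Op Equal e f"
abbreviation seq_com :: "com \<Rightarrow> com \<Rightarrow> com" (infixr ";;" 60) where "c ;; d \<equiv> Seq c d"
abbreviation set_com :: "string \<Rightarrow> expr \<Rightarrow> com" (infix "::=" 62) where "x ::= e \<equiv> Put x (Const 0) e"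

text \<open>Truth values are numbers: a product is a conjunction and subtraction from 1 a negation.
  The search does not stop at a hit but overwrites it, so the last suitable edge wins.\<close>

definition test_edge :: com where
  "test_edge = Cond (Get ''tree'' (V ''p'') \<^bold>* (Get ''vis'' (V ''p'' \<^bold>mod V ''nodes'') \<^bold>*
         (Const 1 \<^bold>- Get ''vis'' (V ''p'' \<^bold>div V ''nodes''))))
       (''cx'' ::= V ''p'' \<^bold>div V ''nodes'' ;; ''cy'' ::= V ''p'' \<^bold>mod V ''nodes'')
       Skip"

definition find_edge :: com where
  "find_edge = For ''p'' (V ''nodes'' \<^bold>* V ''nodes'') test_edge"

definition order_nodes :: com where
  "order_nodes = Put ''vis'' (Const 0) (Const 1) ;; Put ''ord'' (Const 0) (Const 0) ;;
     Put ''par'' (Const 0) (V ''nodes'') ;;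
     For ''i'' (V ''nodes'' \<^bold>- Const 1)
       (find_edge ;; Put ''vis'' (V ''cx'') (Const 1) ;;
        Put ''ord'' (V ''i'' \<^bold>+ Const 1) (V ''cx'') ;; Put ''par'' (V ''cx'') (V ''cy''))"

lemma mods_test_edge [simp]: "mods test_edge = {''cx'', ''cy''}"
  by (auto simp: test_edge_def)

lemma mods_find_edge [simp]: "mods find_edge = {''p'', ''cx'', ''cy''}"
  by (auto simp: find_edge_def)

lemma mods_order_nodes [simp]: "mods order_nodes = {''vis'', ''ord'', ''par'', ''i'', ''p'', ''cx'', ''cy''}"
  by (auto simp: order_nodes_def)

text \<open>Every vertex or edge factor gets one owner among the bags that contain its ends, so that
  it is multiplied in exactly once. A pair inside no bag keeps the initial owner 0, which does no
  harm because its factor is 1.\<close>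

definition assign_home :: com where
  "assign_home = Cond (Get ''bags'' (V ''x'' \<^bold>* V ''n'' \<^bold>+ V ''p'' \<^bold>div V ''n'') \<^bold>*
       Get ''bags'' (V ''x'' \<^bold>* V ''n'' \<^bold>+ V ''p'' \<^bold>mod V ''n'')) (Put ''hm'' (V ''p'') (V ''x'')) Skip"

definition assign_homes :: com where
  "assign_homes = For ''x'' (V ''nodes'') (For ''p'' (V ''n'' \<^bold>* V ''n'') assign_home)"

lemma mods_assign_home [simp]: "mods assign_home = {''hm''}"
  by (auto simp: assign_home_def)

lemma mods_assign_homes [simp]: "mods assign_homes = {''x'', ''p'', ''hm''}"
  by (auto simp: assign_homes_def)

text \<open>The least \<open>k\<close> with \<open>3 * n * n < 2 ^ k\<close>: weights of this length
  on the \<open>n * n\<close> pair numbers fail to isolate with probability at most 1/3.\<close>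

definition weight_bits :: "nat \<Rightarrow> nat" where "weight_bits n = bits (3 * n * n)"

text \<open>Base of the positional system for exponents; the weights of all sets of edges are smaller.\<close>
definition radix :: "nat \<Rightarrow> nat" where "radix n = n * n * 2 ^ weight_bits n + 1"

text \<open>Bounds the binary length of all numbers in the memory during the computation.\<close>
definition word_length :: "nat \<Rightarrow> nat \<Rightarrow> nat" where
  "word_length n N = slot n * radix n ^ 4 + radix n ^ 4 + 3 * n + 2 * N + 4"

section \<open>Word length, search order of the tree and homes of the factors\<close>

locale matching_instance =
  fixes n N :: nat and G :: "nat ugraph" and l :: nat and T :: "nat ugraph" and B :: "nat \<Rightarrow> nat set"
  assumes G: "fin_ugraph G" "verts G = {..<n}" and l: "1 \<le> l"
    and td: "tree_decomposition G T B" and VT: "verts T = {..<N}"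
begin

abbreviation "D \<equiv> radix n"
abbreviation "L \<equiv> word_length n N"
abbreviation "E \<equiv> edges G"
abbreviation "F \<equiv> edges T"

text \<open>The parent of the root is the number \<open>N\<close>, whose bag is empty.\<close>
definition bag :: "nat \<Rightarrow> nat set" where "bag x = (if x < N then B x else {})"

definition input_ok :: "memory \<Rightarrow> bool" where
  "input_ok m \<longleftrightarrow> (\<forall>a\<in>{''n'', ''graph'', ''l'', ''nodes'', ''tree'', ''bags''}. m a = instance_memory G l T B a)"

lemma input_ok_frame:
  assumes "input_ok m" "\<And>a. a \<in> {''n'', ''graph'', ''l'', ''nodes'', ''tree'', ''bags''} \<Longrightarrow> m' a = m a"
  shows "input_ok m'"
  using assms by (simp add: input_ok_def)

lemma input_ok_update [simp]:
  assumes "a \<notin> {''n'', ''graph'', ''l'', ''nodes'', ''tree'', ''bags''}"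
  shows "input_ok (update m a i k) = input_ok m"
  using assms unfolding input_ok_def by (intro ball_cong refl) (auto simp: update_def)

lemma N_pos: "0 < N"
  using td VT by (auto simp: tree_decomposition_def utree_def uconnected_def)

lemma bag_subset: "bag x \<subseteq> {..<n}"
  using td VT G by (auto simp: tree_decomposition_def bag_def)

lemma input_values:
  assumes "input_ok m"
  shows "m ''n'' 0 = n" "m ''nodes'' 0 = N"
    "m ''graph'' p = of_bool ({p div n, p mod n} \<in> E)"
    "m ''tree'' p = of_bool ({p div N, p mod N} \<in> F)"
    "m ''l'' i = (if i < bits l then 1 + (l div 2 ^ i) mod 2 else 0)"
    "v < n \<Longrightarrow> m ''bags'' (x * n + v) = of_bool (v \<in> bag x)"
  using assms G VT by (auto simp: input_ok_def instance_memory_def Let_def bag_def)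

lemma tree_edge:
  assumes "e \<in> F"
  shows "e \<subseteq> {..<N}" "card e = 2"
  using assms td VT by (auto simp: tree_decomposition_def utree_def fin_ugraph_def)

lemma radix_pos: "0 < D" by (simp add: radix_def)

text \<open>The bounds match the summands of \<open>word_length\<close>:
  \<open>slot n * D ^ 4\<close> is for the modulus of the tables, \<open>D ^ 4\<close> for the
  counter of exponents, \<open>3 * n\<close> for \<open>6 ^ n \<le> 8 ^ n\<close>,
  \<open>2 * N\<close> for \<open>N * N\<close>, and the 4 leaves room for small constant
  factors.\<close>

lemma less_word:
  shows "x \<le> N * N \<Longrightarrow> x < 2 ^ L" "x \<le> N \<Longrightarrow> x < 2 ^ L" "x \<le> n \<Longrightarrow> x < 2 ^ L" "x \<le> n * n \<Longrightarrow> x < 2 ^ L"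
    "x \<le> 3 * n * n + 1 \<Longrightarrow> x < 2 ^ L" "x \<le> D ^ 4 \<Longrightarrow> x < 2 ^ L" "x \<le> slot n \<Longrightarrow> x < 2 ^ L"
    "x \<le> 6 ^ n \<Longrightarrow> x < 2 ^ L" "x \<le> 2 ^ slot n \<Longrightarrow> x < 2 ^ L" "x \<le> 2 ^ (slot n * D ^ 4) \<Longrightarrow> x < 2 ^ L"
    "x \<le> 1 \<Longrightarrow> x < 2 ^ L" "x \<le> 2 ^ (n + 1) \<Longrightarrow> x < 2 ^ L" "x \<le> D \<Longrightarrow> x < 2 ^ L"
proof -
  have mono: "x < 2 ^ L" if "x < 2 ^ k" "k \<le> L" for x k :: nat
    using that(1) power_increasing[OF that(2), of "2::nat"] by (rule less_le_trans) simp
  have D1: "1 \<le> D ^ 4" using radix_pos by simp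
  have slotD: "slot n \<le> slot n * D ^ 4" using D1 by simp
  have DD: "D \<le> D ^ 4" using radix_pos by (simp add: self_le_power)
  have sq: "k * k < 2 ^ (2 * k)" for k :: nat
    using mult_strict_mono[of k "2 ^ k" k "2 ^ k"] less_exp[of k] by (simp add: mult_2 power_add)
  have N2: "N * N < 2 ^ L" using sq by (rule mono) (simp add: word_length_def)
  have N1: "N < 2 ^ L" using less_exp by (rule mono) (simp add: word_length_def)
  have n1: "n < 2 ^ L" using less_exp by (rule mono) (simp add: word_length_def)
  have n2: "n * n < 2 ^ L" using sq by (rule mono) (simp add: word_length_def)
  have n3: "3 * n * n + 1 < 2 ^ L"
  proof (rule mono)
    have "3 * n * n + 1 < 4 * 2 ^ (2 * n)" using sq[of n] by simp
    then show "3 * n * n + 1 < 2 ^ (2 * n + 2)" by (simp add: power_add)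
  qed (simp add: word_length_def)
  have D4: "D ^ 4 < 2 ^ L" using less_exp by (rule mono) (simp add: word_length_def)
  have slL: "slot n + 1 \<le> L" unfolding word_length_def using slotD by linarith
  have sl: "slot n < 2 ^ L" using less_exp by (rule mono) (use slL in linarith)
  have p: "2 ^ k < (2::nat) ^ L" if "k < L" for k using that by simp
  have six: "6 ^ n < (2::nat) ^ L"
  proof -
    have "(6::nat) ^ n \<le> 8 ^ n" by (intro power_mono) auto
    also have "\<dots> = 2 ^ (3 * n)" by (simp add: power_mult)
    also have "\<dots> < 2 ^ L" by (rule p) (simp add: word_length_def)
    finally show ?thesis .
  qed
  have sl2: "2 ^ slot n < (2::nat) ^ L" by (rule p) (use slL in linarith)
  have md: "2 ^ (slot n * D ^ 4) < (2::nat) ^ L" by (rule p) (simp add: word_length_def)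
  have nn: "2 ^ (n + 1) < (2::nat) ^ L" by (rule p) (simp add: word_length_def)
  show "x \<le> N * N \<Longrightarrow> x < 2 ^ L" "x \<le> N \<Longrightarrow> x < 2 ^ L" "x \<le> n \<Longrightarrow> x < 2 ^ L" "x \<le> n * n \<Longrightarrow> x < 2 ^ L"
    "x \<le> 3 * n * n + 1 \<Longrightarrow> x < 2 ^ L" "x \<le> D ^ 4 \<Longrightarrow> x < 2 ^ L" "x \<le> slot n \<Longrightarrow> x < 2 ^ L"
    "x \<le> 6 ^ n \<Longrightarrow> x < 2 ^ L" "x \<le> 2 ^ slot n \<Longrightarrow> x < 2 ^ L" "x \<le> 2 ^ (slot n * D ^ 4) \<Longrightarrow> x < 2 ^ L"
    "x \<le> 2 ^ (n + 1) \<Longrightarrow> x < 2 ^ L"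
    using N2 N1 n1 n2 n3 D4 sl six sl2 md nn by linarith+
  show "x \<le> 1 \<Longrightarrow> x < 2 ^ L" using n3 by linarith
  show "x \<le> D \<Longrightarrow> x < 2 ^ L" using D4 DD by linarith
qed

lemma wp_find_edge:
  assumes b: "bounded_memory L m" and inp: "input_ok m"
    and vis: "\<And>x. x < N \<Longrightarrow> m ''vis'' x = of_bool (x \<in> S)"
    and ex: "x < N" "y < N" "x \<notin> S" "y \<in> S" "{x, y} \<in> F"
  shows "wp L (Suc (N * N) * 1) find_edge (\<lambda>m' w'. m' ''cx'' 0 < N \<and> m' ''cy'' 0 < N \<and>
    m' ''cx'' 0 \<notin> S \<and> m' ''cy'' 0 \<in> S \<and> {m' ''cx'' 0, m' ''cy'' 0} \<in> F) m w"
proof -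
  define good where "good p \<longleftrightarrow> {p div N, p mod N} \<in> F \<and> p mod N \<in> S \<and> p div N \<notin> S" for p
  define I where "I k m' (w' :: bool stream) \<longleftrightarrow>
      ((\<exists>p<k. good p) \<longrightarrow> (\<exists>p<k. good p \<and> m' ''cx'' 0 = p div N \<and> m' ''cy'' 0 = p mod N))" for k and m' :: memory and w'
  show ?thesis
    unfolding find_edge_def
  proof (rule wp_For[where I = I])
    show "val (V ''nodes'' \<^bold>* V ''nodes'') m = N * N" using inp by (simp add: input_values)
    show "wp L 1 test_edge (\<lambda>m'' w''. I (Suc k) (update m'' ''p'' 0 (Suc k)) w'') m' w'"
      if k: "k < N * N" and I: "I k m' w'" and b': "bounded_memory L m'" and i: "m' ''p'' 0 = k"
        and fr: "\<And>a. a \<notin> insert ''p'' (mods test_edge) \<Longrightarrow> m' a = m a" for k m' w'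
    proof -
      have inp': "input_ok m'" using inp by (rule input_ok_frame) (auto intro: fr)
      have vis': "m' ''vis'' x = of_bool (x \<in> S)" if "x < N" for x using vis[OF that] fr[of "''vis''"] by simp
      have kN: "k div N < N" "k mod N < N" using k N_pos by (simp_all add: less_mult_imp_div_less)
      show ?thesis
        unfolding test_edge_def using I b' kN
        by (intro wp_Cond wp_Seq wp_Put wp_Skip)
           (auto simp: I_def good_def input_values[OF inp'] vis' i less_Suc_eq intro!: less_word(2))
    qed
    show "m' ''cx'' 0 < N \<and> m' ''cy'' 0 < N \<and>
      m' ''cx'' 0 \<notin> S \<and> m' ''cy'' 0 \<in> S \<and> {m' ''cx'' 0, m' ''cy'' 0} \<in> F" if I: "I (N * N) m' w'" for m' w'
    proof -
      have "x * N + y < N * N" using pair_less ex by simp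
      moreover have "(x * N + y) div N = x" "(x * N + y) mod N = y" using ex by auto
      ultimately have "\<exists>p<N * N. good p" using ex unfolding good_def by metis
      with I obtain p where "p < N * N" "good p" "m' ''cx'' 0 = p div N" "m' ''cy'' 0 = p mod N"
        unfolding I_def by blast
      then show ?thesis using N_pos by (simp add: good_def less_mult_imp_div_less)
    qed
    show "N * N < 2 ^ L" by (rule less_word(1)) simp
  qed (use b in \<open>auto simp: I_def\<close>)
qed

text \<open>Some edge of a walk from inside \<open>S\<close> to the outside must leave
  \<open>S\<close>; this lets the search order always be extended.\<close>

lemma tree_boundary:
  assumes "S \<subseteq> {..<N}" "S \<noteq> {}" "S \<noteq> {..<N}"
  obtains x y where "x < N" "y < N" "x \<notin> S" "y \<in> S" "{x, y} \<in> F"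
proof -
  obtain a b where ab: "a \<in> S" "b \<in> {..<N}" "b \<notin> S" using assms by blast
  then have "(a, b) \<in> {(a, b). {a, b} \<in> F}\<^sup>*"
    using td VT assms(1) by (auto simp: tree_decomposition_def utree_def uconnected_def)
  then have "b \<notin> S \<longrightarrow> (\<exists>x y. {x, y} \<in> F \<and> x \<notin> S \<and> y \<in> S)"
  proof induction
    case base
    show ?case using ab by simp
  next
    case (step y z)
    then show ?case by (metis (no_types, lifting) case_prodD insert_commute mem_Collect_eq)
  qed
  then obtain x y where xy: "{x, y} \<in> F" "x \<notin> S" "y \<in> S" using ab by blast
  moreover have "x < N" "y < N" using tree_edge(1)[OF xy(1)] by auto
  ultimately show ?thesis using that by blast
qed

text \<open>The invariant of the search: after \<open>k\<close> rounds the \<open>k + 1\<close>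
  nodes from \<open>ord 0\<close> to \<open>ord k\<close> are visited. Node 0 serves as the
  root.\<close>

definition partial_order :: "nat \<Rightarrow> (nat \<Rightarrow> nat) \<Rightarrow> (nat \<Rightarrow> nat) \<Rightarrow> (nat \<Rightarrow> nat) \<Rightarrow> bool" where
  "partial_order k ord par vis \<longleftrightarrow> inj_on ord {..k} \<and> ord 0 = 0 \<and> par 0 = N \<and> ord ` {..k} \<subseteq> {..<N} \<and>
    (\<forall>x<N. vis x = of_bool (x \<in> ord ` {..k})) \<and>
    (\<forall>j. 0 < j \<and> j \<le> k \<longrightarrow> par (ord j) \<in> ord ` {..<j} \<and> {ord j, par (ord j)} \<in> F)"

lemma partial_order_step:
  assumes po: "partial_order k ord par vis"
    and xy: "x < N" "x \<notin> ord ` {..k}" "y \<in> ord ` {..k}" "{x, y} \<in> F"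
  shows "partial_order (Suc k) (ord(Suc k := x)) (par(x := y)) (vis(x := 1))"
proof -
  have im: "ord(Suc k := x) ` {..j} = (if j \<le> k then ord ` {..j} else insert x (ord ` {..k}))"
    if "j \<le> Suc k" for j
    using that by (auto simp: atMost_Suc le_Suc_eq image_def)
  have im': "ord(Suc k := x) ` {..<j} = ord ` {..<j}" if "j \<le> Suc k" for j
    using that by (intro image_cong) auto
  have ne: "ord j \<noteq> x" if "j \<le> k" for j using xy(2) that by auto
  have "x \<noteq> 0" using ne[of 0] po by (auto simp: partial_order_def)
  moreover have "inj_on (ord(Suc k := x)) {..Suc k}"
  proof -
    have "inj_on (ord(Suc k := x)) {..k}"
      using po by (subst inj_on_cong[of _ _ ord]) (auto simp: partial_order_def)
    moreover have "(ord(Suc k := x)) (Suc k) \<notin> ord(Suc k := x) ` {..k}" using im[of k] xy by simp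
    ultimately show ?thesis unfolding atMost_Suc by (simp add: inj_on_insert)
  qed
  moreover have "(par(x := y)) ((ord(Suc k := x)) j) \<in> ord(Suc k := x) ` {..<j} \<and>
      {(ord(Suc k := x)) j, (par(x := y)) ((ord(Suc k := x)) j)} \<in> F" if "0 < j" "j \<le> Suc k" for j
  proof (cases "j = Suc k")
    case True
    then show ?thesis using xy im'[of j] by (simp add: lessThan_Suc_atMost)
  next
    case False
    then have "j \<le> k" using that by simp
    then show ?thesis using po that ne[of j] im'[of j] by (simp add: partial_order_def)
  qed
  ultimately show ?thesis
    using po xy im[of "Suc k"] unfolding partial_order_def by auto
qed

lemma partial_order_complete:
  assumes "partial_order (N - 1) ord par vis"
  shows "rooted_order N F ord par"
proof -
  have eq: "{..N - 1} = {..<N}" using N_pos by auto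
  have "inj_on ord {..<N}" "ord ` {..<N} \<subseteq> {..<N}"
    using assms unfolding partial_order_def eq by blast+
  then have "ord ` {..<N} = {..<N}" by (intro endo_inj_surj) auto
  then show ?thesis using assms unfolding rooted_order_def partial_order_def eq by (auto simp: Suc_le_eq)
qed

lemma wp_order_nodes:
  assumes b: "bounded_memory L m" and inp: "input_ok m" and vis: "m ''vis'' = (\<lambda>_. 0)"
    and J: "Suc (N - 1) * (Suc (N * N) * 1) \<le> J"
  shows "wp L J order_nodes (\<lambda>m' w'. rooted_order N F (m' ''ord'') (m' ''par'')) m w"
proof -
  let ?J = "Suc (N - 1) * (Suc (N * N) * 1)"
  define I where "I k m' (w' :: bool stream) \<longleftrightarrow> partial_order k (m' ''ord'') (m' ''par'') (m' ''vis'')"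
    for k and m' :: memory and w'
  define body where "body = (find_edge ;; Put ''vis'' (V ''cx'') (Const 1) ;;
        Put ''ord'' (V ''i'' \<^bold>+ Const 1) (V ''cx'') ;; Put ''par'' (V ''cx'') (V ''cy''))"
  have mods_body: "mods body = {''p'', ''cx'', ''cy'', ''vis'', ''ord'', ''par''}" by (auto simp: body_def)
  have loop: "wp L ?J (For ''i'' (V ''nodes'' \<^bold>- Const 1) body)
     (\<lambda>m' w'. rooted_order N F (m' ''ord'') (m' ''par'')) m1 w"
    if b1: "bounded_memory L m1" and inp1: "input_ok m1" and init: "partial_order 0 (m1 ''ord'') (m1 ''par'') (m1 ''vis'')"
    for m1
  proof (rule wp_For[where I = I])
    show "val (V ''nodes'' \<^bold>- Const 1) m1 = N - 1" using inp1 by (simp add: input_values)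
    show "wp L (Suc (N * N) * 1) body (\<lambda>m'' w''. I (Suc k) (update m'' ''i'' 0 (Suc k)) w'') m' w'"
      if k: "k < N - 1" and I: "I k m' w'" and b': "bounded_memory L m'" and i: "m' ''i'' 0 = k"
        and fr: "\<And>a. a \<notin> insert ''i'' (mods body) \<Longrightarrow> m' a = m1 a" for k m' w'
    proof -
      have inp': "input_ok m'" using inp1 by (rule input_ok_frame) (auto intro!: fr simp: mods_body)
      let ?S = "m' ''ord'' ` {..k}"
      have po: "partial_order k (m' ''ord'') (m' ''par'') (m' ''vis'')" using I by (simp add: I_def)
      have "card ?S = Suc k" using po by (simp add: partial_order_def card_image)
      then have "?S \<noteq> {..<N}" using k by (metis card_lessThan less_diff_conv less_irrefl Suc_eq_plus1)
      moreover have "?S \<subseteq> {..<N}" "?S \<noteq> {}" using po by (auto simp: partial_order_def)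
      ultimately obtain x y where xy: "x < N" "y < N" "x \<notin> ?S" "y \<in> ?S" "{x, y} \<in> F"
        using tree_boundary by metis
      have vis': "\<And>x. x < N \<Longrightarrow> m' ''vis'' x = of_bool (x \<in> ?S)" using po by (simp add: partial_order_def)
      show ?thesis unfolding body_def
      proof (rule wp_Seq, rule wp_conseq[OF wp_find_edge[OF b' inp' vis' xy] order_refl])
        fix m2 w2
        assume found: "m2 ''cx'' 0 < N \<and> m2 ''cy'' 0 < N \<and> m2 ''cx'' 0 \<notin> ?S \<and> m2 ''cy'' 0 \<in> ?S \<and> {m2 ''cx'' 0, m2 ''cy'' 0} \<in> F"
          and b2: "bounded_memory L m2" and fr2: "\<And>a. a \<notin> mods find_edge \<Longrightarrow> m2 a = m' a"
        have eqs: "m2 ''ord'' = m' ''ord''" "m2 ''par'' = m' ''par''" "m2 ''vis'' = m' ''vis''" "m2 ''i'' = m' ''i''"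
          by (auto intro: fr2)
        have "partial_order (Suc k) ((m' ''ord'')(Suc k := m2 ''cx'' 0)) ((m' ''par'')(m2 ''cx'' 0 := m2 ''cy'' 0))
           ((m' ''vis'')(m2 ''cx'' 0 := 1))"
          using found by (intro partial_order_step po) auto
        then show "wp L (Suc (N * N) * 1) (Put ''vis'' (V ''cx'') (Const 1) ;;
        Put ''ord'' (V ''i'' \<^bold>+ Const 1) (V ''cx'') ;; Put ''par'' (V ''cx'') (V ''cy''))
          (\<lambda>m'' w''. I (Suc k) (update m'' ''i'' 0 (Suc k)) w'') m2 w2"
          using found b2 less_word(2)[of "m2 ''cx'' 0"] less_word(2)[of "m2 ''cy'' 0"] less_word(11)[of 1]
          by (intro wp_Seq wp_Put) (simp_all add: I_def eqs i)
      qed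
    qed
    show "N - 1 < 2 ^ L" by (rule less_word(2)) simp
    show "I 0 (update m1 ''i'' 0 0) w" using init by (simp add: I_def)
    show "rooted_order N F (m' ''ord'') (m' ''par'')" if "I (N - 1) m' w'" for m' w'
      using that unfolding I_def by (rule partial_order_complete)
  qed (use b1 in \<open>auto simp: mods_body\<close>)
  show ?thesis
  proof (rule wp_conseq[OF _ J])
    have init: "partial_order 0 ((m ''ord'')(0 := 0)) ((m ''par'')(0 := N)) ((m ''vis'')(0 := 1))"
      using N_pos by (auto simp: partial_order_def vis)
    show "wp L ?J order_nodes (\<lambda>m' w'. rooted_order N F (m' ''ord'') (m' ''par'')) m w"
      unfolding order_nodes_def body_def[symmetric]
      by (intro wp_Seq wp_Put loop)
        (use b init less_word(2)[of N] less_word(11)[of 0] less_word(11)[of 1] in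
          \<open>simp_all add: inp input_values[OF inp]\<close>)
  qed
qed

definition home_ok :: "(nat \<Rightarrow> nat) \<Rightarrow> bool" where
  "home_ok hm \<longleftrightarrow> (\<forall>p<n * n. hm p < N \<and> ((\<exists>x<N. ends n p \<subseteq> bag x) \<longrightarrow> ends n p \<subseteq> bag (hm p)))"

lemma wp_assign_homes:
  assumes b: "bounded_memory L m" and inp: "input_ok m" and hm: "m ''hm'' = (\<lambda>_. 0)"
    and J: "Suc N * (Suc (n * n) * 1) \<le> J"
  shows "wp L J assign_homes (\<lambda>m' w'. home_ok (m' ''hm'')) m w"
proof (rule wp_conseq[OF _ J])
  \<comment> \<open>Bags before \<open>x\<close> are finished, and bag \<open>x\<close> is finished
    for the pairs before \<open>k\<close>; hence \<open>I x (n * n)\<close> amounts to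
    \<open>I (Suc x) 0\<close>.\<close>
  define I where "I x k m' (w' :: bool stream) \<longleftrightarrow> (\<forall>p<n * n. m' ''hm'' p < N \<and>
     ((\<exists>x'<x. ends n p \<subseteq> bag x') \<or> p < k \<and> ends n p \<subseteq> bag x \<longrightarrow> ends n p \<subseteq> bag (m' ''hm'' p)))"
    for x k and m' :: memory and w'
  show "wp L (Suc N * (Suc (n * n) * 1)) assign_homes (\<lambda>m' w'. home_ok (m' ''hm'')) m w"
    unfolding assign_homes_def
  proof (rule wp_For[where I = "\<lambda>x. I x 0"])
    show "val (V ''nodes'') m = N" using inp by (simp add: input_values)
    show "N < 2 ^ L" by (rule less_word(2)) simp
    show "I 0 0 (update m ''x'' 0 0) w" using hm N_pos by (simp add: I_def)
    show "home_ok (m' ''hm'')" if "I N 0 m' w'" for m' w'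
      using that by (simp add: I_def home_ok_def)
    show "wp L (Suc (n * n) * 1) (For ''p'' (V ''n'' \<^bold>* V ''n'') assign_home)
        (\<lambda>m'' w''. I (Suc x) 0 (update m'' ''x'' 0 (Suc x)) w'') m1 w1"
      if x: "x < N" and I1: "I x 0 m1 w1" and b1: "bounded_memory L m1" and x1: "m1 ''x'' 0 = x"
        and fr1: "\<And>a. a \<notin> insert ''x'' (mods (For ''p'' (V ''n'' \<^bold>* V ''n'') assign_home)) \<Longrightarrow> m1 a = m a"
      for x m1 w1
    proof (rule wp_For[where I = "I x"])
      have inp1: "input_ok m1" using inp by (rule input_ok_frame) (auto intro: fr1)
      show "val (V ''n'' \<^bold>* V ''n'') m1 = n * n" using inp1 by (simp add: input_values)
      show "n * n < 2 ^ L" by (rule less_word(4)) simp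
      show "I x 0 (update m1 ''p'' 0 0) w1" using I1 by (simp add: I_def)
      show "I (Suc x) 0 (update m' ''x'' 0 (Suc x)) w'" if "I x (n * n) m' w'" for m' w'
        using that by (auto simp: I_def less_Suc_eq)
      show "wp L 1 assign_home (\<lambda>m'' w''. I x (Suc k) (update m'' ''p'' 0 (Suc k)) w'') m2 w2"
        if k: "k < n * n" and I2: "I x k m2 w2" and b2: "bounded_memory L m2" and k2: "m2 ''p'' 0 = k"
          and fr2: "\<And>a. a \<notin> insert ''p'' (mods assign_home) \<Longrightarrow> m2 a = m1 a" for k m2 w2
      proof -
        have inp2: "input_ok m2" using inp1 by (rule input_ok_frame) (auto intro: fr2)
        have x2: "m2 ''x'' 0 = x" using x1 fr2[of "''x''"] by simp
        have "n \<noteq> 0" using k by (cases n) auto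
        then have kn: "k div n < n" "k mod n < n" using k by (simp_all add: less_mult_imp_div_less)
        have xw: "x < 2 ^ L" using x by (intro less_word(2)) simp
        have I': "m2 ''hm'' p < N" "(\<exists>x'<x. ends n p \<subseteq> bag x') \<or> p < k \<and> ends n p \<subseteq> bag x \<Longrightarrow> ends n p \<subseteq> bag (m2 ''hm'' p)"
          if "p < n * n" for p using I2 that by (auto simp: I_def)
        show ?thesis unfolding assign_home_def
        proof (intro wp_Cond wp_Put wp_Skip b2)
          assume "val (Get ''bags'' (V ''x'' \<^bold>* V ''n'' \<^bold>+ V ''p'' \<^bold>div V ''n'') \<^bold>*
            Get ''bags'' (V ''x'' \<^bold>* V ''n'' \<^bold>+ V ''p'' \<^bold>mod V ''n'')) m2 \<noteq> 0"
          then have "ends n k \<subseteq> bag x" by (auto simp: input_values[OF inp2] x2 k2 kn ends_def)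
          then show "I x (Suc k) (update (update m2 ''hm'' (val (V ''p'') m2) (val (V ''x'') m2)) ''p'' 0 (Suc k)) w2"
            using I' x by (auto simp: I_def k2 x2 less_Suc_eq)
        next
          assume "val (Get ''bags'' (V ''x'' \<^bold>* V ''n'' \<^bold>+ V ''p'' \<^bold>div V ''n'') \<^bold>*
            Get ''bags'' (V ''x'' \<^bold>* V ''n'' \<^bold>+ V ''p'' \<^bold>mod V ''n'')) m2 = 0"
          then have "\<not> ends n k \<subseteq> bag x" by (auto simp: input_values[OF inp2] x2 k2 kn ends_def)
          then show "I x (Suc k) (update m2 ''p'' 0 (Suc k)) w2"
            using I' by (auto simp: I_def less_Suc_eq)
        qed (use xw x2 in auto)
      qed
    qed (use b1 in auto)
  qed (use b in auto)
qed

end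

section \<open>Constants, tables of powers, random weights and the bound \<open>l\<close>\<close>

definition setup_weight_range :: com where
  "setup_weight_range = ''k'' ::= Const 0 ;; ''pw'' ::= Const 1 ;;
     For ''j'' (Const 3 \<^bold>* V ''n'' \<^bold>* V ''n'')
       (Cond (V ''pw'' \<^bold>< Const 3 \<^bold>* V ''n'' \<^bold>* V ''n'' \<^bold>+ Const 1)
         (''pw'' ::= V ''pw'' \<^bold>* Const 2 ;; ''k'' ::= V ''k'' \<^bold>+ Const 1) Skip)"

definition setup_scalars :: com where
  "setup_scalars = ''D'' ::= V ''n'' \<^bold>* V ''n'' \<^bold>* V ''pw'' \<^bold>+ Const 1 ;;
     ''Q'' ::= V ''D'' \<^bold>* V ''D'' \<^bold>* V ''D'' \<^bold>* V ''D'' ;;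
     ''K'' ::= Const 2 \<^bold>* V ''n'' \<^bold>* V ''n'' \<^bold>+ Const 3 \<^bold>* V ''n'' \<^bold>+ Const 1 ;;
     Put ''p2'' (Const 0) (Const 1) ;; Put ''zp'' (Const 0) (Const 1)"

definition double_power :: com where
  "double_power = Put ''p2'' (V ''j'' \<^bold>+ Const 1) (Get ''p2'' (V ''j'') \<^bold>* Const 2)"

text \<open>All powers of the base of the Kronecker substitution are tabulated up to exponent
  \<open>D ^ 4\<close>, so monomials, the modulus and the shift to a digit are single
  look-ups.\<close>

definition next_zpower :: com where
  "next_zpower = Put ''zp'' (V ''j'' \<^bold>+ Const 1) (Get ''zp'' (V ''j'') \<^bold>* Get ''p2'' (V ''K''))"

definition setup_tables :: com where
  "setup_tables = setup_scalars ;; For ''j'' (V ''K'') double_power ;; For ''j'' (V ''Q'') next_zpower"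

definition draw_weights :: com where
  "draw_weights = For ''p'' (V ''n'' \<^bold>* V ''n'') (Put ''wt'' (V ''p'') (Const 0) ;;
     For ''j'' (V ''k'') (Flip ''coin'' (Const 0) ;;
       Put ''wt'' (V ''p'') (Get ''wt'' (V ''p'') \<^bold>* Const 2 \<^bold>+ V ''coin'')))"

text \<open>Only the positions 0 to \<open>n\<close> of \<open>l\<close> are read, from the most
  significant down, so the time does not depend on the length of \<open>l\<close>. Whether
  \<open>l\<close> is longer is tested later at position \<open>n + 1\<close>; in that case
  \<open>l > n\<close> and there is no solution.\<close>

definition read_bound :: com where
  "read_bound = ''lv'' ::= Const 0 ;;
     For ''j'' (V ''n'' \<^bold>+ Const 1) (''u'' ::= V ''n'' \<^bold>- V ''j'' ;;
       Cond (Get ''l'' (V ''u'')) (''lv'' ::= V ''lv'' \<^bold>* Const 2 \<^bold>+ (Get ''l'' (V ''u'') \<^bold>- Const 1)) Skip)"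

lemma mods_setup_tables [simp]:
  "mods setup_scalars = {''D'', ''Q'', ''K'', ''p2'', ''zp''}"
  "mods double_power = {''p2''}" "mods next_zpower = {''zp''}"
  by (auto simp: setup_scalars_def double_power_def next_zpower_def)

lemma mods_setup [simp]:
  "mods setup_weight_range = {''k'', ''pw'', ''j''}"
  "mods setup_tables = {''D'', ''Q'', ''K'', ''p2'', ''zp'', ''j''}"
  "mods draw_weights = {''p'', ''wt'', ''j'', ''coin''}"
  "mods read_bound = {''lv'', ''j'', ''u''}"
  by (auto simp: setup_weight_range_def setup_tables_def draw_weights_def read_bound_def)

lemma flip_free_setup [simp]:
  "flip_free setup_weight_range" "flip_free setup_tables"
  by (simp_all add: setup_scalars_def double_power_def next_zpower_def setup_weight_range_def setup_tables_def)

lemma two_power_le_iff_less_bits: "2 ^ k \<le> x \<longleftrightarrow> k < bits x"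
proof
  assume "2 ^ k \<le> x"
  also have "x < 2 ^ bits x" by (rule less_two_power_bits)
  finally show "k < bits x" by simp
next
  assume k: "k < bits x"
  then have "x \<noteq> 0" by (cases "x = 0") (auto simp: floorlog_def)
  then have "2 ^ (bits x - 1) \<le> x" using floorlog_bounds[of x 2] by simp
  moreover have "(2::nat) ^ k \<le> 2 ^ (bits x - 1)" using k by (intro power_increasing) auto
  ultimately show "2 ^ k \<le> x" by linarith
qed

lemma bits_le_self: "bits x \<le> x"
  by (rule bits_le) (rule less_exp)

context matching_instance
begin

definition range_ok :: "memory \<Rightarrow> bool" where
  "range_ok m \<longleftrightarrow> m ''k'' 0 = weight_bits n \<and> m ''pw'' 0 = 2 ^ weight_bits n"

text \<open>By minimality of \<open>weight_bits n\<close>, half the range of the weights is at most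
  \<open>3 * n * n\<close>; so the range, and with it \<open>D\<close>, is polynomial.\<close>

lemma power_weight_bits_le: "k \<le> weight_bits n \<Longrightarrow> 2 ^ k \<le> 6 * n * n + 1"
proof -
  assume k: "k \<le> weight_bits n"
  show "2 ^ k \<le> 6 * n * n + 1"
  proof (cases k)
    case (Suc k')
    then have "2 ^ k' \<le> 3 * n * n" using k by (simp add: two_power_le_iff_less_bits weight_bits_def)
    then show ?thesis using Suc by simp
  qed simp
qed

lemma word_six: "6 * n * n + 1 < 2 ^ L"
proof -
  have "6 * n * n + 1 < 2 * 2 ^ (2 * n + 2)"
  proof -
    have "n * n < 2 ^ n * 2 ^ n" using less_exp[of n] by (intro mult_strict_mono) auto
    then show ?thesis by (simp add: power_add mult_2)
  qed
  also have "\<dots> = 2 ^ (2 * n + 3)" by (simp add: power_add)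
  also have "\<dots> \<le> 2 ^ L" by (intro power_increasing) (simp_all add: word_length_def)
  finally show ?thesis .
qed

text \<open>A power of two is doubled until it exceeds \<open>x = 3 * n * n\<close>. The loop makes
  \<open>x\<close> passes, of which those after the first \<open>bits x\<close> do nothing; this
  suffices because \<open>bits x \<le> x\<close>.\<close>

lemma wp_setup_weight_range:
  assumes b: "bounded_memory L m" and inp: "input_ok m" and J: "Suc (3 * n * n) * 1 \<le> J"
  shows "wp L J setup_weight_range (\<lambda>m' w'. range_ok m') m w"
proof (rule wp_conseq[OF _ J])
  define x where "x = 3 * n * n"
  define I where "I j m' (w' :: bool stream) \<longleftrightarrow> m' ''k'' 0 = min j (bits x) \<and> m' ''pw'' 0 = 2 ^ min j (bits x)"
    for j and m' :: memory and w'
  define body where "body = Cond (V ''pw'' \<^bold>< Const 3 \<^bold>* V ''n'' \<^bold>* V ''n'' \<^bold>+ Const 1)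
         (''pw'' ::= V ''pw'' \<^bold>* Const 2 ;; ''k'' ::= V ''k'' \<^bold>+ Const 1) Skip"
  have mods_body: "mods body = {''pw'', ''k''}" by (auto simp: body_def)
  have loop: "wp L (Suc x * 1) (For ''j'' (Const 3 \<^bold>* V ''n'' \<^bold>* V ''n'') body) (\<lambda>m' w'. range_ok m') m1 w"
    if b1: "bounded_memory L m1" and inp1: "input_ok m1" and init: "m1 ''k'' 0 = 0" "m1 ''pw'' 0 = 1" for m1
  proof (rule wp_For[where I = I])
    show "val (Const 3 \<^bold>* V ''n'' \<^bold>* V ''n'') m1 = x" using inp1 by (simp add: input_values x_def)
    show "x < 2 ^ L" by (rule less_word(5)) (simp add: x_def)
    show "I 0 (update m1 ''j'' 0 0) w" using init by (simp add: I_def)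
    show "range_ok m'" if "I x m' w'" for m' w'
      using that bits_le_self[of x] unfolding I_def range_ok_def weight_bits_def x_def[symmetric] by (simp add: min_def)
    show "wp L 1 body (\<lambda>m'' w''. I (Suc j) (update m'' ''j'' 0 (Suc j)) w'') m' w'"
      if j: "j < x" and I: "I j m' w'" and b': "bounded_memory L m'"
        and fr: "\<And>a. a \<notin> insert ''j'' (mods body) \<Longrightarrow> m' a = m1 a" for j m' w'
    proof -
      have inp': "input_ok m'" using inp1 by (rule input_ok_frame) (auto intro!: fr simp: mods_body)
      have iff: "2 ^ min j (bits x) < x + 1 \<longleftrightarrow> j < bits x"
        using two_power_le_iff_less_bits[of "min j (bits x)" x] by (auto simp: less_Suc_eq_le)
      have I': "m' ''k'' 0 = min j (bits x)" "m' ''pw'' 0 = 2 ^ min j (bits x)" using I by (simp_all add: I_def)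
      have test: "val (V ''pw'' \<^bold>< Const 3 \<^bold>* V ''n'' \<^bold>* V ''n'' \<^bold>+ Const 1) m' = of_bool (j < bits x)"
        using iff by (simp add: input_values[OF inp'] I' x_def)
      have pw: "2 ^ min j (bits x) * 2 < (2::nat) ^ L" if "j < bits x"
      proof -
        have "2 ^ Suc j \<le> 6 * n * n + 1"
          using that by (intro power_weight_bits_le) (simp add: weight_bits_def x_def)
        with word_six that show ?thesis by (simp add: min_def)
      qed
      have k: "Suc (min j (bits x)) < 2 ^ L"
        using j by (intro less_word(5)) (simp add: x_def)
      show ?thesis unfolding body_def
        by (intro wp_Cond wp_Seq wp_Put wp_Skip)
          (use b' pw k in \<open>simp_all only: test, auto simp: I_def I' min_def split: if_splits\<close>)
    qed
  qed (use b1 in \<open>auto simp: mods_body\<close>)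
  show "wp L (Suc (3 * n * n) * 1) setup_weight_range (\<lambda>m' w'. range_ok m') m w"
    unfolding setup_weight_range_def body_def[symmetric] x_def[symmetric]
    by (intro wp_Seq wp_Put loop) (use b inp less_word(11)[of 0] less_word(11)[of 1] in simp_all)
qed

definition tables_ok :: "memory \<Rightarrow> bool" where
  "tables_ok m \<longleftrightarrow> m ''D'' 0 = D \<and> m ''Q'' 0 = D ^ 4 \<and> m ''K'' 0 = slot n \<and>
    (\<forall>j\<le>slot n. m ''p2'' j = 2 ^ j) \<and> (\<forall>j\<le>D ^ 4. m ''zp'' j = (2 ^ slot n) ^ j)"

lemma wp_setup_scalars:
  assumes b: "bounded_memory L m" and inp: "input_ok m" and range: "range_ok m" and J: "0 < J"
  shows "wp L J setup_scalars (\<lambda>m' w'. m' ''D'' 0 = D \<and> m' ''Q'' 0 = D ^ 4 \<and> m' ''K'' 0 = slot n \<and>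
    m' ''p2'' 0 = 1 \<and> m' ''zp'' 0 = 1) m w"
proof -
  have Dval: "Suc (n * n * 2 ^ weight_bits n) = D" by (simp add: radix_def)
  have Kval: "Suc (2 * n * n + 3 * n) = slot n" by (simp add: slot_def)
  have D4: "D * D * D * D = D ^ 4" by (simp add: power4_eq_xxxx)
  have range': "m ''k'' 0 = weight_bits n" "m ''pw'' 0 = 2 ^ weight_bits n" using range by (simp_all add: range_ok_def)
  show ?thesis unfolding setup_scalars_def
    by (intro wp_Seq wp_Put b J)
      (simp_all add: input_values[OF inp] range' Dval Kval D4 less_word(13)[of D] less_word(6)[of "D ^ 4"]
        less_word(7)[of "slot n"] less_word(11)[of "Suc 0"])
qed

lemma wp_double_powers:
  assumes b: "bounded_memory L m" and init: "m ''K'' 0 = slot n" "m ''p2'' 0 = 1" and J: "Suc (slot n) * 1 \<le> J"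
  shows "wp L J (For ''j'' (V ''K'') double_power) (\<lambda>m' w'. \<forall>i\<le>slot n. m' ''p2'' i = 2 ^ i) m w"
proof (rule wp_conseq[OF _ J])
  define I where "I j m' (w' :: bool stream) \<longleftrightarrow> (\<forall>i\<le>j. m' ''p2'' i = 2 ^ i)"
    for j and m' :: memory and w'
  show "wp L (Suc (slot n) * 1) (For ''j'' (V ''K'') double_power) (\<lambda>m' w'. \<forall>i\<le>slot n. m' ''p2'' i = 2 ^ i) m w"
  proof (rule wp_For[where I = I])
    show "slot n < 2 ^ L" by (rule less_word(7)) simp
    show "wp L 1 double_power (\<lambda>m'' w''. I (Suc j) (update m'' ''j'' 0 (Suc j)) w'') m' w'"
      if j: "j < slot n" and I: "I j m' w'" and b': "bounded_memory L m'" and j': "m' ''j'' 0 = j" for j m' w'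
      unfolding double_power_def
    proof (rule wp_Put)
      have "(2::nat) ^ Suc j \<le> 2 ^ slot n" using j by (intro power_increasing) auto
      then have "(2::nat) ^ Suc j < 2 ^ L" by (rule less_word(9))
      then show "val (Get ''p2'' (V ''j'') \<^bold>* Const 2) m' < 2 ^ L"
        using I j' by (simp add: I_def mult.commute)
      show "I (Suc j) (update (update m' ''p2'' (val (V ''j'' \<^bold>+ Const 1) m') (val (Get ''p2'' (V ''j'') \<^bold>* Const 2) m')) ''j'' 0 (Suc j)) w'"
        using I j' by (auto simp: I_def le_Suc_eq)
    qed (use b' in auto)
  qed (use b init in \<open>auto simp: I_def\<close>)
qed

lemma wp_zpowers:
  assumes b: "bounded_memory L m" and init: "m ''D'' 0 = D" "m ''Q'' 0 = D ^ 4" "m ''K'' 0 = slot n" "m ''zp'' 0 = 1"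
      and p2: "\<forall>i\<le>slot n. m ''p2'' i = 2 ^ i" and J: "Suc (D ^ 4) * 1 \<le> J"
  shows "wp L J (For ''j'' (V ''Q'') next_zpower) (\<lambda>m' w'. tables_ok m') m w"
proof (rule wp_conseq[OF _ J])
  define I where "I j m' (w' :: bool stream) \<longleftrightarrow> (\<forall>i\<le>j. m' ''zp'' i = (2 ^ slot n) ^ i)"
    for j and m' :: memory and w'
  show "wp L (Suc (D ^ 4) * 1) (For ''j'' (V ''Q'') next_zpower) (\<lambda>m' w'. tables_ok m') m w"
  proof (rule wp_For[where I = I])
    show "D ^ 4 < 2 ^ L" by (rule less_word(6)) simp
    show "wp L 1 next_zpower (\<lambda>m'' w''. I (Suc j) (update m'' ''j'' 0 (Suc j)) w'') m' w'"
      if j: "j < D ^ 4" and I: "I j m' w'" and b': "bounded_memory L m'" and j': "m' ''j'' 0 = j"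
        and fr: "\<And>a. a \<notin> insert ''j'' (mods next_zpower) \<Longrightarrow> m' a = m a" for j m' w'
      unfolding next_zpower_def
    proof (rule wp_Put)
      have v: "val (Get ''zp'' (V ''j'') \<^bold>* Get ''p2'' (V ''K'')) m' = (2 ^ slot n) ^ Suc j"
        using I j' p2 fr[of "''p2''"] fr[of "''K''"] init by (simp add: I_def)
      have "((2::nat) ^ slot n) ^ Suc j \<le> 2 ^ (slot n * D ^ 4)"
        unfolding power_mult[symmetric] using j by (intro power_increasing mult_le_mono2) auto
      then show "val (Get ''zp'' (V ''j'') \<^bold>* Get ''p2'' (V ''K'')) m' < 2 ^ L"
        unfolding v by (rule less_word(10))
      show "I (Suc j) (update (update m' ''zp'' (val (V ''j'' \<^bold>+ Const 1) m') (val (Get ''zp'' (V ''j'') \<^bold>* Get ''p2'' (V ''K'')) m')) ''j'' 0 (Suc j)) w'"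
        unfolding v using I j' by (auto simp: I_def le_Suc_eq)
    qed (use b' in auto)
    show "tables_ok m'" if "I (D ^ 4) m' w'"
        and fr: "\<And>a. a \<notin> insert ''j'' (mods next_zpower) \<Longrightarrow> m' a = m a" for m' w'
      using that(1) p2 init fr[of "''p2''"] fr[of "''K''"] fr[of "''D''"] fr[of "''Q''"]
      by (simp add: tables_ok_def I_def)
  qed (use b init in \<open>auto simp: I_def\<close>)
qed

lemma wp_setup_tables:
  assumes b: "bounded_memory L m" and inp: "input_ok m" and range: "range_ok m"
    and J: "Suc (slot n) * 1 \<le> J" "Suc (D ^ 4) * 1 \<le> J"
  shows "wp L J setup_tables (\<lambda>m' w'. tables_ok m') m w"
proof -
  have J0: "0 < J" using J by simp
  show ?thesis
    unfolding setup_tables_def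
  proof (rule wp_Seq, rule wp_conseq[OF wp_setup_scalars[OF b inp range J0] order_refl], rule wp_Seq)
    fix m1 w1
    assume m1: "m1 ''D'' 0 = D \<and> m1 ''Q'' 0 = D ^ 4 \<and> m1 ''K'' 0 = slot n \<and> m1 ''p2'' 0 = 1 \<and> m1 ''zp'' 0 = 1"
      and b1: "bounded_memory L m1"
    show "wp L J (For ''j'' (V ''K'') double_power) (\<lambda>m' w'. wp L J (For ''j'' (V ''Q'') next_zpower) (\<lambda>m' w'. tables_ok m') m' w') m1 w1"
    proof (rule wp_conseq[OF wp_double_powers[OF b1 _ _ J(1)] order_refl])
      fix m2 w2
      assume p2: "\<forall>i\<le>slot n. m2 ''p2'' i = 2 ^ i" and b2: "bounded_memory L m2"
        and fr: "\<And>a. a \<notin> mods (For ''j'' (V ''K'') double_power) \<Longrightarrow> m2 a = m1 a"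
      show "wp L J (For ''j'' (V ''Q'') next_zpower) (\<lambda>m' w'. tables_ok m') m2 w2"
        using m1 fr[of "''D''"] fr[of "''Q''"] fr[of "''K''"] fr[of "''zp''"]
        by (intro wp_zpowers b2 p2 J(2)) simp_all
    qed (use m1 in auto)
  qed
qed

text \<open>Tosses are consumed in the order of the pairs, \<open>weight_bits n\<close> at a time,
  and nowhere else in the program. Acceptance therefore depends only on a prefix of fixed length,
  which also makes it measurable.\<close>

definition weights :: "bool stream \<Rightarrow> nat \<Rightarrow> nat" where
  "weights w = block (weight_bits n) (stake (n * n * weight_bits n) w)"

lemma weights_eq: "p < n * n \<Longrightarrow> weights w p = binary (stake (weight_bits n) (sdrop (p * weight_bits n) w))"
proof -
  assume "p < n * n"
  then have "p * weight_bits n + weight_bits n \<le> n * n * weight_bits n"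
    by (metis Suc_leI add.commute mult_Suc mult_le_mono1)
  then show ?thesis
    unfolding weights_def block_def by (simp add: drop_stake take_stake min_def)
qed

lemma sum_weights_less: "M \<subseteq> pairs n E \<Longrightarrow> sum (weights w) M < D"
proof -
  assume M: "M \<subseteq> pairs n E"
  have "sum (weights w) M \<le> sum (\<lambda>_. 2 ^ weight_bits n) M"
  proof (rule sum_mono)
    fix p assume "p \<in> M"
    then have "p < n * n" using M pairs_subset by blast
    then show "weights w p \<le> 2 ^ weight_bits n"
      using binary_less[of "stake (weight_bits n) (sdrop (p * weight_bits n) w)"] by (simp add: weights_eq)
  qed
  also have "\<dots> = card M * 2 ^ weight_bits n" by simp
  also have "card M \<le> card {..<n * n}" using M pairs_subset by (intro card_mono) auto
  then have "card M * 2 ^ weight_bits n \<le> n * n * 2 ^ weight_bits n" by simp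
  finally show ?thesis by (simp add: radix_def)
qed

lemma wp_draw_weights:
  assumes b: "bounded_memory L m" and inp: "input_ok m" and range: "range_ok m"
    and J: "Suc (n * n) * (Suc (weight_bits n) * 1) \<le> J"
  shows "wp L J draw_weights (\<lambda>m' w'. \<forall>p<n * n. m' ''wt'' p = weights w p) m w"
proof (rule wp_conseq[OF _ J])
  define kb where "kb = weight_bits n"
  define body where "body = Flip ''coin'' (Const 0) ;;
       Put ''wt'' (V ''p'') (Get ''wt'' (V ''p'') \<^bold>* Const 2 \<^bold>+ V ''coin'')"
  define wt where "wt p = binary (stake kb (sdrop (p * kb) w))" for p
  define I where "I p m' w' \<longleftrightarrow> (\<forall>q<p. m' ''wt'' q = wt q) \<and> w' = sdrop (p * kb) w"
    for p and m' :: memory and w'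
  define I' where "I' p j m' w' \<longleftrightarrow> (\<forall>q<p. m' ''wt'' q = wt q) \<and>
      m' ''wt'' p = binary (stake j (sdrop (p * kb) w)) \<and> w' = sdrop (p * kb + j) w"
    for p j and m' :: memory and w'
  have mods_body: "mods body = {''coin'', ''wt''}" by (auto simp: body_def)
  have kbL: "kb < 2 ^ L"
  proof (rule less_word(5))
    show "kb \<le> 3 * n * n + 1" using bits_le_self[of "3 * n * n"] by (simp add: kb_def weight_bits_def)
  qed
  have inner: "wp L 1 body (\<lambda>m'' w''. I' p (Suc j) (update m'' ''j'' 0 (Suc j)) w'') m' w'"
    if j: "j < kb" and I: "I' p j m' w'" and b': "bounded_memory L m'" and p': "m' ''p'' 0 = p" for p j m' w'
    unfolding body_def
  proof (intro wp_Seq wp_Flip wp_Put b')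
    have w': "w' = sdrop (p * kb + j) w" using I by (simp add: I'_def)
    have st: "binary (stake (Suc j) (sdrop (p * kb) w)) = binary (stake j (sdrop (p * kb) w)) * 2 + of_bool (shd w')"
      unfolding stake_Suc binary_snoc w' by (simp add: sdrop_snth mult.commute)
    have v: "val (Get ''wt'' (V ''p'') \<^bold>* Const 2 \<^bold>+ V ''coin'') (update m' ''coin'' (val (Const 0) m') (of_bool (shd w'))) =
       binary (stake (Suc j) (sdrop (p * kb) w))"
      unfolding st using I p' by (simp add: I'_def)
    have "binary (stake (Suc j) (sdrop (p * kb) w)) < 2 ^ Suc j"
      using binary_less[of "stake (Suc j) (sdrop (p * kb) w)"] by simp
    also have "(2::nat) ^ Suc j \<le> 6 * n * n + 1" using j by (intro power_weight_bits_le) (simp add: kb_def)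
    also note word_six
    finally show "val (Get ''wt'' (V ''p'') \<^bold>* Const 2 \<^bold>+ V ''coin'') (update m' ''coin'' (val (Const 0) m') (of_bool (shd w'))) < 2 ^ L"
      unfolding v .
    show "I' p (Suc j) (update (update (update m' ''coin'' (val (Const 0) m') (of_bool (shd w'))) ''wt''
       (val (V ''p'') (update m' ''coin'' (val (Const 0) m') (of_bool (shd w'))))
       (val (Get ''wt'' (V ''p'') \<^bold>* Const 2 \<^bold>+ V ''coin'') (update m' ''coin'' (val (Const 0) m') (of_bool (shd w')))))
       ''j'' 0 (Suc j)) (stl w')"
      unfolding v using I p' by (simp add: I'_def del: stake.simps)
  qed auto
  show "wp L (Suc (n * n) * (Suc (weight_bits n) * 1)) draw_weights (\<lambda>m' w'. \<forall>p<n * n. m' ''wt'' p = weights w p) m w"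
    unfolding draw_weights_def body_def[symmetric]
  proof (rule wp_For[where I = I])
    show "val (V ''n'' \<^bold>* V ''n'') m = n * n" using inp by (simp add: input_values)
    show "n * n < 2 ^ L" by (rule less_word(4)) simp
    show "\<forall>p<n * n. m' ''wt'' p = weights w p" if "I (n * n) m' w'" for m' w'
      using that by (simp add: I_def weights_eq wt_def kb_def)
    show "wp L (Suc (weight_bits n) * 1) (Put ''wt'' (V ''p'') (Const 0) ;; For ''j'' (V ''k'') body)
        (\<lambda>m'' w''. I (Suc p) (update m'' ''p'' 0 (Suc p)) w'') m1 w1"
      if p: "p < n * n" and I1: "I p m1 w1" and b1: "bounded_memory L m1" and p1: "m1 ''p'' 0 = p"
        and fr1: "\<And>a. a \<notin> insert ''p'' (mods (Put ''wt'' (V ''p'') (Const 0) ;; For ''j'' (V ''k'') body)) \<Longrightarrow> m1 a = m a"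
      for p m1 w1
    proof (intro wp_Seq wp_Put b1)
      define m2 where "m2 = update m1 ''wt'' p 0"
      have m2: "update m1 ''wt'' (val (V ''p'') m1) (val (Const 0) m1) = m2" by (simp add: m2_def p1)
      assume "bounded_memory L (update m1 ''wt'' (val (V ''p'') m1) (val (Const 0) m1))"
      then have b2: "bounded_memory L m2" unfolding m2 .
      have k2: "m2 ''k'' 0 = kb" using fr1[of "''k''"] range by (simp add: m2_def mods_body range_ok_def kb_def)
      show "wp L (Suc (weight_bits n) * 1) (For ''j'' (V ''k'') body) (\<lambda>m'' w''. I (Suc p) (update m'' ''p'' 0 (Suc p)) w'')
          (update m1 ''wt'' (val (V ''p'') m1) (val (Const 0) m1)) w1"
        unfolding m2 kb_def[symmetric]
      proof (rule wp_For[where I = "I' p"])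
        show "I' p 0 (update m2 ''j'' 0 0) w1" using I1 by (simp add: I_def I'_def m2_def)
        show "wp L 1 body (\<lambda>m'' w''. I' p (Suc j) (update m'' ''j'' 0 (Suc j)) w'') m' w'"
          if "j < kb" "I' p j m' w'" "bounded_memory L m'"
            and fr: "\<And>a. a \<notin> insert ''j'' (mods body) \<Longrightarrow> m' a = m2 a" for j m' w'
          using fr[of "''p''"] by (intro inner that(1-3)) (simp add: mods_body m2_def p1)
        show "I (Suc p) (update m' ''p'' 0 (Suc p)) w'" if "I' p kb m' w'" for m' w'
          using that by (auto simp: I_def I'_def wt_def less_Suc_eq add.commute)
      qed (use b2 k2 kbL in \<open>auto simp: mods_body\<close>)
    qed (use less_word(11)[of 0] in auto)
  qed (use b in \<open>auto simp: I_def mods_body\<close>)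
qed

lemma wp_read_bound:
  assumes b: "bounded_memory L m" and inp: "input_ok m" and J: "Suc (n + 1) * 1 \<le> J"
  shows "wp L J read_bound (\<lambda>m' w'. bits l \<le> n + 1 \<longrightarrow> m' ''lv'' 0 = l) m w"
proof (rule wp_conseq[OF _ J])
  define body where "body = ''u'' ::= V ''n'' \<^bold>- V ''j'' ;;
       Cond (Get ''l'' (V ''u'')) (''lv'' ::= V ''lv'' \<^bold>* Const 2 \<^bold>+ (Get ''l'' (V ''u'') \<^bold>- Const 1)) Skip"
  \<comment> \<open>After \<open>j\<close> passes the top \<open>j\<close> of the
    \<open>n + 1\<close> digits are assembled. The bound \<open>2 ^ j\<close> is kept for an
    overlong \<open>l\<close> as well, so that the memory stays bounded in any case.\<close>
  define I where "I j m' (w' :: bool stream) \<longleftrightarrow> m' ''lv'' 0 < 2 ^ j \<and> (bits l \<le> n + 1 \<longrightarrow> m' ''lv'' 0 = l div 2 ^ (n + 1 - j))"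
    for j and m' :: memory and w'
  have mods_body: "mods body = {''u'', ''lv''}" by (auto simp: body_def)
  have loop: "wp L (Suc (n + 1) * 1) (For ''j'' (V ''n'' \<^bold>+ Const 1) body) (\<lambda>m' w'. bits l \<le> n + 1 \<longrightarrow> m' ''lv'' 0 = l) m1 w"
    if b1: "bounded_memory L m1" and inp1: "input_ok m1" and init: "m1 ''lv'' 0 = 0" for m1
  proof (rule wp_For[where I = I])
    show "val (V ''n'' \<^bold>+ Const 1) m1 = n + 1" using inp1 by (simp add: input_values)
    show "n + 1 < 2 ^ L" by (rule less_word(12)) (simp add: Suc_leI less_exp flip: power_Suc)
    show "I 0 (update m1 ''j'' 0 0) w"
      using init less_two_power_bits[of l] power_increasing[of "bits l" "n + 1" "2::nat"] by (auto simp: I_def)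
    show "bits l \<le> n + 1 \<longrightarrow> m' ''lv'' 0 = l" if "I (n + 1) m' w'" for m' w' using that by (simp add: I_def)
    show "wp L 1 body (\<lambda>m'' w''. I (Suc j) (update m'' ''j'' 0 (Suc j)) w'') m' w'"
      if j: "j < n + 1" and I: "I j m' w'" and b': "bounded_memory L m'" and j': "m' ''j'' 0 = j"
        and fr: "\<And>a. a \<notin> insert ''j'' (mods body) \<Longrightarrow> m' a = m1 a" for j m' w'
    proof -
      have inp': "input_ok m'" using inp1 by (rule input_ok_frame) (auto intro!: fr simp: mods_body)
      have lv: "m' ''lv'' 0 < 2 ^ j" "bits l \<le> n + 1 \<Longrightarrow> m' ''lv'' 0 = l div 2 ^ (n + 1 - j)" using I by (simp_all add: I_def)
      have eq: "n + 1 - j = Suc (n - j)" using j by simp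
      have digit: "l div 2 ^ (n - j) = l div 2 ^ (n + 1 - j) * 2 + l div 2 ^ (n - j) mod 2"
        unfolding eq power_Suc2 div_mult2_eq by simp
      have "(2::nat) ^ Suc j \<le> 2 ^ (n + 1)" using j by (intro power_increasing) auto
      then have small: "x < 2 ^ L" if "x < 2 ^ Suc j" for x :: nat using less_word(12)[of x] that by linarith
      have step: "m' ''lv'' 0 * 2 + l div 2 ^ (n - j) mod 2 < 2 ^ Suc j" using lv(1) by simp
      have zero: "l div 2 ^ (n - j) = 0" if "\<not> n - j < bits l"
      proof -
        have "l < 2 ^ bits l" by (rule less_two_power_bits)
        also have "\<dots> \<le> 2 ^ (n - j)" using that by (intro power_increasing) auto
        finally show ?thesis by simp
      qed
      have nw: "n - j < 2 ^ L" by (rule less_word(3)) simp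
      show ?thesis unfolding body_def
      proof (rule wp_Seq, rule wp_Put[OF b'])
        define m2 where "m2 = update m' ''u'' 0 (n - j)"
        have m2: "update m' ''u'' (val (Const 0) m') (val (V ''n'' \<^bold>- V ''j'') m') = m2"
          by (simp add: m2_def input_values[OF inp'] j')
        assume "bounded_memory L (update m' ''u'' (val (Const 0) m') (val (V ''n'' \<^bold>- V ''j'') m'))"
        then have b2: "bounded_memory L m2" unfolding m2 .
        have inp2: "input_ok m2" using inp' by (simp add: m2_def)
        have vals: "m2 ''u'' 0 = n - j" "m2 ''lv'' 0 = m' ''lv'' 0" by (simp_all add: m2_def)
        show "wp L 1 (Cond (Get ''l'' (V ''u'')) (''lv'' ::= V ''lv'' \<^bold>* Const 2 \<^bold>+ (Get ''l'' (V ''u'') \<^bold>- Const 1)) Skip)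
          (\<lambda>m'' w''. I (Suc j) (update m'' ''j'' 0 (Suc j)) w'') (update m' ''u'' (val (Const 0) m') (val (V ''n'' \<^bold>- V ''j'') m')) w'"
          unfolding m2
        proof (rule wp_Cond[OF b2])
          assume "val (Get ''l'' (V ''u'')) m2 \<noteq> 0"
          then have "n - j < bits l" by (simp add: vals input_values[OF inp2] split: if_splits)
          then have v: "val (V ''lv'' \<^bold>* Const 2 \<^bold>+ (Get ''l'' (V ''u'') \<^bold>- Const 1)) m2 = m' ''lv'' 0 * 2 + l div 2 ^ (n - j) mod 2"
            by (simp add: vals input_values[OF inp2])
          show "wp L 1 (''lv'' ::= V ''lv'' \<^bold>* Const 2 \<^bold>+ (Get ''l'' (V ''u'') \<^bold>- Const 1))
            (\<lambda>m'' w''. I (Suc j) (update m'' ''j'' 0 (Suc j)) w'') m2 w'"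
          proof (rule wp_Put[OF b2])
            show "val (V ''lv'' \<^bold>* Const 2 \<^bold>+ (Get ''l'' (V ''u'') \<^bold>- Const 1)) m2 < 2 ^ L"
              unfolding v by (rule small[OF step])
            show "I (Suc j) (update (update m2 ''lv'' (val (Const 0) m2) (val (V ''lv'' \<^bold>* Const 2 \<^bold>+ (Get ''l'' (V ''u'') \<^bold>- Const 1)) m2)) ''j'' 0 (Suc j)) w'"
              unfolding v using step lv(2) digit by (simp add: I_def)
          qed simp
        next
          assume "val (Get ''l'' (V ''u'')) m2 = 0"
          then have nb: "\<not> n - j < bits l" by (simp add: vals input_values[OF inp2] split: if_splits)
          show "wp L 1 Skip (\<lambda>m'' w''. I (Suc j) (update m'' ''j'' 0 (Suc j)) w'') m2 w'"
            by (rule wp_Skip[OF b2]) (use lv zero[OF nb] digit in \<open>auto simp: I_def vals\<close>)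
        qed simp
      qed (use nw in \<open>simp_all add: input_values[OF inp'] j'\<close>)
    qed
  qed (use b1 in \<open>auto simp: mods_body\<close>)
  show "wp L (Suc (n + 1) * 1) read_bound (\<lambda>m' w'. bits l \<le> n + 1 \<longrightarrow> m' ''lv'' 0 = l) m w"
    unfolding read_bound_def body_def[symmetric]
    by (intro wp_Seq wp_Put loop) (use b inp less_word(11)[of 0] in simp_all)
qed

end

section \<open>The dynamic program over the bags\<close>

abbreviation Ite :: "expr \<Rightarrow> expr \<Rightarrow> expr \<Rightarrow> expr" where
  "Ite c e f \<equiv> c \<^bold>* e \<^bold>+ (Const 1 \<^bold>- c) \<^bold>* f"

definition count_states :: com where
  "count_states = ''cnt'' ::= Const 1 ;; For ''v'' (V ''n'')
     (Cond (Get ''bags'' (V ''x'' \<^bold>* V ''n'' \<^bold>+ V ''v'')) (''cnt'' ::= V ''cnt'' \<^bold>* Const 6) Skip)"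

text \<open>Vertices are visited downwards because \<open>code\<close> gives the largest vertex the
  least significant digit.\<close>

definition decode_digit :: com where
  "decode_digit = ''u'' ::= V ''n'' \<^bold>- Const 1 \<^bold>- V ''v'' ;;
     Cond (Get ''bags'' (V ''x'' \<^bold>* V ''n'' \<^bold>+ V ''u''))
       (Put ''sig'' (V ''u'') (V ''r'' \<^bold>mod Const 6) ;; ''r'' ::= V ''r'' \<^bold>div Const 6) Skip"

definition decode :: com where
  "decode = ''r'' ::= V ''d'' ;; For ''v'' (V ''n'') decode_digit"

text \<open>For the parent of the root the row index is \<open>N\<close>, where the matrix of bags
  contains only zeros; the intersection is then empty and the key 0.\<close>

definition encode_digit :: "expr \<Rightarrow> expr \<Rightarrow> com" where
  "encode_digit e f = Cond (Get ''bags'' (e \<^bold>* V ''n'' \<^bold>+ V ''v'') \<^bold>* Get ''bags'' (f \<^bold>* V ''n'' \<^bold>+ V ''v''))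
     (''key'' ::= V ''key'' \<^bold>* Const 6 \<^bold>+ Get ''sig'' (V ''v'')) Skip"

definition encode :: "expr \<Rightarrow> expr \<Rightarrow> com" where
  "encode e f = ''key'' ::= Const 0 ;; For ''v'' (V ''n'') (encode_digit e f)"

text \<open>As \<open>Ite\<close> is arithmetic, both alternatives are always evaluated. This is
  harmless: every array can be read at any index, and the value not chosen is multiplied by 0. The
  entry of \<open>p2\<close> minus 1 is the factor \<open>sg\<close>.\<close>

definition vertex_expr :: expr where
  "vertex_expr = (let s = Get ''sig'' (V ''p'' \<^bold>mod V ''n'') in
     Ite (s \<^bold>< Const 2) (Const 1) (Ite (s \<^bold>< Const 4)
       ((Get ''p2'' (V ''n'' \<^bold>+ Const 1) \<^bold>- Const 1) \<^bold>* Get ''zp'' (Const 1)) (Get ''zp'' (Const 1))))"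

definition edge_expr :: expr where
  "edge_expr = (let s = Get ''sig'' (V ''p'' \<^bold>div V ''n''); t = Get ''sig'' (V ''p'' \<^bold>mod V ''n'') in
     Ite (s \<^bold>< Const 2) (Const 1) (Ite (t \<^bold>< Const 2) (Const 1)
       (Ite (s \<^bold>mod Const 2 \<^bold>= t \<^bold>mod Const 2)
         (Get ''zp'' (V ''D'') \<^bold>* (Const 1 \<^bold>+ Ite (Const 3 \<^bold>< s) (Ite (Const 3 \<^bold>< t)
            (Get ''zp'' (V ''D'' \<^bold>* V ''D'' \<^bold>+ V ''D'' \<^bold>* V ''D'' \<^bold>* V ''D'' \<^bold>* Get ''wt'' (V ''p''))) (Const 0)) (Const 0)))
         (Const 0))))"

definition pair_expr :: expr where
  "pair_expr = (let u = V ''p'' \<^bold>div V ''n''; v = V ''p'' \<^bold>mod V ''n'' in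
     Ite (u \<^bold>= v) vertex_expr (Ite (u \<^bold>< v) (Ite (Get ''graph'' (V ''p'')) edge_expr (Const 1)) (Const 1)))"

definition mult_factor :: com where
  "mult_factor = Cond (Get ''hm'' (V ''p'') \<^bold>= V ''x'')
     (''val'' ::= (V ''val'' \<^bold>* pair_expr) \<^bold>mod Get ''zp'' (V ''Q'')) Skip"

definition mult_factors :: com where
  "mult_factors = ''val'' ::= Const 1 ;; For ''p'' (V ''n'' \<^bold>* V ''n'') mult_factor"

definition mult_child :: com where
  "mult_child = Cond (Get ''par'' (V ''y'') \<^bold>= V ''x'')
     (encode (V ''y'') (V ''x'') ;;
      ''val'' ::= (V ''val'' \<^bold>* Get ''msg'' (V ''key'' \<^bold>* V ''nodes'' \<^bold>+ V ''y'')) \<^bold>mod Get ''zp'' (V ''Q'')) Skip"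

definition mult_children :: com where
  "mult_children = For ''y'' (V ''nodes'') mult_child"

text \<open>Distinct states with the same restriction to the parent add up in one entry; the memory,
  initially zero, provides the empty sums.\<close>

definition add_message :: com where
  "add_message = encode (V ''x'') (Get ''par'' (V ''x'')) ;;
     Put ''msg'' (V ''key'' \<^bold>* V ''nodes'' \<^bold>+ V ''x'')
       ((Get ''msg'' (V ''key'' \<^bold>* V ''nodes'' \<^bold>+ V ''x'') \<^bold>+ V ''val'') \<^bold>mod Get ''zp'' (V ''Q''))"

definition process_state :: com where
  "process_state = decode ;; mult_factors ;; mult_children ;; add_message"

definition process_node :: com where
  "process_node = ''x'' ::= Get ''ord'' (V ''nodes'' \<^bold>- Const 1 \<^bold>- V ''i'') ;; count_states ;;
     For ''d'' (V ''cnt'') process_state"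

definition process_nodes :: com where
  "process_nodes = For ''i'' (V ''nodes'') process_node"

lemma mods_encode [simp]: "mods (encode e f) = {''key'', ''v''}"
  by (auto simp: encode_def encode_digit_def)

lemma mods_process [simp]:
  "mods count_states = {''cnt'', ''v''}"
  "mods decode_digit = {''u'', ''sig'', ''r''}"
  "mods decode = {''r'', ''v'', ''u'', ''sig''}"
  "mods (encode_digit e f) = {''key''}"
  "mods mult_factor = {''val''}"
  "mods mult_factors = {''val'', ''p''}"
  "mods mult_child = {''key'', ''v'', ''val''}"
  "mods mult_children = {''key'', ''v'', ''val'', ''y''}"
  "mods add_message = {''key'', ''v'', ''msg''}"
  by (auto simp: count_states_def decode_def decode_digit_def encode_digit_def mult_factor_def
      mult_factors_def mult_child_def mult_children_def add_message_def)

lemma mods_process_state [simp]: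
  "mods process_state = {''r'', ''v'', ''u'', ''sig'', ''val'', ''p'', ''key'', ''y'', ''msg''}"
  by (auto simp: process_state_def)

lemma mods_process_node [simp]:
  "mods process_node = {''r'', ''v'', ''u'', ''sig'', ''val'', ''p'', ''key'', ''y'', ''msg'', ''x'', ''cnt'', ''d''}"
  by (auto simp: process_node_def)

lemma mods_process_nodes [simp]:
  "mods process_nodes = {''r'', ''v'', ''u'', ''sig'', ''val'', ''p'', ''key'', ''y'', ''msg'', ''x'', ''cnt'', ''d'', ''i''}"
  by (auto simp: process_nodes_def)

lemma card_Int_lessThan_Suc: "finite S \<Longrightarrow> v \<in> S \<Longrightarrow> card (S \<inter> {..<Suc v}) = Suc (card (S \<inter> {..<v}))"
proof -
  assume "finite S" "v \<in> S"
  then have "S \<inter> {..<Suc v} = insert v (S \<inter> {..<v})" by auto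
  then show ?thesis using \<open>finite S\<close> by simp
qed

lemma Int_lessThan_Suc_notin: "v \<notin> S \<Longrightarrow> S \<inter> {..<Suc v} = S \<inter> {..<v}"
  by (auto simp: less_Suc_eq)

context matching_instance
begin

lemma finite_bag [simp]: "finite (bag x)"
  by (rule finite_subset[OF bag_subset]) simp

lemma card_bag_le: "card (S \<inter> bag x) \<le> n" "card (bag x \<inter> S) \<le> n"
proof -
  have "card (bag x \<inter> S) \<le> card {..<n}" using bag_subset by (intro card_mono) auto
  then show "card (bag x \<inter> S) \<le> n" "card (S \<inter> bag x) \<le> n" by (simp_all add: Int_commute)
qed

lemma six_power_less_word: "k \<le> n \<Longrightarrow> 6 ^ k < (2::nat) ^ L"
  by (rule less_word(8)) (simp add: power_increasing)

lemma wp_count_states: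
  assumes b: "bounded_memory L m" and inp: "input_ok m" and x: "m ''x'' 0 = x" and J: "Suc n * 1 \<le> J"
  shows "wp L J count_states (\<lambda>m' w'. m' ''cnt'' 0 = 6 ^ card (bag x)) m w"
proof (rule wp_conseq[OF _ J])
  define body where "body = Cond (Get ''bags'' (V ''x'' \<^bold>* V ''n'' \<^bold>+ V ''v'')) (''cnt'' ::= V ''cnt'' \<^bold>* Const 6) Skip"
  define I where "I v m' (w' :: bool stream) \<longleftrightarrow> m' ''cnt'' 0 = 6 ^ card (bag x \<inter> {..<v})"
    for v and m' :: memory and w'
  have mods_body: "mods body = {''cnt''}" by (auto simp: body_def)
  have loop: "wp L (Suc n * 1) (For ''v'' (V ''n'') body) (\<lambda>m' w'. m' ''cnt'' 0 = 6 ^ card (bag x)) m1 w"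
    if b1: "bounded_memory L m1" and inp1: "input_ok m1" and init: "m1 ''cnt'' 0 = 1" and x1: "m1 ''x'' 0 = x" for m1
  proof (rule wp_For[where I = I])
    show "val (V ''n'') m1 = n" using inp1 by (simp add: input_values)
    show "n < 2 ^ L" by (rule less_word(3)) simp
    show "m' ''cnt'' 0 = 6 ^ card (bag x)" if "I n m' w'" for m' w'
      using that bag_subset[of x] by (simp add: I_def Int_absorb2)
    show "wp L 1 body (\<lambda>m'' w''. I (Suc v) (update m'' ''v'' 0 (Suc v)) w'') m' w'"
      if v: "v < n" and I: "I v m' w'" and b': "bounded_memory L m'" and v': "m' ''v'' 0 = v"
        and fr: "\<And>a. a \<notin> insert ''v'' (mods body) \<Longrightarrow> m' a = m1 a" for v m' w'
    proof -
      have inp': "input_ok m'" using inp1 by (rule input_ok_frame) (auto intro!: fr simp: mods_body)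
      have x': "m' ''x'' 0 = x" using fr[of "''x''"] x1 by (simp add: mods_body)
      have bound: "6 ^ card (bag x \<inter> {..<v}) * 6 < (2::nat) ^ L" if "v \<in> bag x"
        using six_power_less_word[OF card_bag_le(2)[of x "{..<Suc v}"]] that by (simp add: card_Int_lessThan_Suc mult.commute)
      show ?thesis unfolding body_def
        by (intro wp_Cond wp_Put wp_Skip b')
          (use I bound in \<open>auto simp: I_def input_values[OF inp'] v v' x' card_Int_lessThan_Suc Int_lessThan_Suc_notin\<close>)
    qed
  qed (use b1 init in \<open>auto simp: mods_body I_def\<close>)
  show "wp L (Suc n * 1) count_states (\<lambda>m' w'. m' ''cnt'' 0 = 6 ^ card (bag x)) m w"
    unfolding count_states_def body_def[symmetric]
    by (intro wp_Seq wp_Put loop) (use b inp x less_word(11)[of 1] in simp_all)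
qed

lemma wp_decode:
  assumes b: "bounded_memory L m" and inp: "input_ok m" and x: "m ''x'' 0 = x" and d: "m ''d'' 0 < 6 ^ card (bag x)"
    and J: "Suc n * 1 \<le> J"
  shows "wp L J decode (\<lambda>m' w'. code (bag x) (m' ''sig'') n = m ''d'' 0 \<and> (\<forall>u\<in>bag x. m' ''sig'' u < 6)) m w"
proof (rule wp_conseq[OF _ J])
  define d where "d = m ''d'' 0"
  \<comment> \<open>The digits of the vertices below \<open>n - v\<close> are still unknown, so the
    invariant speaks of all completions: a state that agrees with \<open>sig\<close> on the decoded
    vertices and has code \<open>r\<close> on the others has code \<open>d\<close>.\<close>
  define I where "I v m' (w' :: bool stream) \<longleftrightarrow> m' ''r'' 0 < 6 ^ card (bag x \<inter> {..<n - v}) \<and>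
      (\<forall>u\<in>bag x. n - v \<le> u \<longrightarrow> m' ''sig'' u < 6) \<and>
      (\<forall>\<sigma>. (\<forall>u\<in>bag x. n - v \<le> u \<longrightarrow> \<sigma> u = m' ''sig'' u) \<longrightarrow> code (bag x) \<sigma> (n - v) = m' ''r'' 0 \<longrightarrow> code (bag x) \<sigma> n = d)"
    for v and m' :: memory and w'
  have loop: "wp L (Suc n * 1) (For ''v'' (V ''n'') decode_digit)
      (\<lambda>m' w'. code (bag x) (m' ''sig'') n = d \<and> (\<forall>u\<in>bag x. m' ''sig'' u < 6)) m1 w"
    if b1: "bounded_memory L m1" and inp1: "input_ok m1" and init: "m1 ''r'' 0 = d" and x1: "m1 ''x'' 0 = x" for m1
  proof (rule wp_For[where I = I])
    show "val (V ''n'') m1 = n" using inp1 by (simp add: input_values)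
    show "n < 2 ^ L" by (rule less_word(3)) simp
    show "I 0 (update m1 ''v'' 0 0) w"
      using init assms(4) bag_subset[of x] by (auto simp: I_def d_def Int_absorb2)
    show "code (bag x) (m' ''sig'') n = d \<and> (\<forall>u\<in>bag x. m' ''sig'' u < 6)" if "I n m' w'" for m' w'
      using that by (simp add: I_def)
    show "wp L 1 decode_digit (\<lambda>m'' w''. I (Suc v) (update m'' ''v'' 0 (Suc v)) w'') m' w'"
      if v: "v < n" and I: "I v m' w'" and b': "bounded_memory L m'" and v': "m' ''v'' 0 = v"
        and fr: "\<And>a. a \<notin> insert ''v'' (mods decode_digit) \<Longrightarrow> m' a = m1 a" for v m' w'
    proof -
      have inp': "input_ok m'" using inp1 by (rule input_ok_frame) (auto intro!: fr)
      have x': "m' ''x'' 0 = x" using fr[of "''x''"] x1 by simp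
      define u where "u = n - Suc v"
      have nv: "n - v = Suc u" and un: "u < n" using v by (auto simp: u_def)
      have uw: "u < 2 ^ L" using un by (intro less_word(3)) simp
      have mw: "a mod 6 < 2 ^ L" for a :: nat
      proof -
        have "a mod 6 < 6" by simp
        also have "\<dots> \<le> 2 ^ L" using power_increasing[of 3 L "2::nat"] by (simp add: word_length_def)
        finally show ?thesis .
      qed
      have dw: "m' ''r'' 0 div 6 < 2 ^ L"
        using b' div_le_dividend[of "m' ''r'' 0" 6] unfolding bounded_memory_def by (meson le_less_trans)
      define m2 where "m2 = update m' ''u'' 0 u"
      have m2: "update m' ''u'' (val (Const 0) m') (val (V ''n'' \<^bold>- Const 1 \<^bold>- V ''v'') m') = m2"
        by (simp add: m2_def input_values[OF inp'] v' u_def)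
      have inp2: "input_ok m2" using inp' by (simp add: m2_def)
      have vals: "m2 ''u'' 0 = u" "m2 ''r'' = m' ''r''" "m2 ''sig'' = m' ''sig''" "m2 ''x'' 0 = x"
        by (simp_all add: m2_def x')
      show ?thesis unfolding decode_digit_def
      proof (rule wp_Seq, rule wp_Put[OF b'])
        assume "bounded_memory L (update m' ''u'' (val (Const 0) m') (val (V ''n'' \<^bold>- Const 1 \<^bold>- V ''v'') m'))"
        then have b2: "bounded_memory L m2" unfolding m2 .
        show "wp L 1 (Cond (Get ''bags'' (V ''x'' \<^bold>* V ''n'' \<^bold>+ V ''u''))
            (Put ''sig'' (V ''u'') (V ''r'' \<^bold>mod Const 6) ;; ''r'' ::= V ''r'' \<^bold>div Const 6) Skip)
          (\<lambda>m'' w''. I (Suc v) (update m'' ''v'' 0 (Suc v)) w'')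
          (update m' ''u'' (val (Const 0) m') (val (V ''n'' \<^bold>- Const 1 \<^bold>- V ''v'') m')) w'"
          unfolding m2
        proof (rule wp_Cond[OF b2])
          assume "val (Get ''bags'' (V ''x'' \<^bold>* V ''n'' \<^bold>+ V ''u'')) m2 \<noteq> 0"
          then have ub: "u \<in> bag x" by (simp add: vals input_values[OF inp2] un)
          define m3 where "m3 = update (update m2 ''sig'' u (m' ''r'' 0 mod 6)) ''r'' 0 (m' ''r'' 0 div 6)"
          have "I (Suc v) (update m3 ''v'' 0 (Suc v)) w'"
            unfolding I_def
          proof (intro conjI allI impI ballI)
            have "m' ''r'' 0 < 6 * 6 ^ card (bag x \<inter> {..<u})"
              using I unfolding I_def nv by (simp add: card_Int_lessThan_Suc ub)
            then show "update m3 ''v'' 0 (Suc v) ''r'' 0 < 6 ^ card (bag x \<inter> {..<n - Suc v})"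
              unfolding u_def[symmetric] by (simp add: m3_def)
            fix u' assume u': "u' \<in> bag x" "n - Suc v \<le> u'"
            show "update m3 ''v'' 0 (Suc v) ''sig'' u' < 6"
              using I u' unfolding I_def nv u_def[symmetric] by (cases "u' = u") (auto simp: m3_def vals)
          next
            fix \<sigma> assume ag: "\<forall>u\<in>bag x. n - Suc v \<le> u \<longrightarrow> \<sigma> u = update m3 ''v'' 0 (Suc v) ''sig'' u"
              and co: "code (bag x) \<sigma> (n - Suc v) = update m3 ''v'' 0 (Suc v) ''r'' 0"
            have su: "\<sigma> u = m' ''r'' 0 mod 6" using ag ub unfolding u_def[symmetric] by (simp add: m3_def)
            have "code (bag x) \<sigma> u = m' ''r'' 0 div 6" using co unfolding u_def[symmetric] by (simp add: m3_def)
            then have "code (bag x) \<sigma> (n - v) = m' ''r'' 0" unfolding nv using ub su by simp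
            moreover have "\<forall>u'\<in>bag x. n - v \<le> u' \<longrightarrow> \<sigma> u' = m' ''sig'' u'"
              using ag unfolding u_def[symmetric] nv by (auto simp: m3_def vals)
            ultimately show "code (bag x) \<sigma> n = d" using I unfolding I_def by blast
          qed
          then show "wp L 1 (Put ''sig'' (V ''u'') (V ''r'' \<^bold>mod Const 6) ;; ''r'' ::= V ''r'' \<^bold>div Const 6)
            (\<lambda>m'' w''. I (Suc v) (update m'' ''v'' 0 (Suc v)) w'') m2 w'"
            by (intro wp_Seq wp_Put b2) (simp_all add: vals mw dw m3_def)
        next
          assume "val (Get ''bags'' (V ''x'' \<^bold>* V ''n'' \<^bold>+ V ''u'')) m2 = 0"
          then have ub: "u \<notin> bag x" by (simp add: vals input_values[OF inp2] un)
          have ge: "n - v \<le> u' \<longleftrightarrow> n - Suc v \<le> u'" if "u' \<in> bag x" for u'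
            unfolding nv u_def[symmetric] using that ub by (cases "u' = u") auto
          have "I (Suc v) (update m2 ''v'' 0 (Suc v)) w'"
            using I unfolding I_def using ge ub
            by (simp add: nv u_def[symmetric] vals Int_lessThan_Suc_notin)
          then show "wp L 1 Skip (\<lambda>m'' w''. I (Suc v) (update m'' ''v'' 0 (Suc v)) w'') m2 w'"
            by (intro wp_Skip b2) simp_all
        qed simp
      qed (use uw in \<open>simp_all add: input_values[OF inp'] v' u_def\<close>)
    qed
  qed (use b1 in auto)
  have dL: "m ''d'' 0 < 2 ^ L" using b by (simp add: bounded_memory_def)
  show "wp L (Suc n * 1) decode (\<lambda>m' w'. code (bag x) (m' ''sig'') n = m ''d'' 0 \<and> (\<forall>u\<in>bag x. m' ''sig'' u < 6)) m w"
    unfolding decode_def d_def[symmetric]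
    by (intro wp_Seq wp_Put loop) (use b inp x dL in \<open>simp_all add: d_def\<close>)
qed

lemma wp_encode:
  assumes b: "bounded_memory L m" and inp: "input_ok m" and e: "val e m = x" "val f m = y"
    and reads: "''key'' \<notin> reads e \<union> reads f" "''v'' \<notin> reads e \<union> reads f"
    and sig: "\<And>u. u \<in> bag x \<Longrightarrow> u \<in> bag y \<Longrightarrow> m ''sig'' u < 6" and J: "Suc n * 1 \<le> J"
  shows "wp L J (encode e f) (\<lambda>m' w'. m' ''key'' 0 = code (bag x \<inter> bag y) (m ''sig'') n) m w"
proof (rule wp_conseq[OF _ J])
  define S where "S = bag x \<inter> bag y"
  define \<sigma> where "\<sigma> = m ''sig''"
  define I where "I v m' (w' :: bool stream) \<longleftrightarrow> m' ''key'' 0 = code S \<sigma> v"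
    for v and m' :: memory and w'
  have small: "code S \<sigma> v < 2 ^ L" if "v \<le> n" for v
  proof -
    have "code S \<sigma> v < 6 ^ card (S \<inter> {..<v})" by (rule code_less) (simp add: S_def \<sigma>_def sig)
    also have "\<dots> < 2 ^ L" unfolding S_def Int_assoc by (intro six_power_less_word card_bag_le)
    finally show ?thesis .
  qed
  have loop: "wp L (Suc n * 1) (For ''v'' (V ''n'') (encode_digit e f)) (\<lambda>m' w'. m' ''key'' 0 = code S \<sigma> n) m1 w"
    if b1: "bounded_memory L m1" and inp1: "input_ok m1" and init: "m1 ''key'' 0 = 0" and sig1: "m1 ''sig'' = \<sigma>"
      and e1: "val e m1 = x" "val f m1 = y" for m1
  proof (rule wp_For[where I = I])
    show "val (V ''n'') m1 = n" using inp1 by (simp add: input_values)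
    show "n < 2 ^ L" by (rule less_word(3)) simp
    show "wp L 1 (encode_digit e f) (\<lambda>m'' w''. I (Suc v) (update m'' ''v'' 0 (Suc v)) w'') m' w'"
      if v: "v < n" and I: "I v m' w'" and b': "bounded_memory L m'" and v': "m' ''v'' 0 = v"
        and fr: "\<And>a. a \<notin> insert ''v'' (mods (encode_digit e f)) \<Longrightarrow> m' a = m1 a" for v m' w'
    proof -
      have inp': "input_ok m'" using inp1 by (rule input_ok_frame) (auto intro!: fr)
      have "val e m' = val e m1" "val f m' = val f m1"
        using reads by (auto intro!: val_cong_reads fr)
      then have e': "val e m' = x" "val f m' = y" using e1 by simp_all
      have sig': "m' ''sig'' = \<sigma>" using fr[of "''sig''"] sig1 by simp
      have bound: "code S \<sigma> v * 6 + \<sigma> v < 2 ^ L" if "v \<in> S" using small[of "Suc v"] v that by simp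
      show ?thesis unfolding encode_digit_def
        by (intro wp_Cond wp_Put wp_Skip b')
          (use I bound in \<open>auto simp: I_def input_values[OF inp'] v v' e' sig' S_def\<close>)
    qed
  qed (use b1 init in \<open>auto simp: I_def\<close>)
  show "wp L (Suc n * 1) (encode e f) (\<lambda>m' w'. m' ''key'' 0 = code (bag x \<inter> bag y) (m ''sig'') n) m w"
    unfolding encode_def S_def[symmetric] \<sigma>_def[symmetric]
  proof (intro wp_Seq wp_Put loop)
    have "val e (update m ''key'' 0 0) = val e m" "val f (update m ''key'' 0 0) = val f m"
      using reads by (auto intro!: val_cong_reads)
    then show "val e (update m ''key'' (val (Const 0) m) (val (Const 0) m)) = x"
      "val f (update m ''key'' (val (Const 0) m) (val (Const 0) m)) = y" using e by simp_all
  qed (use b inp less_word(11)[of 0] in \<open>simp_all add: \<sigma>_def\<close>)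
qed

end

text \<open>The results of the preparatory phases become parameters: from here on they are read-only
  arrays, and \<open>static\<close> says that the memory still holds them.\<close>

locale dp_instance = matching_instance +
  fixes ord par hm wt :: "nat \<Rightarrow> nat"
  assumes ro: "rooted_order N F ord par" and home: "home_ok hm"
    and wt_less: "\<And>p. p < n * n \<Longrightarrow> wt p < D"
begin

abbreviation "md \<equiv> (2::nat) ^ (slot n * D ^ 4)"

abbreviation "pf \<equiv> pfac n E (2 ^ (n + 1) - 1) (2 ^ slot n) D wt"

definition loc :: "nat \<Rightarrow> (nat \<Rightarrow> nat) \<Rightarrow> nat" where
  "loc x \<sigma> = (\<Prod>p | p < n * n \<and> hm p = x. pf p \<sigma>)"

text \<open>The tables of all nodes are interleaved with stride \<open>N\<close>, so no table needs
  a length fixed in advance.\<close>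

definition messages :: "memory \<Rightarrow> nat \<Rightarrow> nat \<Rightarrow> nat" where
  "messages m x k = m ''msg'' (k * N + x)"

definition static :: "memory \<Rightarrow> bool" where
  "static m \<longleftrightarrow> input_ok m \<and> tables_ok m \<and> m ''ord'' = ord \<and> m ''par'' = par \<and> m ''hm'' = hm \<and> (\<forall>p<n * n. m ''wt'' p = wt p)"

definition static_arrays :: "string set" where
  "static_arrays = {''n'', ''graph'', ''l'', ''nodes'', ''tree'', ''bags'', ''D'', ''Q'', ''K'', ''p2'', ''zp'', ''ord'', ''par'', ''hm'', ''wt''}"

lemma static_frame:
  assumes "static m" "\<And>a. a \<in> static_arrays \<Longrightarrow> m' a = m a"
  shows "static m'"
  using assms by (simp add: static_def static_arrays_def tables_ok_def input_ok_def)

lemma static_update [simp]: "a \<notin> static_arrays \<Longrightarrow> static m \<Longrightarrow> static (update m a i k)"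
  by (erule static_frame) auto

lemma static_inputs: "static m \<Longrightarrow> input_ok m" by (simp add: static_def)

lemma static_values:
  assumes "static m"
  shows "m ''par'' = par" "m ''ord'' = ord" "m ''hm'' = hm" "p < n * n \<Longrightarrow> m ''wt'' p = wt p"
    "m ''D'' 0 = D" "m ''p2'' (Suc n) = 2 ^ Suc n" "m ''zp'' (Suc 0) = 2 ^ slot n" "m ''zp'' D = (2 ^ slot n) ^ D"
    "p < n * n \<Longrightarrow> m ''zp'' (D * D + D * D * D * wt p) = (2 ^ slot n) ^ (D ^ 2 + D ^ 3 * wt p)"
    "m ''zp'' (m ''Q'' 0) = md" "m ''n'' 0 = n" "m ''nodes'' 0 = N"
proof -
  have t: "tables_ok m" using assms by (simp add: static_def)
  have D1: "1 \<le> D" using radix_pos by simp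
  have D4: "D \<le> D ^ 4" using D1 by (simp add: self_le_power)
  show "m ''p2'' (Suc n) = 2 ^ Suc n" using t by (simp add: tables_ok_def slot_def)
  show "m ''zp'' (Suc 0) = 2 ^ slot n" "m ''zp'' D = (2 ^ slot n) ^ D" using t D4 D1 by (auto simp: tables_ok_def)
  show "m ''zp'' (D * D + D * D * D * wt p) = (2 ^ slot n) ^ (D ^ 2 + D ^ 3 * wt p)" if "p < n * n"
  proof -
    \<comment> \<open>The exponent of a chosen edge stays within the table of powers: with
      \<open>wt p < D\<close> it is at most \<open>D ^ 3 * Suc (wt p)\<close>, hence at most
      \<open>D ^ 4\<close>.\<close>
    have "D ^ 2 * 1 \<le> D ^ 2 * D" using D1 by (intro mult_le_mono2)
    then have "D ^ 2 + D ^ 3 * wt p \<le> D ^ 3 * Suc (wt p)" by (simp add: power3_eq_cube power2_eq_square)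
    also have "\<dots> \<le> D ^ 3 * D" using wt_less[OF that] by (intro mult_le_mono2) simp
    also have "\<dots> = D ^ 4" by (simp add: power3_eq_cube power4_eq_xxxx)
    finally have "D ^ 2 + D ^ 3 * wt p \<le> D ^ 4" .
    moreover have "D * D + D * D * D * wt p = D ^ 2 + D ^ 3 * wt p" by (simp add: power3_eq_cube power2_eq_square)
    ultimately show ?thesis using t by (simp add: tables_ok_def)
  qed
  show "m ''zp'' (m ''Q'' 0) = md" using t by (simp add: tables_ok_def power_mult)
qed (use assms in \<open>auto simp: static_def tables_ok_def input_values\<close>)

lemma val_pair_expr:
  assumes st: "static m" and p: "p < n * n" "m ''p'' 0 = p"
  shows "val pair_expr m = pf p (m ''sig'')"
proof -
  note sv = static_values[OF st]
  have v: "val vertex_expr m = vfac (2 ^ (n + 1) - 1) (2 ^ slot n) (m ''sig'' (p mod n))"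
    by (simp add: vertex_expr_def Let_def vfac_def p sv)
  have e: "val edge_expr m = efac ((2 ^ slot n) ^ D) ((2 ^ slot n) ^ (D ^ 2 + D ^ 3 * wt p)) (m ''sig'' (p div n)) (m ''sig'' (p mod n))"
    using sv(9)[OF p(1)] sv(4)[OF p(1)] by (simp add: edge_expr_def Let_def efac_def p sv(1-3,5-8,10-12))
  have g: "m ''graph'' p = of_bool (ends n p \<in> E)" using input_values(3)[OF static_inputs[OF st]] by (simp add: ends_def)
  have "val pair_expr m = (if p div n = p mod n then val vertex_expr m
     else if p div n < p mod n \<and> ends n p \<in> E then val edge_expr m else 1)"
    by (simp add: pair_expr_def Let_def p sv(11) g)
  then show ?thesis unfolding v e pfac_def .
qed

lemma wp_mult_factors:
  assumes b: "bounded_memory L m" and st: "static m" and x: "m ''x'' 0 = x" and J: "Suc (n * n) * 1 \<le> J"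
  shows "wp L J mult_factors (\<lambda>m' w'. m' ''val'' 0 = loc x (m ''sig'') mod md) m w"
proof (rule wp_conseq[OF _ J])
  define \<sigma> where "\<sigma> = m ''sig''"
  define I where "I k m' (w' :: bool stream) \<longleftrightarrow> m' ''val'' 0 = (\<Prod>p | p < k \<and> hm p = x. pf p \<sigma>) mod md"
    for k and m' :: memory and w'
  have loop: "wp L (Suc (n * n) * 1) (For ''p'' (V ''n'' \<^bold>* V ''n'') mult_factor) (\<lambda>m' w'. m' ''val'' 0 = loc x \<sigma> mod md) m1 w"
    if b1: "bounded_memory L m1" and st1: "static m1" and init: "m1 ''val'' 0 = 1" and x1: "m1 ''x'' 0 = x"
      and sig1: "m1 ''sig'' = \<sigma>" for m1
  proof (rule wp_For[where I = I])
    show "val (V ''n'' \<^bold>* V ''n'') m1 = n * n" using st1 by (simp add: static_values)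
    show "n * n < 2 ^ L" by (rule less_word(4)) simp
    show "I 0 (update m1 ''p'' 0 0) w" using init radix_pos by (simp add: I_def slot_def)
    show "m' ''val'' 0 = loc x \<sigma> mod md" if "I (n * n) m' w'" for m' w' using that by (simp add: I_def loc_def)
    show "wp L 1 mult_factor (\<lambda>m'' w''. I (Suc k) (update m'' ''p'' 0 (Suc k)) w'') m' w'"
      if k: "k < n * n" and I: "I k m' w'" and b': "bounded_memory L m'" and k': "m' ''p'' 0 = k"
        and fr: "\<And>a. a \<notin> insert ''p'' (mods mult_factor) \<Longrightarrow> m' a = m1 a" for k m' w'
    proof -
      have st': "static m'" using st1 by (rule static_frame) (auto intro!: fr simp: static_arrays_def)
      have x': "m' ''x'' 0 = x" using fr[of "''x''"] x1 by simp
      have sig': "m' ''sig'' = \<sigma>" using fr[of "''sig''"] sig1 by simp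
      have v: "val ((V ''val'' \<^bold>* pair_expr) \<^bold>mod Get ''zp'' (V ''Q'')) m' = (m' ''val'' 0 * pf k \<sigma>) mod md"
        using val_pair_expr[OF st' k k'] static_values(10)[OF st'] by (simp add: sig')
      have t: "val (Get ''hm'' (V ''p'') \<^bold>= V ''x'') m' = of_bool (hm k = x)"
        by (simp add: static_values[OF st'] k' x')
      show ?thesis unfolding mult_factor_def
      proof (rule wp_Cond[OF b'])
        assume "val (Get ''hm'' (V ''p'') \<^bold>= V ''x'') m' \<noteq> 0"
        then have hk: "hm k = x" unfolding t by simp
        then have "{p. p < Suc k \<and> hm p = x} = insert k {p. p < k \<and> hm p = x}" by auto
        then have "(\<Prod>p | p < Suc k \<and> hm p = x. pf p \<sigma>) = pf k \<sigma> * (\<Prod>p | p < k \<and> hm p = x. pf p \<sigma>)" by simp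
        then have eq: "(m' ''val'' 0 * pf k \<sigma>) mod md = (\<Prod>p | p < Suc k \<and> hm p = x. pf p \<sigma>) mod md"
          using I by (simp add: I_def mod_mult_left_eq mult.commute mod_mult_right_eq)
        have "(m' ''val'' 0 * pf k \<sigma>) mod md \<le> md" by (rule less_imp_le) simp
        then show "wp L 1 (''val'' ::= (V ''val'' \<^bold>* pair_expr) \<^bold>mod Get ''zp'' (V ''Q''))
            (\<lambda>m'' w''. I (Suc k) (update m'' ''p'' 0 (Suc k)) w'') m' w'"
          by (intro wp_Put b'; (simp only: v)?) (use less_word(10) eq in \<open>auto simp: I_def\<close>)
      next
        assume "val (Get ''hm'' (V ''p'') \<^bold>= V ''x'') m' = 0"
        then have "{p. p < Suc k \<and> hm p = x} = {p. p < k \<and> hm p = x}" unfolding t by (auto simp: less_Suc_eq)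
        then show "wp L 1 Skip (\<lambda>m'' w''. I (Suc k) (update m'' ''p'' 0 (Suc k)) w'') m' w'"
          using I by (intro wp_Skip b') (simp_all add: I_def)
      qed simp
    qed
  qed (use b1 in auto)
  show "wp L (Suc (n * n) * 1) mult_factors (\<lambda>m' w'. m' ''val'' 0 = loc x (m ''sig'') mod md) m w"
    unfolding mult_factors_def \<sigma>_def[symmetric]
    by (intro wp_Seq wp_Put loop) (use b st x less_word(11)[of 1] in \<open>simp_all add: static_arrays_def \<sigma>_def\<close>)
qed

lemma wp_mult_children:
  assumes b: "bounded_memory L m" and st: "static m" and x: "m ''x'' 0 = x"
    and sig: "\<And>u. u \<in> bag x \<Longrightarrow> m ''sig'' u < 6" and v0: "m ''val'' 0 = a mod md"
    and J: "Suc N * (Suc n * 1) \<le> J"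
  shows "wp L J mult_children (\<lambda>m' w'. m' ''val'' 0 =
     (a * (\<Prod>y\<in>children N par x. messages m y (code (bag y \<inter> bag x) (m ''sig'') n))) mod md) m w"
proof (rule wp_conseq[OF _ J])
  define \<sigma> where "\<sigma> = m ''sig''"
  define h where "h y = messages m y (code (bag y \<inter> bag x) \<sigma> n)" for y
  define I where "I k m' (w' :: bool stream) \<longleftrightarrow> m' ''val'' 0 = (a * (\<Prod>y | y < k \<and> par y = x. h y)) mod md"
    for k and m' :: memory and w'
  show "wp L (Suc N * (Suc n * 1)) mult_children (\<lambda>m' w'. m' ''val'' 0 =
     (a * (\<Prod>y\<in>children N par x. messages m y (code (bag y \<inter> bag x) (m ''sig'') n))) mod md) m w"
    unfolding mult_children_def \<sigma>_def[symmetric] h_def[symmetric]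
  proof (rule wp_For[where I = I])
    show "val (V ''nodes'') m = N" using st by (simp add: static_values)
    show "N < 2 ^ L" by (rule less_word(2)) simp
    show "I 0 (update m ''y'' 0 0) w" using v0 by (simp add: I_def)
    show "m' ''val'' 0 = (a * prod h (children N par x)) mod md" if "I N m' w'" for m' w'
      using that by (simp add: I_def children_def)
    show "wp L (Suc n * 1) mult_child (\<lambda>m'' w''. I (Suc k) (update m'' ''y'' 0 (Suc k)) w'') m' w'"
      if k: "k < N" and I: "I k m' w'" and b': "bounded_memory L m'" and k': "m' ''y'' 0 = k"
        and fr: "\<And>a. a \<notin> insert ''y'' (mods mult_child) \<Longrightarrow> m' a = m a" for k m' w'
    proof -
      have st': "static m'" using st by (rule static_frame) (auto intro!: fr simp: static_arrays_def)
      have x': "m' ''x'' 0 = x" using fr[of "''x''"] x by simp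
      have sig': "m' ''sig'' = \<sigma>" using fr[of "''sig''"] by (simp add: \<sigma>_def)
      have msg': "m' ''msg'' = m ''msg''" using fr[of "''msg''"] by simp
      have t: "val (Get ''par'' (V ''y'') \<^bold>= V ''x'') m' = of_bool (par k = x)"
        by (simp add: static_values[OF st'] k' x')
      show ?thesis unfolding mult_child_def
      proof (rule wp_Cond[OF b'])
        assume "val (Get ''par'' (V ''y'') \<^bold>= V ''x'') m' \<noteq> 0"
        then have pk: "par k = x" unfolding t by simp
        then have "{y. y < Suc k \<and> par y = x} = insert k {y. y < k \<and> par y = x}" by auto
        then have pr: "(\<Prod>y | y < Suc k \<and> par y = x. h y) = h k * (\<Prod>y | y < k \<and> par y = x. h y)" by simp
        show "wp L (Suc n * 1) (encode (V ''y'') (V ''x'') ;;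
          ''val'' ::= (V ''val'' \<^bold>* Get ''msg'' (V ''key'' \<^bold>* V ''nodes'' \<^bold>+ V ''y'')) \<^bold>mod Get ''zp'' (V ''Q''))
          (\<lambda>m'' w''. I (Suc k) (update m'' ''y'' 0 (Suc k)) w'') m' w'"
        proof (rule wp_Seq, rule wp_conseq[OF wp_encode[OF b' static_inputs[OF st'], where x = k and y = x] order_refl])
          fix m2 w2
          assume key: "m2 ''key'' 0 = code (bag k \<inter> bag x) (m' ''sig'') n" and b2: "bounded_memory L m2"
            and fr2: "\<And>a. a \<notin> mods (encode (V ''y'') (V ''x'')) \<Longrightarrow> m2 a = m' a"
          have st2: "static m2" using st' by (rule static_frame) (auto intro!: fr2 simp: static_arrays_def)
          have eqs: "m2 ''val'' 0 = m' ''val'' 0" "m2 ''msg'' = m ''msg''" "m2 ''y'' 0 = k"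
            using fr2[of "''val''"] fr2[of "''msg''"] fr2[of "''y''"] msg' k' by simp_all
          have v: "val ((V ''val'' \<^bold>* Get ''msg'' (V ''key'' \<^bold>* V ''nodes'' \<^bold>+ V ''y'')) \<^bold>mod Get ''zp'' (V ''Q'')) m2 =
             (m' ''val'' 0 * h k) mod md"
            using static_values(10,12)[OF st2] key by (simp add: eqs h_def messages_def sig')
          have "(m' ''val'' 0 * h k) mod md = (a * (\<Prod>y | y < k \<and> par y = x. h y)) * h k mod md"
            using I by (simp add: I_def mod_mult_left_eq)
          also have "\<dots> = (a * (\<Prod>y | y < Suc k \<and> par y = x. h y)) mod md" unfolding pr by (simp add: mult_ac)
          finally have eq: "(m' ''val'' 0 * h k) mod md = (a * (\<Prod>y | y < Suc k \<and> par y = x. h y)) mod md" .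
          have "(m' ''val'' 0 * h k) mod md \<le> md" by (rule less_imp_le) simp
          then show "wp L (Suc n * 1) (''val'' ::= (V ''val'' \<^bold>* Get ''msg'' (V ''key'' \<^bold>* V ''nodes'' \<^bold>+ V ''y'')) \<^bold>mod Get ''zp'' (V ''Q''))
            (\<lambda>m'' w''. I (Suc k) (update m'' ''y'' 0 (Suc k)) w'') m2 w2"
            by (intro wp_Put b2; (simp only: v)?) (use less_word(10) eq in \<open>auto simp: I_def\<close>)
        qed (use k' x' sig in \<open>auto simp: sig' \<sigma>_def\<close>)
      next
        assume "val (Get ''par'' (V ''y'') \<^bold>= V ''x'') m' = 0"
        then have "{y. y < Suc k \<and> par y = x} = {y. y < k \<and> par y = x}" unfolding t by (auto simp: less_Suc_eq)
        then show "wp L (Suc n * 1) Skip (\<lambda>m'' w''. I (Suc k) (update m'' ''y'' 0 (Suc k)) w'') m' w'"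
          using I by (intro wp_Skip b') (simp_all add: I_def)
      qed simp
    qed
  qed (use b in auto)
qed

lemma wp_add_message:
  assumes b: "bounded_memory L m" and st: "static m" and x: "m ''x'' 0 = x"
    and sig: "\<And>u. u \<in> bag x \<Longrightarrow> m ''sig'' u < 6" and v0: "m ''val'' 0 = a mod md"
    and J: "Suc n * 1 \<le> J"
  shows "wp L J add_message (\<lambda>m' w'. m' ''msg'' = (m ''msg'')(code (bag x \<inter> bag (par x)) (m ''sig'') n * N + x :=
     (messages m x (code (bag x \<inter> bag (par x)) (m ''sig'') n) + a) mod md)) m w"
  unfolding add_message_def
proof (rule wp_Seq, rule wp_conseq[OF wp_encode[OF b static_inputs[OF st], where x = x and y = "par x"] J])
  fix m2 w2
  assume key: "m2 ''key'' 0 = code (bag x \<inter> bag (par x)) (m ''sig'') n" and b2: "bounded_memory L m2"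
    and fr2: "\<And>a. a \<notin> mods (encode (V ''x'') (Get ''par'' (V ''x''))) \<Longrightarrow> m2 a = m a"
  have J0: "0 < J" using J by simp
  have st2: "static m2" using st by (rule static_frame) (auto intro!: fr2 simp: static_arrays_def)
  have eqs: "m2 ''val'' 0 = a mod md" "m2 ''msg'' = m ''msg''" "m2 ''x'' 0 = x"
    using fr2[of "''val''"] fr2[of "''msg''"] fr2[of "''x''"] x v0 by simp_all
  let ?k = "code (bag x \<inter> bag (par x)) (m ''sig'') n"
  have v: "val ((Get ''msg'' (V ''key'' \<^bold>* V ''nodes'' \<^bold>+ V ''x'') \<^bold>+ V ''val'') \<^bold>mod Get ''zp'' (V ''Q'')) m2 =
     (messages m x ?k + a) mod md"
    using static_values(10,12)[OF st2] key by (simp add: eqs messages_def mod_add_right_eq)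
  have i: "val (V ''key'' \<^bold>* V ''nodes'' \<^bold>+ V ''x'') m2 = ?k * N + x"
    using static_values(12)[OF st2] key by (simp add: eqs)
  have "(messages m x ?k + a) mod md \<le> md" by (rule less_imp_le) simp
  then show "wp L J (Put ''msg'' (V ''key'' \<^bold>* V ''nodes'' \<^bold>+ V ''x'')
       ((Get ''msg'' (V ''key'' \<^bold>* V ''nodes'' \<^bold>+ V ''x'') \<^bold>+ V ''val'') \<^bold>mod Get ''zp'' (V ''Q'')))
     (\<lambda>m' w'. m' ''msg'' = (m ''msg'')(?k * N + x := (messages m x ?k + a) mod md)) m2 w2"
    by (intro wp_Put b2 J0; (simp only: v i)?) (use less_word(10) in \<open>auto simp: eqs\<close>)
qed (use x sig in \<open>auto simp: static_values[OF st]\<close>)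

text \<open>Outside of \<open>bag x\<close> the array \<open>sig\<close> may hold leftovers of
  earlier states, so the state is described only by its code and its range on the bag. This is
  enough because \<open>node_value\<close> and the key depend on no other vertices.\<close>

lemma wp_process_state:
  assumes b: "bounded_memory L m" and st: "static m" and x: "m ''x'' 0 = x" and d: "m ''d'' 0 < 6 ^ card (bag x)"
    and J: "Suc N * (Suc n * 1) \<le> J" "Suc (n * n) * 1 \<le> J"
  shows "wp L J process_state (\<lambda>m' w'. \<exists>\<sigma>. code (bag x) \<sigma> n = m ''d'' 0 \<and> (\<forall>u\<in>bag x. \<sigma> u < 6) \<and>
    m' ''msg'' = (m ''msg'')(code (bag x \<inter> bag (par x)) \<sigma> n * N + x :=
     (messages m x (code (bag x \<inter> bag (par x)) \<sigma> n) + node_value n N par bag loc (messages m) x \<sigma>) mod md)) m w"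
proof -
  define Q where "Q m' \<longleftrightarrow> (\<exists>\<sigma>. code (bag x) \<sigma> n = m ''d'' 0 \<and> (\<forall>u\<in>bag x. \<sigma> u < 6) \<and>
    m' ''msg'' = (m ''msg'')(code (bag x \<inter> bag (par x)) \<sigma> n * N + x :=
     (messages m x (code (bag x \<inter> bag (par x)) \<sigma> n) + node_value n N par bag loc (messages m) x \<sigma>) mod md))"
    for m' :: memory
  have Jn: "Suc n * 1 \<le> J" using J(1) by (metis le_trans le_mult_pos(2) zero_less_Suc)
  show ?thesis
    unfolding process_state_def Q_def[symmetric]
  proof (rule wp_Seq, rule wp_conseq[OF wp_decode[OF b static_inputs[OF st] x d Jn] order_refl])
    fix m1 w1
    assume dec: "code (bag x) (m1 ''sig'') n = m ''d'' 0 \<and> (\<forall>u\<in>bag x. m1 ''sig'' u < 6)" and b1: "bounded_memory L m1"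
      and fr1: "\<And>a. a \<notin> mods decode \<Longrightarrow> m1 a = m a"
    define \<sigma> where "\<sigma> = m1 ''sig''"
    have st1: "static m1" using st by (rule static_frame) (auto intro!: fr1 simp: static_arrays_def)
    have x1: "m1 ''x'' 0 = x" and msg1: "m1 ''msg'' = m ''msg''" using fr1[of "''x''"] fr1[of "''msg''"] x by simp_all
    have sig6: "\<And>u. u \<in> bag x \<Longrightarrow> \<sigma> u < 6" using dec by (simp add: \<sigma>_def)
    show "wp L J (mult_factors ;; mult_children ;; add_message) (\<lambda>m' w'. Q m') m1 w1"
    proof (rule wp_Seq, rule wp_conseq[OF wp_mult_factors[OF b1 st1 x1 J(2)] order_refl])
      fix m2 w2
      assume v2: "m2 ''val'' 0 = loc x (m1 ''sig'') mod md" and b2: "bounded_memory L m2"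
        and fr2: "\<And>a. a \<notin> mods mult_factors \<Longrightarrow> m2 a = m1 a"
      have st2: "static m2" using st1 by (rule static_frame) (auto intro!: fr2 simp: static_arrays_def)
      have eq2: "m2 ''x'' 0 = x" "m2 ''msg'' = m ''msg''" "m2 ''sig'' = \<sigma>"
        using fr2[of "''x''"] fr2[of "''msg''"] fr2[of "''sig''"] x1 msg1 by (simp_all add: \<sigma>_def)
      have mes2: "messages m2 = messages m" by (intro ext) (simp add: messages_def eq2)
      have sig2: "\<And>u. u \<in> bag x \<Longrightarrow> m2 ''sig'' u < 6" using sig6 by (simp add: eq2)
      show "wp L J (mult_children ;; add_message) (\<lambda>m' w'. Q m') m2 w2"
      proof (rule wp_Seq, rule wp_conseq[OF wp_mult_children[OF b2 st2 eq2(1) sig2 v2 J(1)] order_refl])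
        fix m3 w3
        assume v3: "m3 ''val'' 0 = (loc x (m1 ''sig'') * (\<Prod>y\<in>children N par x. messages m2 y (code (bag y \<inter> bag x) (m2 ''sig'') n))) mod md"
          and b3: "bounded_memory L m3" and fr3: "\<And>a. a \<notin> mods mult_children \<Longrightarrow> m3 a = m2 a"
        have st3: "static m3" using st2 by (rule static_frame) (auto intro!: fr3 simp: static_arrays_def)
        have eq3: "m3 ''x'' 0 = x" "m3 ''msg'' = m ''msg''" "m3 ''sig'' = \<sigma>"
          using fr3[of "''x''"] fr3[of "''msg''"] fr3[of "''sig''"] eq2 by simp_all
        have mes3: "messages m3 = messages m" by (intro ext) (simp add: messages_def eq3)
        have v3': "m3 ''val'' 0 = node_value n N par bag loc (messages m) x \<sigma> mod md"
          using v3 unfolding mes2 eq2 node_value_def \<sigma>_def[symmetric] .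
        have sig3: "\<And>u. u \<in> bag x \<Longrightarrow> m3 ''sig'' u < 6" using sig6 by (simp add: eq3)
        show "wp L J add_message (\<lambda>m' w'. Q m') m3 w3"
        proof (rule wp_conseq[OF wp_add_message[OF b3 st3 eq3(1) sig3 v3' Jn] order_refl])
          fix m4 :: memory
          assume "m4 ''msg'' = (m3 ''msg'')(code (bag x \<inter> bag (par x)) (m3 ''sig'') n * N + x :=
            (messages m3 x (code (bag x \<inter> bag (par x)) (m3 ''sig'') n) + node_value n N par bag loc (messages m) x \<sigma>) mod md)"
          then show "Q m4"
            using dec unfolding eq3 mes3 Q_def by (intro exI[of _ \<sigma>]) (simp add: \<sigma>_def)
        qed
      qed
    qed
  qed
qed

lemma par_facts:
  assumes "j < N"
  shows "par (ord j) \<in> ord ` {..<j} \<or> N \<le> par (ord j) \<and> j = 0" "par (ord j) \<noteq> ord j" "ord j < N"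
    "i \<le> j \<Longrightarrow> par (ord i) \<noteq> ord j"
proof -
  have inj: "inj_on ord {..<N}" and im: "ord ` {..<N} = {..<N}" and p0: "par (ord 0) = N"
    and p: "\<And>j. 0 < j \<Longrightarrow> j < N \<Longrightarrow> par (ord j) \<in> ord ` {..<j}"
    using ro by (auto simp: rooted_order_def)
  show oN: "ord j < N" using im assms by auto
  show "par (ord j) \<in> ord ` {..<j} \<or> N \<le> par (ord j) \<and> j = 0" using p[of j] p0 assms by (cases "j = 0") auto
  have *: "par (ord i) \<noteq> ord j" if ij: "i \<le> j" for i
  proof (cases "i = 0")
    case True
    then show ?thesis using p0 oN by simp
  next
    case False
    then obtain k where "k < i" "par (ord i) = ord k" using p[of i] ij assms by auto
    moreover from this have "ord k \<noteq> ord j" using inj_onD[OF inj, of k j] ij assms by auto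
    ultimately show ?thesis by simp
  qed
  show "par (ord i) \<noteq> ord j" if "i \<le> j" using *[OF that] .
  show "par (ord j) \<noteq> ord j" using *[of j] by simp
qed

lemma vertex_in_bag:
  assumes "v < n"
  shows "\<exists>x<N. v \<in> bag x"
proof -
  have "\<forall>v\<in>verts G. \<exists>x\<in>verts T. v \<in> B x" using td by (simp add: tree_decomposition_def)
  moreover have "v \<in> verts G" using assms G by simp
  ultimately obtain x where "x \<in> verts T" "v \<in> B x" by blast
  then have "x < N" "v \<in> bag x" using VT by (simp_all add: bag_def)
  then show ?thesis by blast
qed

lemma edge_in_bag:
  assumes "e \<in> E"
  shows "\<exists>x<N. e \<subseteq> bag x"
proof -
  have "\<forall>e\<in>E. \<exists>x\<in>verts T. e \<subseteq> B x" using td by (simp add: tree_decomposition_def)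
  with assms obtain x where "x \<in> verts T" "e \<subseteq> B x" by blast
  then have "x < N" "e \<subseteq> bag x" using VT by (simp_all add: bag_def)
  then show ?thesis by blast
qed

text \<open>A factor that depends on the state belongs to a vertex or an edge. By the axioms of a
  tree decomposition its ends lie together in some bag, hence in the bag of its home
  \<open>x\<close>; all other factors are constantly 1.\<close>

lemma loc_cong:
  assumes "\<And>v. v \<in> bag x \<Longrightarrow> \<sigma> v = \<tau> v"
  shows "loc x \<sigma> = loc x \<tau>"
  unfolding loc_def
proof (rule prod.cong[OF refl])
  fix p assume "p \<in> {p. p < n * n \<and> hm p = x}"
  then have p: "p < n * n" "hm p = x" by auto
  then have "n \<noteq> 0" by (cases n) auto
  then have pn: "p mod n < n" by simp
  have sub: "ends n p \<subseteq> bag x" if "p div n = p mod n \<or> ends n p \<in> E"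
  proof -
    have "\<exists>x<N. ends n p \<subseteq> bag x"
      using that
    proof
      assume "p div n = p mod n"
      then show ?thesis using vertex_in_bag[OF pn] by (simp add: ends_def)
    qed (rule edge_in_bag)
    then show ?thesis using home p by (auto simp: home_ok_def)
  qed
  show "pf p \<sigma> = pf p \<tau>"
  proof (cases "p div n = p mod n \<or> ends n p \<in> E")
    case True
    with sub have "\<sigma> (p div n) = \<tau> (p div n)" "\<sigma> (p mod n) = \<tau> (p mod n)"
      by (auto intro!: assms simp: ends_def)
    then show ?thesis by (simp add: pfac_def)
  qed (simp add: pfac_def)
qed

lemma messages_update:
  assumes "x < N" "y < N"
  shows "messages (m''(''msg'' := (m ''msg'')(k * N + x := v))) y j =
    (if y = x \<and> j = k then v else messages m y j)"
proof -
  have "j * N + y = k * N + x \<longleftrightarrow> j = k \<and> y = x"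
  proof
    assume eq: "j * N + y = k * N + x"
    from arg_cong[OF eq, of "\<lambda>a. a mod N"] arg_cong[OF eq, of "\<lambda>a. a div N"] assms
    show "j = k \<and> y = x" by simp
  qed simp
  then show ?thesis by (auto simp: messages_def)
qed

text \<open>The only loop with exponentially many passes; each pass costs the polynomial factor
  \<open>J\<close>. The counter \<open>d\<close> runs through the codes, and
  \<open>bij_betw_code\<close> turns the sum over codes into the sum over states that makes up the
  message.\<close>

lemma wp_states_loop:
  assumes b: "bounded_memory L m" and st: "static m" and x: "m ''x'' 0 = x" "x < N" "par x \<noteq> x"
    and cnt: "m ''cnt'' 0 = 6 ^ card (bag x)" and zero: "\<And>k. messages m x k = 0"
    and J: "Suc N * (Suc n * 1) \<le> J" "Suc (n * n) * 1 \<le> J"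
  shows "wp L (Suc (6 ^ card (bag x)) * J) (For ''d'' (V ''cnt'') process_state) (\<lambda>m' w'.
     (\<forall>y k. y < N \<longrightarrow> y \<noteq> x \<longrightarrow> messages m' y k = messages m y k) \<and>
     (\<forall>k. messages m' x k = (\<Sum>\<rho> | \<rho> \<in> states (bag x) \<and> code (bag x \<inter> bag (par x)) \<rho> n = k.
        node_value n N par bag loc (messages m) x \<rho>) mod md)) m w"
proof -
  define f where "f = node_value n N par bag loc (messages m) x"
  define S where "S = bag x \<inter> bag (par x)"
  define dec where "dec = inv_into (states (bag x)) (\<lambda>\<sigma>. code (bag x) \<sigma> n)"
  note bij = bij_betw_code[OF bag_subset[of x]]
  have dec: "dec d \<in> states (bag x)" "code (bag x) (dec d) n = d" if "d < 6 ^ card (bag x)" for d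
    using bij_betw_apply[OF bij_betw_inv_into[OF bij], of d] bij_betw_inv_into_right[OF bij, of d] that
    by (auto simp: dec_def)
  have f_cong: "f \<sigma> = f \<tau>" if "\<And>v. v \<in> bag x \<Longrightarrow> \<sigma> v = \<tau> v" for \<sigma> \<tau>
  proof -
    have "code (bag y \<inter> bag x) \<sigma> n = code (bag y \<inter> bag x) \<tau> n" for y
      by (rule code_cong) (use that in auto)
    then show ?thesis unfolding f_def node_value_def using loc_cong[OF that] by simp
  qed
  define I where "I d m' (w' :: bool stream) \<longleftrightarrow> (\<forall>y k. y < N \<longrightarrow> y \<noteq> x \<longrightarrow> messages m' y k = messages m y k) \<and>
     (\<forall>k. messages m' x k = (\<Sum>d'<d. if code S (dec d') n = k then f (dec d') else 0) mod md)"
    for d and m' :: memory and w'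
  show ?thesis unfolding f_def[symmetric] S_def[symmetric]
  proof (rule wp_For[where I = I])
    show "6 ^ card (bag x) < (2::nat) ^ L" using card_bag_le(2)[of x UNIV] by (intro six_power_less_word) simp
    show "I 0 (update m ''d'' 0 0) w" using zero by (simp add: I_def messages_def)
    show "wp L J process_state (\<lambda>m'' w''. I (Suc d) (update m'' ''d'' 0 (Suc d)) w'') m' w'"
      if d: "d < 6 ^ card (bag x)" and I: "I d m' w'" and b': "bounded_memory L m'" and d': "m' ''d'' 0 = d"
        and fr: "\<And>a. a \<notin> insert ''d'' (mods process_state) \<Longrightarrow> m' a = m a" for d m' w'
    proof -
      have st': "static m'" using st by (rule static_frame) (auto intro!: fr simp: static_arrays_def)
      have x': "m' ''x'' 0 = x" using fr[of "''x''"] x by simp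
      have I1: "\<And>y k. y < N \<Longrightarrow> y \<noteq> x \<Longrightarrow> messages m' y k = messages m y k"
        and I2: "\<And>k. messages m' x k = (\<Sum>d'<d. if code S (dec d') n = k then f (dec d') else 0) mod md"
        using I by (auto simp: I_def)
      have nv: "node_value n N par bag loc (messages m') x \<sigma> = f \<sigma>" for \<sigma>
        unfolding f_def node_value_def
      proof (intro arg_cong2[where f = "(*)"] refl prod.cong)
        fix y assume "y \<in> children N par x"
        then have "y < N" "y \<noteq> x" using x(3) by (auto simp: children_def)
        then show "messages m' y (code (bag y \<inter> bag x) \<sigma> n) = messages m y (code (bag y \<inter> bag x) \<sigma> n)"
          by (rule I1)
      qed
      have dlt: "m' ''d'' 0 < 6 ^ card (bag x)" using d d' by simp
      show ?thesis
      proof (rule wp_conseq[OF wp_process_state[OF b' st' x' dlt J] order_refl])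
        fix m2 :: memory and w2 :: "bool stream"
        assume "\<exists>\<sigma>. code (bag x) \<sigma> n = m' ''d'' 0 \<and> (\<forall>u\<in>bag x. \<sigma> u < 6) \<and>
          m2 ''msg'' = (m' ''msg'')(code (bag x \<inter> bag (par x)) \<sigma> n * N + x :=
          (messages m' x (code (bag x \<inter> bag (par x)) \<sigma> n) + node_value n N par bag loc (messages m') x \<sigma>) mod md)"
        then obtain \<sigma> where \<sigma>: "code (bag x) \<sigma> n = d" "\<forall>u\<in>bag x. \<sigma> u < 6"
          "m2 ''msg'' = (m' ''msg'')(code S \<sigma> n * N + x := (messages m' x (code S \<sigma> n) + f \<sigma>) mod md)"
          unfolding nv S_def[symmetric] d' by blast
        have eq: "\<sigma> u = dec d u" if "u \<in> bag x" for u
        proof (rule code_inject[of n "bag x" \<sigma> "dec d" u])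
          show "code (bag x) \<sigma> n = code (bag x) (dec d) n" using dec(2)[OF d] \<sigma>(1) by simp
          show "u < n" using bag_subset that by auto
          show "dec d u < 6" if "u \<in> bag x" for u using dec(1)[OF d] that by (auto simp: states_def)
        qed (use \<sigma>(2) that in auto)
        have fe: "f \<sigma> = f (dec d)" by (rule f_cong) (rule eq)
        have ce: "code S \<sigma> n = code S (dec d) n" by (rule code_cong) (auto simp: S_def eq)
        have "update m2 ''d'' 0 (Suc d) ''msg'' = m2 ''msg''" by simp
        then have mes: "messages (update m2 ''d'' 0 (Suc d)) y j =
            (if y = x \<and> j = code S (dec d) n then (messages m' x j + f (dec d)) mod md else messages m' y j)" if "y < N" for y j
          using messages_update[OF x(2) that, of m2 m' "code S \<sigma> n" _ j] \<sigma>(3)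
          unfolding messages_def fe ce by auto
        show "I (Suc d) (update m2 ''d'' 0 (Suc d)) w2"
          unfolding I_def
        proof (intro conjI allI impI)
          show "messages (update m2 ''d'' 0 (Suc d)) y k = messages m y k" if "y < N" "y \<noteq> x" for y k
            unfolding mes[OF that(1)] using that I1 by simp
          show "messages (update m2 ''d'' 0 (Suc d)) x k =
             (\<Sum>d'<Suc d. if code S (dec d') n = k then f (dec d') else 0) mod md" for k
            unfolding mes[OF x(2)] I2 by (simp add: mod_add_left_eq)
        qed
      qed
    qed
    show "(\<forall>y k. y < N \<longrightarrow> y \<noteq> x \<longrightarrow> messages m' y k = messages m y k) \<and>
      (\<forall>k. messages m' x k = (\<Sum>\<rho> | \<rho> \<in> states (bag x) \<and> code S \<rho> n = k. f \<rho>) mod md)"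
      if I: "I (6 ^ card (bag x)) m' w'" for m' w'
    proof -
      have "(\<Sum>d'<6 ^ card (bag x). if code S (dec d') n = k then f (dec d') else 0) =
        (\<Sum>\<rho> | \<rho> \<in> states (bag x) \<and> code S \<rho> n = k. f \<rho>)" for k
      proof -
        have "(\<Sum>d'<6 ^ card (bag x). if code S (dec d') n = k then f (dec d') else 0) =
          (\<Sum>\<rho>\<in>states (bag x). if code S \<rho> n = k then f \<rho> else 0)"
          unfolding dec_def by (rule sum.reindex_bij_betw[OF bij_betw_inv_into[OF bij]])
        also have "\<dots> = (\<Sum>\<rho> | \<rho> \<in> states (bag x) \<and> code S \<rho> n = k. f \<rho>)"
          by (rule sum.inter_filter[symmetric]) simp
        finally show ?thesis .
      qed
      then show ?thesis using I unfolding I_def by simp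
    qed
  qed (use b cnt J in auto)
qed

abbreviation "psum m A \<equiv> partial_sum n N par bag loc (messages m) A"

text \<open>One application of \<open>partial_sum_step\<close>; the nodes before position
  \<open>N - Suc i\<close> of the order remain. That their entries are still 0 is carried along
  because messages are accumulated in place.\<close>

lemma wp_process_node:
  assumes b: "bounded_memory L m" and st: "static m" and i: "m ''i'' 0 = i" "i < N"
    and zero: "\<And>x k. x \<in> ord ` {..<N - i} \<Longrightarrow> messages m x k = 0"
    and card: "\<And>x. card (bag x) \<le> W" and J: "Suc N * (Suc n * 1) \<le> J" "Suc (n * n) * 1 \<le> J"
  shows "wp L (Suc (6 ^ W) * J) process_node (\<lambda>m' w'.
     psum m' (ord ` {..<N - Suc i}) mod md = psum m (ord ` {..<N - i}) mod md \<and>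
     (\<forall>x k. x \<in> ord ` {..<N - Suc i} \<longrightarrow> messages m' x k = 0)) m w"
proof -
  define j where "j = N - Suc i"
  define x where "x = ord j"
  have j: "j < N" "N - i = Suc j" using i by (auto simp: j_def)
  note pf = par_facts[OF j(1), folded x_def]
  have xw: "x < 2 ^ L" using pf(3) by (intro less_word(2)) simp
  have J0: "0 < Suc (6 ^ W) * J" using J by simp
  have Jn: "Suc n * 1 \<le> Suc (6 ^ W) * J"
  proof -
    have "Suc n * 1 \<le> J" using J(1) by (metis le_trans le_mult_pos(2) zero_less_Suc)
    also have "J \<le> Suc (6 ^ W) * J" by simp
    finally show ?thesis .
  qed
  define A where "A = ord ` {..<j}"
  have insA: "ord ` {..<N - i} = insert x A" unfolding j(2) A_def x_def by (simp add: lessThan_Suc)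
  have inj: "inj_on ord {..<N}" and im: "ord ` {..<N} = {..<N}" using ro by (auto simp: rooted_order_def)
  have xA: "x \<notin> A"
  proof
    assume "x \<in> A"
    then obtain k where "k < j" "ord k = ord j" unfolding A_def x_def by auto
    then show False using inj_onD[OF inj, of k j] j(1) by auto
  qed
  have AN: "A \<subseteq> {..<N}" using im j(1) by (auto simp: A_def)
  define m1 where "m1 = update m ''x'' 0 x"
  have m1: "update m ''x'' (val (Const 0) m) (val (Get ''ord'' (V ''nodes'' \<^bold>- Const 1 \<^bold>- V ''i'')) m) = m1"
    using static_values(2,12)[OF st] by (simp add: m1_def x_def j_def i)
  have v: "val (Get ''ord'' (V ''nodes'' \<^bold>- Const 1 \<^bold>- V ''i'')) m = x"
    using static_values(2,12)[OF st] by (simp add: x_def j_def i)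
  have mes1: "messages m1 = messages m" by (intro ext) (simp add: messages_def m1_def)
  show ?thesis unfolding process_node_def
  proof (rule wp_Seq, rule wp_Put[OF b J0])
    show "val (Get ''ord'' (V ''nodes'' \<^bold>- Const 1 \<^bold>- V ''i'')) m < 2 ^ L" unfolding v by (rule xw)
    assume "bounded_memory L (update m ''x'' (val (Const 0) m) (val (Get ''ord'' (V ''nodes'' \<^bold>- Const 1 \<^bold>- V ''i'')) m))"
    then have b1: "bounded_memory L m1" unfolding m1 .
    have st1: "static m1" using st by (simp add: m1_def static_arrays_def)
    have x1: "m1 ''x'' 0 = x" by (simp add: m1_def)
    show "wp L (Suc (6 ^ W) * J) (count_states ;; For ''d'' (V ''cnt'') process_state) (\<lambda>m' w'.
     psum m' (ord ` {..<N - Suc i}) mod md = psum m (ord ` {..<N - i}) mod md \<and>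
     (\<forall>x k. x \<in> ord ` {..<N - Suc i} \<longrightarrow> messages m' x k = 0))
      (update m ''x'' (val (Const 0) m) (val (Get ''ord'' (V ''nodes'' \<^bold>- Const 1 \<^bold>- V ''i'')) m)) w"
      unfolding m1 insA unfolding j_def[symmetric] A_def[symmetric]
    proof (rule wp_Seq, rule wp_conseq[OF wp_count_states[OF b1 static_inputs[OF st1] x1 Jn] order_refl])
      fix m2 w2
      assume cnt: "m2 ''cnt'' 0 = 6 ^ card (bag x)" and b2: "bounded_memory L m2"
        and fr2: "\<And>a. a \<notin> mods count_states \<Longrightarrow> m2 a = m1 a"
      have st2: "static m2" using st1 by (rule static_frame) (auto intro!: fr2 simp: static_arrays_def)
      have x2: "m2 ''x'' 0 = x" using fr2[of "''x''"] x1 by simp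
      have "m2 ''msg'' = m1 ''msg''" using fr2[of "''msg''"] by simp
      then have mes2: "messages m2 = messages m" unfolding mes1[symmetric] by (intro ext) (simp add: messages_def)
      have zero2: "messages m2 x k = 0" for k unfolding mes2 by (rule zero) (simp add: insA)
      have Jc: "Suc (6 ^ card (bag x)) * J \<le> Suc (6 ^ W) * J"
        using card[of x] by (intro mult_le_mono1) (simp add: power_increasing)
      show "wp L (Suc (6 ^ W) * J) (For ''d'' (V ''cnt'') process_state) (\<lambda>m' w'.
       psum m' A mod md = psum m (insert x A) mod md \<and> (\<forall>x k. x \<in> A \<longrightarrow> messages m' x k = 0)) m2 w2"
      proof (rule wp_conseq[OF wp_states_loop[OF b2 st2 x2 pf(3) pf(2) cnt zero2 J] Jc])
        fix m3 :: memory and w3 :: "bool stream"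
        assume m3: "(\<forall>y k. y < N \<longrightarrow> y \<noteq> x \<longrightarrow> messages m3 y k = messages m2 y k) \<and>
          (\<forall>k. messages m3 x k = (\<Sum>\<rho> | \<rho> \<in> states (bag x) \<and> code (bag x \<inter> bag (par x)) \<rho> n = k.
          node_value n N par bag loc (messages m2) x \<rho>) mod md)"
        have other: "messages m3 y k = messages m y k" if "y < N" "y \<noteq> x" for y k
          using m3 that unfolding mes2 by blast
        have new: "messages m3 x k = (\<Sum>\<rho> | \<rho> \<in> states (bag x) \<and> code (bag x \<inter> bag (par x)) \<rho> n = k.
          node_value n N par bag loc (messages m) x \<rho>) mod md" for k
          using m3 unfolding mes2 by blast
        show "psum m3 A mod md = psum m (insert x A) mod md \<and> (\<forall>x k. x \<in> A \<longrightarrow> messages m3 x k = 0)"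
        proof
          show "psum m3 A mod md = psum m (insert x A) mod md"
          proof (rule partial_sum_step)
            show "finite A" by (simp add: A_def)
            show "bag y \<subseteq> {..<n}" for y by (rule bag_subset)
            show "bag y = {}" if "N \<le> y" for y using that by (simp add: bag_def)
            show "par x \<in> A \<or> N \<le> par x \<and> A = {}" using pf(1) by (auto simp: A_def)
            show "par y \<noteq> x" if yA: "y \<in> A" for y
            proof -
              obtain k where "k < j" "y = ord k" using yA by (auto simp: A_def)
              then show ?thesis using pf(4)[of k] by simp
            qed
            show "bag x \<inter> \<Union>(bag ` A) \<subseteq> bag (par x)"
            proof
              fix u assume "u \<in> bag x \<inter> \<Union>(bag ` A)"
              then obtain k where k: "k < j" "u \<in> bag (ord k)" and ux: "u \<in> bag x" by (auto simp: A_def)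
              have "u \<in> B (par (ord j))"
                using running_intersection[OF td VT ro j(1) k(1), of u] k ux
                by (auto simp: bag_def x_def split: if_splits)
              moreover have "par (ord j) < N" using pf(1) k(1) AN unfolding x_def[symmetric] by (auto simp: A_def)
              ultimately show "u \<in> bag (par x)" by (simp add: bag_def x_def)
            qed
            show "loc y \<sigma> = loc y \<tau>" if "\<And>v. v \<in> bag y \<Longrightarrow> \<sigma> v = \<tau> v" for y \<sigma> \<tau> using that by (rule loc_cong)
            show "messages m3 x k mod md = (\<Sum>\<rho> | \<rho> \<in> states (bag x) \<and> code (bag x \<inter> bag (par x)) \<rho> n = k.
                node_value n N par bag loc (messages m) x \<rho>) mod md" for k unfolding new by simp
            show "messages m3 y = messages m y" if "y < N" "y \<noteq> x" for y using other that by blast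
          qed (use xA pf(3) AN in auto)
          show "\<forall>y k. y \<in> A \<longrightarrow> messages m3 y k = 0"
          proof (intro allI impI)
            fix y k assume "y \<in> A"
            then have "y < N" "y \<noteq> x" using AN xA by auto
            with \<open>y \<in> A\<close> show "messages m3 y k = 0" using other zero insA by auto
          qed
        qed
      qed
    qed
  qed
qed

text \<open>Homes partition the factors among the nodes, and the bags cover all vertices.\<close>

lemma Zsum_eq_psum: "psum m {..<N} = Zsum n E (2 ^ (n + 1) - 1) (2 ^ slot n) D wt"
  unfolding Zsum_def
proof (rule partial_sum_full)
  show "\<Union>(bag ` {..<N}) = {..<n}" using bag_subset vertex_in_bag by blast
  show "(\<Prod>x<N. loc x \<sigma>) = (\<Prod>p<n * n. pf p \<sigma>)" for \<sigma>
  proof -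
    have "hm ` {..<n * n} \<subseteq> {..<N}" using home by (auto simp: home_ok_def)
    from prod.group[OF _ _ this, of "\<lambda>p. pf p \<sigma>"] show ?thesis unfolding loc_def by simp
  qed
qed

text \<open>With all nodes remaining, the partial sum is the partition function; each round
  preserves it modulo \<open>md\<close>; with none remaining, it is the single entry of the root,
  whose parent has the empty bag. That entry has key 0 and is stored at
  \<open>0 * N + ord 0\<close>.\<close>

lemma wp_process_nodes:
  assumes b: "bounded_memory L m" and st: "static m" and zero: "m ''msg'' = (\<lambda>_. 0)"
    and card: "\<And>x. card (bag x) \<le> W" and J: "Suc N * (Suc n * 1) \<le> J" "Suc (n * n) * 1 \<le> J"
    and J': "Suc N * (Suc (6 ^ W) * J) \<le> J'"
  shows "wp L J' process_nodes (\<lambda>m' w'. m' ''msg'' (ord 0) mod md = Zsum n E (2 ^ (n + 1) - 1) (2 ^ slot n) D wt mod md) m w"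
proof (rule wp_conseq[OF _ J'])
  define I where "I i m' (w' :: bool stream) \<longleftrightarrow> psum m' (ord ` {..<N - i}) mod md = Zsum n E (2 ^ (n + 1) - 1) (2 ^ slot n) D wt mod md \<and>
     (\<forall>x k. x \<in> ord ` {..<N - i} \<longrightarrow> messages m' x k = 0)"
    for i and m' :: memory and w'
  have im: "ord ` {..<N} = {..<N}" using ro by (auto simp: rooted_order_def)
  have upd: "messages (update m' ''i'' 0 v) = messages m'" for m' v
    by (intro ext) (simp add: messages_def)
  show "wp L (Suc N * (Suc (6 ^ W) * J)) process_nodes
    (\<lambda>m' w'. m' ''msg'' (ord 0) mod md = Zsum n E (2 ^ (n + 1) - 1) (2 ^ slot n) D wt mod md) m w"
    unfolding process_nodes_def
  proof (rule wp_For[where I = I])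
    show "val (V ''nodes'') m = N" using st by (simp add: static_values)
    show "N < 2 ^ L" by (rule less_word(2)) simp
    show "I 0 (update m ''i'' 0 0) w"
      unfolding I_def diff_zero im Zsum_eq_psum upd using zero by (simp add: messages_def)
    show "wp L (Suc (6 ^ W) * J) process_node (\<lambda>m'' w''. I (Suc i) (update m'' ''i'' 0 (Suc i)) w'') m' w'"
      if i: "i < N" and I: "I i m' w'" and b': "bounded_memory L m'" and i': "m' ''i'' 0 = i"
        and fr: "\<And>a. a \<notin> insert ''i'' (mods process_node) \<Longrightarrow> m' a = m a" for i m' w'
    proof -
      have st': "static m'" using st by (rule static_frame) (auto intro!: fr simp: static_arrays_def)
      have z: "\<And>x k. x \<in> ord ` {..<N - i} \<Longrightarrow> messages m' x k = 0" using I by (simp add: I_def)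
      show ?thesis
        by (rule wp_conseq[OF wp_process_node[OF b' st' i' i z card J] order_refl])
          (use I in \<open>auto simp only: I_def upd\<close>)
    qed
    show "m' ''msg'' (ord 0) mod md = Zsum n E (2 ^ (n + 1) - 1) (2 ^ slot n) D wt mod md" if "I N m' w'" for m' w'
    proof -
      have "{y. y < N \<and> N \<le> par y} = {ord 0}"
      proof (rule set_eqI)
        fix y
        show "y \<in> {y. y < N \<and> N \<le> par y} \<longleftrightarrow> y \<in> {ord 0}"
        proof
          assume y: "y \<in> {y. y < N \<and> N \<le> par y}"
          then have "y \<in> ord ` {..<N}" unfolding im by simp
          then obtain j where j: "j < N" "y = ord j" "N \<le> par (ord j)" using y by auto
          have "ord ` {..<j} \<subseteq> {..<N}" using im j(1) by auto
          then have "j = 0" using par_facts(1)[OF j(1)] j(3) by auto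
          with j show "y \<in> {ord 0}" by simp
        next
          assume "y \<in> {ord 0}"
          then show "y \<in> {y. y < N \<and> N \<le> par y}" using par_facts(1,3)[of 0] N_pos by auto
        qed
      qed
      moreover have "bag (par (ord 0)) = {}" using par_facts(1)[OF N_pos] by (auto simp: bag_def)
      ultimately have "psum m' {} = messages m' (ord 0) 0" by (rule partial_sum_empty)
      then show ?thesis using that by (simp add: I_def messages_def)
    qed
  qed (use b J in auto)
qed

end

text \<open>The test \<open>found\<close> as one number: 0/1 conditions times a residue of the
  coefficient, nonzero exactly on success. Cell 0 of \<open>ord\<close> is the root, so the look-up
  in \<open>msg\<close> yields its only entry; the condition on cell \<open>n + 1\<close> of
  \<open>l\<close> rejects a bound too long to have been read.\<close>

definition key_expr :: expr where
  "key_expr = (let a = V ''q'' \<^bold>mod V ''D''; b = V ''q'' \<^bold>div V ''D'' \<^bold>mod V ''D'';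
     c = V ''q'' \<^bold>div (V ''D'' \<^bold>* V ''D'') \<^bold>mod V ''D'' in
     (a \<^bold>= Const 2 \<^bold>* c) \<^bold>* ((Const 1 \<^bold>- (a \<^bold>< V ''lv'')) \<^bold>* ((b \<^bold>< V ''n'' \<^bold>+ Const 1) \<^bold>*
     ((Get ''l'' (V ''n'' \<^bold>+ Const 1) \<^bold>= Const 0) \<^bold>*
      (Get ''msg'' (V ''ord'') \<^bold>mod Get ''zp'' (V ''Q'') \<^bold>div Get ''zp'' (V ''q'') \<^bold>mod
       Get ''p2'' (V ''n'' \<^bold>- b \<^bold>+ Const 1))))))"

definition test_key :: com where
  "test_key = Cond key_expr (''out'' ::= Const 1) Skip"

definition search :: com where
  "search = For ''q'' (V ''Q'') test_key"

definition decision_program :: com where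
  "decision_program = setup_weight_range ;; setup_tables ;; draw_weights ;; read_bound ;; order_nodes ;;
     assign_homes ;; process_nodes ;; search"

lemma mods_search [simp]: "mods test_key = {''out''}" "mods search = {''q'', ''out''}"
  by (auto simp: search_def test_key_def)

lemma radix_square: "n * n < radix n"
proof -
  have "n * n \<le> n * n * 2 ^ weight_bits n" by (rule le_mult_pos) simp
  then show ?thesis unfolding radix_def by linarith
qed

context dp_instance
begin

lemma wp_search:
  assumes b: "bounded_memory L m" and st: "static m" and lv: "bits l \<le> n + 1 \<longrightarrow> m ''lv'' 0 = l"
    and out: "m ''out'' 0 = 0"
    and msg: "m ''msg'' (ord 0) mod md = Zsum n E (2 ^ (n + 1) - 1) (2 ^ slot n) D wt mod md"
    and wt: "\<And>M. M \<subseteq> pairs n E \<Longrightarrow> sum wt M < D" and J: "Suc (D ^ 4) * 1 \<le> J"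
  shows "wp L J search (\<lambda>m' w'. m' ''out'' 0 \<noteq> 0 \<longleftrightarrow> bits l \<le> n + 1 \<and> (\<exists>q<D ^ 4. found n E l D wt q)) m w"
proof (rule wp_conseq[OF _ J])
  note nD = radix_square[of n]
  define good where "good q \<longleftrightarrow> bits l \<le> n + 1 \<and> found n E l D wt q" for q
  define I where "I k m' (w' :: bool stream) \<longleftrightarrow> (m' ''out'' 0 \<noteq> 0 \<longleftrightarrow> (\<exists>q<k. good q))"
    for k and m' :: memory and w'
  show "wp L (Suc (D ^ 4) * 1) search (\<lambda>m' w'. m' ''out'' 0 \<noteq> 0 \<longleftrightarrow> bits l \<le> n + 1 \<and> (\<exists>q<D ^ 4. found n E l D wt q)) m w"
    unfolding search_def
  proof (rule wp_For[where I = I])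
    show "val (V ''Q'') m = D ^ 4" using st by (simp add: static_def tables_ok_def)
    show "D ^ 4 < 2 ^ L" by (rule less_word(6)) simp
    show "I 0 (update m ''q'' 0 0) w" using out by (simp add: I_def)
    show "m' ''out'' 0 \<noteq> 0 \<longleftrightarrow> bits l \<le> n + 1 \<and> (\<exists>q<D ^ 4. found n E l D wt q)" if "I (D ^ 4) m' w'" for m' w'
      using that by (auto simp: I_def good_def)
    show "wp L 1 test_key (\<lambda>m'' w''. I (Suc q) (update m'' ''q'' 0 (Suc q)) w'') m' w'"
      if q: "q < D ^ 4" and I: "I q m' w'" and b': "bounded_memory L m'" and q': "m' ''q'' 0 = q"
        and fr: "\<And>a. a \<notin> insert ''q'' (mods test_key) \<Longrightarrow> m' a = m a" for q m' w'
    proof -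
      have st': "static m'" using st by (rule static_frame) (auto intro!: fr simp: static_arrays_def)
      have t': "tables_ok m'" using st' by (simp add: static_def)
      have lv': "m' ''lv'' 0 = m ''lv'' 0" and msg': "m' ''msg'' = m ''msg''"
        using fr[of "''lv''"] fr[of "''msg''"] by simp_all
      define c where "c = q div D mod D"
      have zq: "m' ''zp'' q = (2 ^ slot n) ^ q" using t' q by (simp add: tables_ok_def)
      have p2: "m' ''p2'' (n - c + 1) = 2 ^ (n - c + 1)" using t' by (simp add: tables_ok_def slot_def)
      have lz: "m' ''l'' (Suc n) = 0 \<longleftrightarrow> bits l \<le> n + 1"
        using input_values(5)[OF static_inputs[OF st'], of "Suc n"] by (auto simp: not_less)
      have "m' ''msg'' (ord 0) mod md = Zsum n E (2 ^ (n + 1) - 1) (2 ^ slot n) D wt"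
        using msg Zsum_less[OF G nD wt] unfolding msg' by (simp add: power_mult)
      then have ex: "m' ''msg'' (ord 0) mod md div (2 ^ slot n) ^ q mod 2 ^ (n - c + 1) = coef n E D wt q mod 2 ^ (n - c + 1)"
        using coef_extract[OF G nD wt q, of "n - c + 1"] by (simp add: slot_def)
      note sv = static_values[OF st']
      have v: "val key_expr m' = of_bool (q mod D = 2 * (q div D ^ 2 mod D)) * ((1 - of_bool (q mod D < m ''lv'' 0)) *
          (of_bool (c < n + 1) * (of_bool (m' ''l'' (Suc n) = 0) *
          (m' ''msg'' (ord 0) mod md div (2 ^ slot n) ^ q mod 2 ^ (n - c + 1)))))"
        using p2 zq sv(10) by (simp add: key_expr_def Let_def q' sv(2,5,11) lv' c_def power2_eq_square)
      have iff: "val key_expr m' \<noteq> 0 \<longleftrightarrow> good q"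
        unfolding v ex good_def found_def lz c_def[symmetric] using lv by (auto simp: not_less)
      show ?thesis unfolding test_key_def
        by (intro wp_Cond wp_Put wp_Skip b')
          (use iff I less_word(11)[of 1] in \<open>auto simp: I_def less_Suc_eq\<close>)
    qed
  qed (use b in auto)
qed

end

section \<open>Running time, soundness and error probability\<close>

context matching_instance
begin

text \<open>A sum of iteration counts of the phases, hence an upper bound for each of them; the
  loops over nodes and over states of the dynamic program are multiplied in separately.\<close>

definition loop_bound :: nat where
  "loop_bound = Suc N * Suc n + Suc (n * n) + Suc (N * N) * Suc N + Suc N * Suc (n * n) + Suc (3 * n * n) +
     Suc (slot n) + Suc (D ^ 4) + Suc (n * n) * Suc (weight_bits n) + Suc (n + 1)"

definition accepting :: "bool stream \<Rightarrow> bool" where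
  "accepting w \<longleftrightarrow> bits l \<le> n + 1 \<and> (\<exists>q<D ^ 4. found n E l D (weights w) q)"

lemma wp_decision_program:
  assumes card: "\<And>x. card (bag x) \<le> W"
  shows "wp L (Suc N * (Suc (6 ^ W) * loop_bound)) decision_program (\<lambda>m' w'. m' ''out'' 0 \<noteq> 0 \<longleftrightarrow> accepting w)
     (instance_memory G l T B) w"
proof -
  define J where "J = Suc N * (Suc (6 ^ W) * loop_bound)"
  define m0 where "m0 = instance_memory G l T B"
  have "loop_bound \<le> J" unfolding J_def by simp
  then have JJ: "x \<le> loop_bound \<Longrightarrow> x \<le> J" for x by simp
  have Js: "Suc (N - 1) * (Suc (N * N) * 1) \<le> J" "Suc N * (Suc (n * n) * 1) \<le> J" "Suc (3 * n * n) * 1 \<le> J"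
    "Suc (slot n) * 1 \<le> J" "Suc (D ^ 4) * 1 \<le> J" "Suc (n * n) * (Suc (weight_bits n) * 1) \<le> J" "Suc (n + 1) * 1 \<le> J"
    by (rule JJ; use N_pos in \<open>simp add: loop_bound_def mult.commute\<close>)+
  have Jl: "Suc N * (Suc n * 1) \<le> loop_bound" "Suc (n * n) * 1 \<le> loop_bound"
    by (simp_all add: loop_bound_def)
  have zero: "m0 a = (\<lambda>_. 0)" if "a \<notin> {''n'', ''graph'', ''l'', ''nodes'', ''tree'', ''bags''}" for a
    using that by (simp add: m0_def instance_memory_def Let_def)
  have inp0: "input_ok m0" by (simp add: input_ok_def m0_def)
  have b0: "bounded_memory L m0"
  proof -
    have "m0 a i < 2 ^ L" for a i
    proof -
      have ops: "n < 2 ^ L" "N < 2 ^ L" "(0::nat) < 2 ^ L" "(1::nat) < 2 ^ L"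
        using less_word(2,3) less_word(11)[of 1] by simp_all
      have two: "1 + x mod 2 < 2 ^ L" for x :: nat
      proof -
        have "1 + x mod 2 < 2 ^ 2" by simp
        also have "(2::nat) ^ 2 \<le> 2 ^ L" by (intro power_increasing) (simp_all add: word_length_def)
        finally show ?thesis .
      qed
      show ?thesis using ops two G(2) VT by (auto simp: m0_def instance_memory_def Let_def)
    qed
    then show ?thesis by (simp add: bounded_memory_def word_length_def)
  qed
  have "wp L J decision_program (\<lambda>m' w'. m' ''out'' 0 \<noteq> 0 \<longleftrightarrow> accepting w) m0 w"
    unfolding decision_program_def
  proof (rule wp_Seq, rule wp_conseq[OF wp_setup_weight_range[OF b0 inp0 Js(3)] order_refl])
    fix m1 w1 assume r1: "range_ok m1" and b1: "bounded_memory L m1"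
      and fr1: "\<And>a. a \<notin> mods setup_weight_range \<Longrightarrow> m1 a = m0 a" and "flip_free setup_weight_range \<Longrightarrow> w1 = w"
    then have w1: "w1 = w" by simp
    have inp1: "input_ok m1" using inp0 by (rule input_ok_frame) (auto intro!: fr1)
    show "wp L J (setup_tables ;; draw_weights ;; read_bound ;; order_nodes ;; assign_homes ;; process_nodes ;; search)
      (\<lambda>m' w'. m' ''out'' 0 \<noteq> 0 \<longleftrightarrow> accepting w) m1 w1"
      unfolding w1
    proof (rule wp_Seq, rule wp_conseq[OF wp_setup_tables[OF b1 inp1 r1 Js(4,5)] order_refl])
      fix m2 w2 assume t2: "tables_ok m2" and b2: "bounded_memory L m2"
        and fr2: "\<And>a. a \<notin> mods setup_tables \<Longrightarrow> m2 a = m1 a" and "flip_free setup_tables \<Longrightarrow> w2 = w"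
      then have w2: "w2 = w" by simp
      have inp2: "input_ok m2" using inp1 by (rule input_ok_frame) (auto intro!: fr2)
      have r2: "range_ok m2" using r1 fr2[of "''k''"] fr2[of "''pw''"] by (simp add: range_ok_def)
      show "wp L J (draw_weights ;; read_bound ;; order_nodes ;; assign_homes ;; process_nodes ;; search)
        (\<lambda>m' w'. m' ''out'' 0 \<noteq> 0 \<longleftrightarrow> accepting w) m2 w2"
        unfolding w2
      proof (rule wp_Seq, rule wp_conseq[OF wp_draw_weights[OF b2 inp2 r2 Js(6)] order_refl])
        fix m3 w3 assume wt3: "\<forall>p<n * n. m3 ''wt'' p = weights w p" and b3: "bounded_memory L m3"
          and fr3: "\<And>a. a \<notin> mods draw_weights \<Longrightarrow> m3 a = m2 a"
        have inp3: "input_ok m3" using inp2 by (rule input_ok_frame) (auto intro!: fr3)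
        show "wp L J (read_bound ;; order_nodes ;; assign_homes ;; process_nodes ;; search)
          (\<lambda>m' w'. m' ''out'' 0 \<noteq> 0 \<longleftrightarrow> accepting w) m3 w3"
        proof (rule wp_Seq, rule wp_conseq[OF wp_read_bound[OF b3 inp3 Js(7)] order_refl])
          fix m4 w4 assume lv4: "bits l \<le> n + 1 \<longrightarrow> m4 ''lv'' 0 = l" and b4: "bounded_memory L m4"
            and fr4: "\<And>a. a \<notin> mods read_bound \<Longrightarrow> m4 a = m3 a"
          have inp4: "input_ok m4" using inp3 by (rule input_ok_frame) (auto intro!: fr4)
          have vis4: "m4 ''vis'' = (\<lambda>_. 0)"
            using fr4[of "''vis''"] fr3[of "''vis''"] fr2[of "''vis''"] fr1[of "''vis''"] zero[of "''vis''"] by simp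
          show "wp L J (order_nodes ;; assign_homes ;; process_nodes ;; search)
            (\<lambda>m' w'. m' ''out'' 0 \<noteq> 0 \<longleftrightarrow> accepting w) m4 w4"
          proof (rule wp_Seq, rule wp_conseq[OF wp_order_nodes[OF b4 inp4 vis4 Js(1)] order_refl])
            fix m5 w5 assume ro5: "rooted_order N F (m5 ''ord'') (m5 ''par'')" and b5: "bounded_memory L m5"
              and fr5: "\<And>a. a \<notin> mods order_nodes \<Longrightarrow> m5 a = m4 a"
            have inp5: "input_ok m5" using inp4 by (rule input_ok_frame) (auto intro!: fr5)
            have hm5: "m5 ''hm'' = (\<lambda>_. 0)"
              using fr5[of "''hm''"] fr4[of "''hm''"] fr3[of "''hm''"] fr2[of "''hm''"] fr1[of "''hm''"] zero[of "''hm''"] by simp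
            show "wp L J (assign_homes ;; process_nodes ;; search)
              (\<lambda>m' w'. m' ''out'' 0 \<noteq> 0 \<longleftrightarrow> accepting w) m5 w5"
            proof (rule wp_Seq, rule wp_conseq[OF wp_assign_homes[OF b5 inp5 hm5 Js(2)] order_refl])
              fix m6 w6 assume home6: "home_ok (m6 ''hm'')" and b6: "bounded_memory L m6"
                and fr6: "\<And>a. a \<notin> mods assign_homes \<Longrightarrow> m6 a = m5 a"
              have inp6: "input_ok m6" using inp5 by (rule input_ok_frame) (auto intro!: fr6)
              have m6_m2: "m6 a = m2 a" if "a \<in> {''D'', ''Q'', ''K'', ''p2'', ''zp''}" for a
                using that fr6[of a] fr5[of a] fr4[of a] fr3[of a] by auto
              have t6: "tables_ok m6" using t2 by (simp add: tables_ok_def m6_m2)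
              have wt6: "m6 ''wt'' = m3 ''wt''" using fr6[of "''wt''"] fr5[of "''wt''"] fr4[of "''wt''"] by simp
              have lv6: "bits l \<le> n + 1 \<longrightarrow> m6 ''lv'' 0 = l" using lv4 fr6[of "''lv''"] fr5[of "''lv''"] by simp
              have z6: "m6 a = (\<lambda>_. 0)" if "a \<in> {''msg'', ''out''}" for a
                using that fr6[of a] fr5[of a] fr4[of a] fr3[of a] fr2[of a] fr1[of a] zero[of a] by auto
              have wl: "weights w p < D" if p: "p < n * n" for p
              proof -
                have "weights w p < 2 ^ weight_bits n"
                  using binary_less[of "stake (weight_bits n) (sdrop (p * weight_bits n) w)"] p by (simp add: weights_eq)
                also have "\<dots> \<le> n * n * 2 ^ weight_bits n" using p by (intro le_mult_pos) linarith
                finally show ?thesis by (simp add: radix_def)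
              qed
              interpret dp: dp_instance n N G l T B "m6 ''ord''" "m6 ''par''" "m6 ''hm''" "weights w"
                by unfold_locales (use ro5 home6 wl fr6[of "''ord''"] fr6[of "''par''"] in simp_all)
              have st6: "dp.static m6" using inp6 t6 wt6 wt3 by (simp add: dp.static_def)
              show "wp L J (process_nodes ;; search) (\<lambda>m' w'. m' ''out'' 0 \<noteq> 0 \<longleftrightarrow> accepting w) m6 w6"
              proof (rule wp_Seq, rule wp_conseq[OF dp.wp_process_nodes[OF b6 st6 z6 card Jl] order_refl])
                show "Suc N * (Suc (6 ^ W) * loop_bound) \<le> J" by (simp add: J_def)
                fix m7 w7
                assume msg7: "m7 ''msg'' (m6 ''ord'' 0) mod 2 ^ (slot n * D ^ 4) =
                    Zsum n E (2 ^ (n + 1) - 1) (2 ^ slot n) D (weights w) mod 2 ^ (slot n * D ^ 4)"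
                  and b7: "bounded_memory L m7" and fr7: "\<And>a. a \<notin> mods process_nodes \<Longrightarrow> m7 a = m6 a"
                have st7: "dp.static m7" using st6 by (rule dp.static_frame) (auto intro!: fr7 simp: dp.static_arrays_def)
                have lv7: "bits l \<le> n + 1 \<longrightarrow> m7 ''lv'' 0 = l" using lv6 fr7[of "''lv''"] by simp
                have out7: "m7 ''out'' 0 = 0" using z6[of "''out''"] fr7[of "''out''"] by simp
                show "wp L J search (\<lambda>m' w'. m' ''out'' 0 \<noteq> 0 \<longleftrightarrow> accepting w) m7 w7"
                  unfolding accepting_def
                  by (rule dp.wp_search[OF b7 st7 lv7 out7 msg7 sum_weights_less Js(5)])
              qed simp
            qed
          qed
        qed
      qed
    qed
  qed
  then show ?thesis by (simp add: J_def m0_def)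
qed

lemma card_bag_width: "card (bag x) \<le> width T B + 1"
proof (cases "x < N")
  case True
  have "card (B x) \<le> Max ((\<lambda>x. card (B x)) ` verts T)" using True VT by (intro Max_ge) auto
  then show ?thesis using True by (simp add: bag_def width_def)
qed (simp add: bag_def)

text \<open>With \<open>s = n + N\<close> the word length is at most \<open>30000 * s ^ 18\<close>,
  governed by \<open>slot n * D ^ 4\<close> where \<open>D \<le> 8 * s ^ 4\<close>;
  \<open>loop_bound\<close> is at most \<open>5000 * s ^ 16\<close>, governed by
  \<open>D ^ 4\<close>; one more factor \<open>s\<close> is the loop over nodes. So 35 = 18 + 16 +
  1, and bags of size \<open>tw + 1\<close> cost only a constant factor over
  \<open>6 ^ tw\<close>.\<close>

lemma resource_bound:
  "L * (Suc N * (Suc (6 ^ (tw + 1)) * loop_bound)) \<le> 10 ^ 10 * 6 ^ tw * (n + N) ^ 35"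
proof -
  define s where "s = n + N"
  have s: "1 \<le> s" "n \<le> s" "N \<le> s" using N_pos by (simp_all add: s_def)
  have pw: "s ^ i \<le> s ^ j" if "i \<le> j" for i j using s that by (simp add: power_increasing)
  have nn: "n * n \<le> s ^ 2" "N * N \<le> s ^ 2" using s by (simp_all add: power2_eq_square mult_le_mono)
  have s2: "1 \<le> s ^ 2" using s by simp
  have wb: "2 ^ weight_bits n \<le> 7 * s ^ 2" using power_weight_bits_le[of "weight_bits n"] nn s2 by linarith
  have "n * n * 2 ^ weight_bits n \<le> s ^ 2 * (7 * s ^ 2)" using nn(1) wb by (rule mult_le_mono)
  also have "\<dots> = 7 * s ^ 4" by (simp flip: power_add)
  finally have "D \<le> 8 * s ^ 4" using pw[of 0 4] by (simp add: radix_def)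
  then have "D ^ 4 \<le> (8 * s ^ 4) ^ 4" by (rule power_mono) simp
  also have "\<dots> = 4096 * s ^ 16" by (simp add: power_mult_distrib flip: power_mult)
  finally have D4: "D ^ 4 \<le> 4096 * s ^ 16" .
  have n1: "n \<le> s ^ 2" "N \<le> s ^ 2" using s pw[of 1 2] by auto
  have sl: "slot n \<le> 6 * s ^ 2" unfolding slot_def using nn n1 s2 by linarith
  have "slot n * D ^ 4 \<le> 6 * s ^ 2 * (4096 * s ^ 16)" using sl D4 by (rule mult_le_mono)
  also have "\<dots> = 24576 * s ^ 18" by (simp flip: power_add)
  finally have "slot n * D ^ 4 \<le> 24576 * s ^ 18" .
  then have "L \<le> 30000 * s ^ 18"
    unfolding word_length_def using D4 n1 s2 pw[of 2 18] pw[of 16 18] by linarith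
  moreover have "loop_bound \<le> 5000 * s ^ 16"
  proof -
    have a: "Suc N \<le> 2 * s" "Suc n \<le> 2 * s" "Suc (n * n) \<le> 2 * s ^ 2" "Suc (N * N) \<le> 2 * s ^ 2"
      using s nn s2 by linarith+
    have "weight_bits n \<le> 3 * n * n" unfolding weight_bits_def by (rule bits_le_self)
    then have a5: "Suc (weight_bits n) \<le> 4 * s ^ 2" using nn s2 by linarith
    have "Suc N * Suc n \<le> 2 * s * (2 * s)" by (rule mult_le_mono[OF a(1,2)])
    then have b1: "Suc N * Suc n \<le> 4 * s ^ 2" by (simp add: power2_eq_square)
    have "Suc (N * N) * Suc N \<le> 2 * s ^ 2 * (2 * s)" by (rule mult_le_mono[OF a(4,1)])
    then have b2: "Suc (N * N) * Suc N \<le> 4 * s ^ 3" by (simp add: power3_eq_cube power2_eq_square)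
    have "Suc N * Suc (n * n) \<le> 2 * s * (2 * s ^ 2)" by (rule mult_le_mono[OF a(1,3)])
    then have b3: "Suc N * Suc (n * n) \<le> 4 * s ^ 3" by (simp add: power3_eq_cube power2_eq_square)
    have "Suc (n * n) * Suc (weight_bits n) \<le> 2 * s ^ 2 * (4 * s ^ 2)" by (rule mult_le_mono[OF a(3) a5])
    then have b4: "Suc (n * n) * Suc (weight_bits n) \<le> 8 * s ^ 4" by (simp flip: power_add)
    show ?thesis unfolding loop_bound_def
      using b1 b2 b3 b4 a D4 sl nn n1 s2 pw[of 2 16] pw[of 3 16] pw[of 4 16] by linarith
  qed
  moreover have "Suc N \<le> 2 * s" using s by linarith
  moreover have "Suc (6 ^ (tw + 1)) \<le> 7 * 6 ^ tw" by simp
  ultimately have "L * (Suc N * (Suc (6 ^ (tw + 1)) * loop_bound)) \<le>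
      30000 * s ^ 18 * (2 * s * (7 * 6 ^ tw * (5000 * s ^ 16)))"
    by (intro mult_le_mono)
  also have "\<dots> = 2100000000 * 6 ^ tw * s ^ 35"
    by (simp add: mult_ac flip: power_add power_Suc)
  also have "\<dots> \<le> 10 ^ 10 * 6 ^ tw * s ^ 35" by (intro mult_le_mono1) simp
  finally show ?thesis unfolding s_def .
qed

lemma decision_program_run:
  assumes "width T B = tw"
  obtains t m' w' where "exec decision_program (instance_memory G l T B, w) t (m', w')"
    "t \<le> tc decision_program * 10 ^ 10 * 6 ^ tw * (n + N) ^ 35" "m' ''out'' 0 \<noteq> 0 \<longleftrightarrow> accepting w"
proof -
  have "wp L (Suc N * (Suc (6 ^ (tw + 1)) * loop_bound)) decision_program (\<lambda>m' w'. m' ''out'' 0 \<noteq> 0 \<longleftrightarrow> accepting w)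
     (instance_memory G l T B) w"
    by (rule wp_decision_program) (use card_bag_width assms in simp)
  then obtain t m' w' where run: "exec decision_program (instance_memory G l T B, w) t (m', w')"
    and t: "t \<le> L * (tc decision_program * (Suc N * (Suc (6 ^ (tw + 1)) * loop_bound)))"
    and out: "m' ''out'' 0 \<noteq> 0 \<longleftrightarrow> accepting w"
    unfolding wp_def by blast
  have "L * (tc decision_program * (Suc N * (Suc (6 ^ (tw + 1)) * loop_bound))) =
     tc decision_program * (L * (Suc N * (Suc (6 ^ (tw + 1)) * loop_bound)))" by (simp only: mult_ac)
  also have "\<dots> \<le> tc decision_program * (10 ^ 10 * 6 ^ tw * (n + N) ^ 35)"
    by (rule mult_le_mono2) (rule resource_bound)
  finally have "t \<le> tc decision_program * 10 ^ 10 * 6 ^ tw * (n + N) ^ 35"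
    using t by (simp only: mult.assoc)
  then show ?thesis using run out that by blast
qed

text \<open>\<open>accepts\<close> asks for some accepting run; by determinism of
  \<open>exec\<close> it can only be the run provided by the verification.\<close>

lemma accepts_iff: "accepts decision_program (instance_memory G l T B) w \<longleftrightarrow> accepting w"
proof -
  obtain t m' w' where run: "exec decision_program (instance_memory G l T B, w) t (m', w')"
    and out: "m' ''out'' 0 \<noteq> 0 \<longleftrightarrow> accepting w"
    using decision_program_run[OF refl] by blast
  show ?thesis
  proof
    assume "accepts decision_program (instance_memory G l T B) w"
    then obtain t2 m2 w2 where "exec decision_program (instance_memory G l T B, w) t2 (m2, w2)" "m2 ''out'' 0 \<noteq> 0"
      unfolding accepts_def by blast
    with exec_deterministic[OF run] out show "accepting w" by blast
  next
    assume "accepting w"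
    then show "accepts decision_program (instance_memory G l T B) w"
      using run out unfolding accepts_def by blast
  qed
qed

lemma accepting_sound: "accepting w \<Longrightarrow> acyclic_matching G l"
  unfolding accepting_def using found_sound[OF G radix_square sum_weights_less] by blast

text \<open>Isolation of the matching family implies acceptance, so the success probability is at
  least that of isolation.\<close>

lemma prob_accepting:
  assumes "acyclic_matching G l"
  shows "measure coin_flips {w. accepting w} \<ge> 2 / 3"
proof -
  interpret prob_space coin_flips
    unfolding coin_flips_def by (intro prob_space.prob_space_stream_space measure_pmf.prob_space_axioms)
  obtain X where X: "X \<subseteq> {..<n}" "l \<le> card X" using assms G by (auto simp: acyclic_matching_def)
  \<comment> \<open>A solution has at most \<open>n\<close> vertices, so
    \<open>l \<le> n < 2 ^ (n + 1)\<close> passes the length test of the program.\<close>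
  have "card X \<le> n" using card_mono[OF _ X(1)] by simp
  moreover have "n + 1 < 2 ^ (n + 1)" by (rule less_exp)
  ultimately have "l < 2 ^ (n + 1)" using X(2) by linarith
  then have lb: "bits l \<le> n + 1" by (rule bits_le)
  let ?k = "weight_bits n"
  have eq: "{w. accepting w} = {w. stake (n * n * ?k) w \<in> {xs. bits l \<le> n + 1 \<and> (\<exists>q<D ^ 4. found n E l D (block ?k xs) q)}}"
    unfolding accepting_def weights_def by simp
  have meas: "{w. accepting w} \<in> sets coin_flips" unfolding eq by (rule measurable_stake_coin_flips)
  have "2 / 3 \<le> measure coin_flips {w. isolated (block ?k (stake (n * n * ?k) w)) (matching_family n G l)}"
  proof (rule prob_isolated)
    show "S \<subseteq> {..<n * n}" if "S \<in> matching_family n G l" for S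
      using that pairs_subset by (auto simp: matching_family_def)
    show "matching_family n G l \<noteq> {}"
      by (rule matching_family_nonempty[OF G radix_square sum_weights_less assms])
    show "3 * (n * n) \<le> 2 ^ ?k"
      using less_two_power_bits[of "3 * n * n"] by (simp add: weight_bits_def mult.assoc)
  qed
  also have "\<dots> \<le> measure coin_flips {w. accepting w}"
  proof (rule finite_measure_mono[OF _ meas], rule subsetI)
    fix w assume "w \<in> {w. isolated (block ?k (stake (n * n * ?k) w)) (matching_family n G l)}"
    then have "isolated (weights w) (matching_family n G l)" by (simp add: weights_def)
    from found_complete[OF G radix_square sum_weights_less this] lb
    show "w \<in> {w. accepting w}" by (simp add: accepting_def)
  qed
  finally show ?thesis .
qed

end

theorem theorem2:
  shows "\<exists>(P::com) (C::nat) (c::nat).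
    \<forall>(n::nat) (N::nat) (G::nat ugraph) (l::nat) (T::nat ugraph) (B::nat \<Rightarrow> nat set) (tw::nat).
      fin_ugraph G \<and> verts G = {..<n} \<and> l \<ge> 1 \<and>
      tree_decomposition G T B \<and> verts T = {..<N} \<and> width T B = tw \<longrightarrow>
        (\<forall>w. halts_within P (instance_memory G l T B) w (C * 6 ^ tw * (n + N) ^ c)) \<and>
        (\<forall>w. accepts P (instance_memory G l T B) w \<longrightarrow> acyclic_matching G l) \<and>
        (acyclic_matching G l \<longrightarrow>
           measure coin_flips {w \<in> space coin_flips. accepts P (instance_memory G l T B) w} \<ge> 1 - 1 / 3)"
proof (intro exI allI impI)
  fix n N :: nat and G :: "nat ugraph" and l :: nat and T :: "nat ugraph" and B :: "nat \<Rightarrow> nat set" and tw :: nat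
  assume asm: "fin_ugraph G \<and> verts G = {..<n} \<and> l \<ge> 1 \<and>
      tree_decomposition G T B \<and> verts T = {..<N} \<and> width T B = tw"
  then interpret matching_instance n N G l T B by unfold_locales auto
  have tw: "width T B = tw" using asm by simp
  show "(\<forall>w. halts_within decision_program (instance_memory G l T B) w
           (tc decision_program * 10 ^ 10 * 6 ^ tw * (n + N) ^ 35)) \<and>
        (\<forall>w. accepts decision_program (instance_memory G l T B) w \<longrightarrow> acyclic_matching G l) \<and>
        (acyclic_matching G l \<longrightarrow>
           measure coin_flips {w \<in> space coin_flips. accepts decision_program (instance_memory G l T B) w} \<ge> 1 - 1 / 3)"
  proof (intro conjI allI impI)
    fix w
    show "halts_within decision_program (instance_memory G l T B) w
           (tc decision_program * 10 ^ 10 * 6 ^ tw * (n + N) ^ 35)"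
      using decision_program_run[OF tw, of w] unfolding halts_within_def by blast
    show "acyclic_matching G l" if "accepts decision_program (instance_memory G l T B) w"
      using that accepting_sound unfolding accepts_iff by blast
  next
    assume "acyclic_matching G l"
    from prob_accepting[OF this]
    show "measure coin_flips {w \<in> space coin_flips. accepts decision_program (instance_memory G l T B) w} \<ge> 1 - 1 / 3"
      by (simp add: accepts_iff)
  qed
qed

end
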